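(* Let $K$ be an algebraically closed field of characteristic $p>0$, let $a$ be a closed point of $\mathbb{A}^2_K$ with coordinate ring $R$, fix a local flag $\mathcal F$ at $a$, and let $f\in R/R^p$ be nonzero. Assume that $f$ is neither monomial nor a quasi-monomial at $a$. Let $\pi$ be the blowup of $\mathbb{A}^2_K$ with center $a$ and exceptional divisor $E$, let $a'\in E$ be a closed point, equipped with the induced flag $\mathcal F'$, and let $f^*$ be the total transform of $f$ at $a'$. Then the invariant $j=(\mathrm{complicacy},\mathrm{dent})$ decreases lexicographically: $$(\mathrm{complicacy}_{a'}(f^* ),\mathrm{dent}_{a'}(f^* ))<_{lex}(\mathrm{complicacy}_a(f),\mathrm{dent}_a(f)).$$
   Context: Classes modulo $p$-th powers. Let $R^p$ be the subring of $p$-th powers of $R=K[y,z]$; similarly for charts of the blowup. Let $\widehat R_a$ be the completed local ring at a closed point $a$. Local coordinates at $a$ are a regular parameter system $(y,z)$ of $\widehat R_a$; they identify $\widehat R_a$ with $K[[y,z]]$. A nonzero class $f$ modulo $p$-th powers has a unique expansion $F=\sum c_{\alpha\beta}y^\alpha z^\beta\in K[[y,z]]$ with only exponents $(\alpha,\beta)\in\mathbb{N}^2\setminus p\mathbb{N}^2$. Flags. A local flag $\mathcal F$ at $a$ is a regular element (regular parameter) $h\in\widehat R_a$. Coordinates $(y,z)$ are subordinate to $\mathcal F$ if $z$ and $h$ generate the same ideal; $\mathcal C$ denotes the set of subordinate coordinates at $a$. The induced flag $\mathcal F'$ at $a'\in E$ is the strict transform $\mathcal F^s$ of $\mathcal F$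 if $a'\in E\cap\mathcal F^s$, and $E$ otherwise. The total transform $f^*$ at $a'$ is the class modulo $p$-th powers of the pullback of a representative of $f$ under $\pi$; in suitable subordinate coordinates it is given by $F(yz+tz,z)$, $t\in K$, or $F(y,yz)$. Measures of an expansion. The Newton polygon of $F\ne0$ is $N(F)=\mathrm{conv}(\mathrm{supp}(F)+\mathbb{R}_+^2)$; $A$ denotes its set of vertices $(\alpha,\beta)$ ($\alpha$ the $y$-exponent, $\beta$ the $z$-exponent). Put $\mathrm{ord}(F)=\min_A(\alpha+\beta)$, $\mathrm{ord}_y(F)=\min_A\alpha$, $\deg_y(F)=\max_A\alpha$, $\mathrm{ord}_z(F)=\min_A\beta$, $\deg_z(F)=\max_A\beta$, $\mathrm{width}(F)=\deg_z(F)-\mathrm{ord}_z(F)$, and $$\mathrm{shade}(F)=\mathrm{ord}(F)-\mathrm{ord}_y(F)-\mathrm{ord}_z(F).$$ If $N(F)$ is not a quadrant, $\mathrm{dent}(F)=(\mathrm{updent}(F),\mathrm{indent}(F))=(\alpha_1-\alpha_2,\beta_2-\beta_1)$, where $(\alpha_1,\beta_1),(\alpha_2,\beta_2)\in A$ are the vertices with highest and second highest first component. $F$ is adjacent if $\mathrm{ord}_y(F)=0$, close if $\mathrm{ord}_y(F)=1$, distant if $\mathrm{ord}_y(F)\geq2$. Fix constants $0<\varepsilon<\delta<1$. The defect of $F$ is: if $\mathrm{shade}(F)=\deg_y(F)-\mathrm{ord}_y(F)$, it is $1+\delta$ for $F$ adjacent, $\varepsilon$ for $F$ close, $0$ otherwise;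 if $\mathrm{shade}(F)=\deg_y(F)-\mathrm{ord}_y(F)-1$, it is $\delta$ for $F$ adjacent and $0$ otherwise; if $\mathrm{shade}(F)\le\deg_y(F)-\mathrm{ord}_y(F)-2$, it is $0$. Invariant. $\mathrm{shade}_a(f)=\min\{\mathrm{shade}(F):(y,z)\in\mathcal C\}$, $F$ being the expansion of $f$ in $(y,z)$. $\mathrm{defect}(F)$ takes the same value $\mathrm{defect}_a(f)$ for all $(y,z)\in\mathcal C$ with $\mathrm{shade}(F)=\mathrm{shade}_a(f)$, and $\mathrm{complicacy}_a(f)=\mathrm{shade}_a(f)-\mathrm{defect}_a(f)$. $\mathrm{dent}_a(f)=(\mathrm{updent}_a(f),\mathrm{indent}_a(f))$ is obtained by first minimizing $\mathrm{updent}(F)$ and then maximizing $\mathrm{indent}(F)$ over all $(y,z)\in\mathcal C$ with $\mathrm{shade}(F)=\mathrm{shade}_a(f)$. The invariant $j_a(f)=(\mathrm{complicacy}_a(f),\mathrm{dent}_a(f))$ is ordered lexicographically, first component most significant (and $\mathrm{dent}$ itself lexicographically, updent first). If the transform $f^*$ has Newton polygon a quadrant in coordinates realizing the shade, its dent is not needed: only complicacy is compared. Monomial and quasi-monomial. $f$ is monomial at $a$ if in some (not necessarily subordinate) local coordinates its expansion is $y^\alpha z^\beta$ times a unit. A series $F$ is a quasi-monomial if $\mathrm{width}(F)=1$ and $\mathrm{ord}_y(F)=0$; $f$ is called a quasi-monomial at $a$ if its expansion in some subordinate coordinates realizing the shade (i.e. with $\mathrm{shade}(F)=\mathrm{shade}_a(f)$)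 is a quasi-monomial. *)

theory Defs
  imports
    "HOL-Analysis.Polytope"
    "HOL-Computational_Algebra.Computational_Algebra"
begin

text \<open>
  Throughout, \<^typ>\<open>'k poly poly\<close> is the polynomial ring $K[y,z]$ and \<^typ>\<open>'k fps fps\<close> is
  $K[[y,z]]$. In both, the outer indeterminate is $y$ and the inner one is $z$.
  A closed point of the affine plane is a pair \<^typ>\<open>'k \<times> 'k\<close> ($K$ being algebraically closed);
  the completed local ring at $(a_1,a_2)$ is \<^typ>\<open>'k fps fps\<close>, its indeterminates standing
  for $y - a_1$ and $z - a_2$. A class in $R/R^p$ is given by a representing polynomial.
\<close>

subsection \<open>Polynomials and power series in two indeterminates\<close>

definition coeff2 :: "'k::zero fps fps \<Rightarrow> nat \<Rightarrow> nat \<Rightarrow> 'k" where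
  "coeff2 F \<alpha> \<beta> = fps_nth (fps_nth F \<alpha>) \<beta>"

definition fps_y :: "'k::comm_ring_1 fps fps" where
  "fps_y = fps_X"

definition fps_z :: "'k::comm_ring_1 fps fps" where
  "fps_z = fps_const fps_X"

definition const2 :: "'k::zero \<Rightarrow> 'k fps fps" where
  "const2 c = fps_const (fps_const c)"

definition poly_y :: "'k::comm_ring_1 poly poly" where
  "poly_y = [:0, 1:]"

definition poly_z :: "'k::comm_ring_1 poly poly" where
  "poly_z = [:[:0, 1:]:]"

text \<open>\<open>eval2 \<iota> g s t\<close> is $g(s,t)$, the scalars being mapped to the target ring by \<open>\<iota>\<close>.\<close>

definition eval2 :: "('k::zero \<Rightarrow> 'r::comm_ring_1) \<Rightarrow> 'k poly poly \<Rightarrow> 'r \<Rightarrow> 'r \<Rightarrow> 'r" where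
  "eval2 \<iota> g s t = poly (map_poly (\<lambda>q. poly (map_poly \<iota> q) t) g) s"

text \<open>
  \<open>subst2 F Y Z\<close> is $F(Y,Z)$ for $Y$, $Z$ without constant term. As $Y^\alpha Z^\beta$ then has
  order at least $\alpha+\beta$, only indices up to $i+j$ contribute to the coefficient at $(i,j)$.
\<close>

definition subst2 :: "'k::comm_ring_1 fps fps \<Rightarrow> 'k fps fps \<Rightarrow> 'k fps fps \<Rightarrow> 'k fps fps" where
  "subst2 F Y Z = Abs_fps (\<lambda>i. Abs_fps (\<lambda>j.
     \<Sum>\<alpha>\<le>i + j. \<Sum>\<beta>\<le>i + j. coeff2 F \<alpha> \<beta> * coeff2 (Y ^ \<alpha> * Z ^ \<beta>) i j))"

text \<open>The image of a polynomial in the completed local ring at the closed point \<open>a\<close>.\<close>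

definition germ :: "'k::comm_ring_1 \<times> 'k \<Rightarrow> 'k poly poly \<Rightarrow> 'k fps fps" where
  "germ a g = eval2 const2 g (const2 (fst a) + fps_y) (const2 (snd a) + fps_z)"

subsection \<open>Local coordinates, flags and expansions\<close>

definition max_ideal :: "'k::comm_ring_1 fps fps set" where
  "max_ideal = {F. coeff2 F 0 0 = 0}"

definition local_coordinates :: "('k::comm_ring_1 fps fps \<times> 'k fps fps) set" where
  "local_coordinates = {(Y, Z). {A * Y + B * Z | A B. True} = max_ideal}"

definition regular_parameter :: "'k::comm_ring_1 fps fps \<Rightarrow> bool" where
  "regular_parameter h \<longleftrightarrow> (\<exists>h'. (h', h) \<in> local_coordinates)"

definition subordinate :: "'k::comm_ring_1 fps fps \<Rightarrow> ('k fps fps \<times> 'k fps fps) set" where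
  "subordinate h = {(Y, Z) \<in> local_coordinates. {A * Z | A. True} = {A * h | A. True}}"

text \<open>
  The expansion, in the local coordinates $(Y,Z)$ at \<open>a\<close>, of the class of \<open>g\<close> modulo $p$-th powers.
\<close>

definition expansion ::
  "'k::field \<times> 'k \<Rightarrow> 'k fps fps \<times> 'k fps fps \<Rightarrow> 'k poly poly \<Rightarrow> 'k fps fps" where
  "expansion a c g = (THE F.
     (\<forall>\<alpha> \<beta>. CHAR('k) dvd \<alpha> \<and> CHAR('k) dvd \<beta> \<longrightarrow> coeff2 F \<alpha> \<beta> = 0) \<and>
     (\<exists>q. subst2 F (fst c) (snd c) = germ a g + q ^ CHAR('k)))"

subsection \<open>Measures of an expansion\<close>

definition newton_polygon :: "'k::zero fps fps \<Rightarrow> (real \<times> real) set" where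
  "newton_polygon F = convex hull
     {(real \<alpha> + s, real \<beta> + t) | \<alpha> \<beta> s t. coeff2 F \<alpha> \<beta> \<noteq> 0 \<and> 0 \<le> s \<and> 0 \<le> t}"

text \<open>The vertices belong to the support, hence are integral.\<close>

definition vertices :: "'k::zero fps fps \<Rightarrow> (nat \<times> nat) set" where
  "vertices F = {(\<alpha>, \<beta>). (real \<alpha>, real \<beta>) extreme_point_of newton_polygon F}"

definition is_quadrant :: "'k::zero fps fps \<Rightarrow> bool" where
  "is_quadrant F \<longleftrightarrow> (\<exists>\<alpha> \<beta>. newton_polygon F = {(s, t). \<alpha> \<le> s \<and> \<beta> \<le> t})"

definition ord :: "'k::zero fps fps \<Rightarrow> nat" where
  "ord F = Min ((\<lambda>(\<alpha>, \<beta>). \<alpha> + \<beta>) ` vertices F)"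

definition ord_y :: "'k::zero fps fps \<Rightarrow> nat" where
  "ord_y F = Min (fst ` vertices F)"

definition deg_y :: "'k::zero fps fps \<Rightarrow> nat" where
  "deg_y F = Max (fst ` vertices F)"

definition ord_z :: "'k::zero fps fps \<Rightarrow> nat" where
  "ord_z F = Min (snd ` vertices F)"

definition deg_z :: "'k::zero fps fps \<Rightarrow> nat" where
  "deg_z F = Max (snd ` vertices F)"

definition width :: "'k::zero fps fps \<Rightarrow> nat" where
  "width F = deg_z F - ord_z F"

text \<open>The natural-number subtractions here and below never truncate if $F \neq 0$.\<close>

definition shade :: "'k::zero fps fps \<Rightarrow> nat" where
  "shade F = ord F - ord_y F - ord_z F"

text \<open>
  First components of the vertices are pairwise distinct. \<open>alpha2\<close>, \<open>updent\<close> and \<open>indent\<close> are only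
  meaningful if there are two vertices, i.e.\ if the Newton polygon is not a quadrant.
\<close>

definition alpha1 :: "'k::zero fps fps \<Rightarrow> nat" where
  "alpha1 F = Max (fst ` vertices F)"

definition alpha2 :: "'k::zero fps fps \<Rightarrow> nat" where
  "alpha2 F = Max (fst ` vertices F - {alpha1 F})"

definition updent :: "'k::zero fps fps \<Rightarrow> nat" where
  "updent F = alpha1 F - alpha2 F"

definition indent :: "'k::zero fps fps \<Rightarrow> nat" where
  "indent F = (THE \<beta>. (alpha2 F, \<beta>) \<in> vertices F) - (THE \<beta>. (alpha1 F, \<beta>) \<in> vertices F)"

definition adjacent :: "'k::zero fps fps \<Rightarrow> bool" where
  "adjacent F \<longleftrightarrow> ord_y F = 0"

definition close :: "'k::zero fps fps \<Rightarrow> bool" where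
  "close F \<longleftrightarrow> ord_y F = 1"

definition defect :: "real \<Rightarrow> real \<Rightarrow> 'k::zero fps fps \<Rightarrow> real" where
  "defect \<epsilon> \<delta> F =
     (if shade F = deg_y F - ord_y F then
        (if adjacent F then 1 + \<delta> else if close F then \<epsilon> else 0)
      else if shade F + 1 = deg_y F - ord_y F then
        (if adjacent F then \<delta> else 0)
      else 0)"

subsection \<open>The invariant\<close>

definition shade_at :: "'k::field \<times> 'k \<Rightarrow> 'k fps fps \<Rightarrow> 'k poly poly \<Rightarrow> nat" where
  "shade_at a h f = (LEAST n. \<exists>c\<in>subordinate h. shade (expansion a c f) = n)"

definition realizing ::
  "'k::field \<times> 'k \<Rightarrow> 'k fps fps \<Rightarrow> 'k poly poly \<Rightarrow> ('k fps fps \<times> 'k fps fps) set" where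
  "realizing a h f = {c \<in> subordinate h. shade (expansion a c f) = shade_at a h f}"

text \<open>The defect of the expansion is the same for all coordinates realizing the shade.\<close>

definition defect_at ::
  "real \<Rightarrow> real \<Rightarrow> 'k::field \<times> 'k \<Rightarrow> 'k fps fps \<Rightarrow> 'k poly poly \<Rightarrow> real" where
  "defect_at \<epsilon> \<delta> a h f = (THE d. \<exists>c\<in>realizing a h f. defect \<epsilon> \<delta> (expansion a c f) = d)"

definition complicacy_at ::
  "real \<Rightarrow> real \<Rightarrow> 'k::field \<times> 'k \<Rightarrow> 'k fps fps \<Rightarrow> 'k poly poly \<Rightarrow> real" where
  "complicacy_at \<epsilon> \<delta> a h f = real (shade_at a h f) - defect_at \<epsilon> \<delta> a h f"

definition updent_at :: "'k::field \<times> 'k \<Rightarrow> 'k fps fps \<Rightarrow> 'k poly poly \<Rightarrow> nat" where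
  "updent_at a h f = (LEAST n. \<exists>c\<in>realizing a h f. updent (expansion a c f) = n)"

definition indent_at :: "'k::field \<times> 'k \<Rightarrow> 'k fps fps \<Rightarrow> 'k poly poly \<Rightarrow> nat" where
  "indent_at a h f = (GREATEST n. \<exists>c\<in>realizing a h f.
     updent (expansion a c f) = updent_at a h f \<and> indent (expansion a c f) = n)"

definition dent_at :: "'k::field \<times> 'k \<Rightarrow> 'k fps fps \<Rightarrow> 'k poly poly \<Rightarrow> nat \<times> nat" where
  "dent_at a h f = (updent_at a h f, indent_at a h f)"

definition quadrant_at :: "'k::field \<times> 'k \<Rightarrow> 'k fps fps \<Rightarrow> 'k poly poly \<Rightarrow> bool" where
  "quadrant_at a h f \<longleftrightarrow> (\<exists>c\<in>realizing a h f. is_quadrant (expansion a c f))"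

definition lex_less :: "((real \<times> nat \<times> nat) \<times> (real \<times> nat \<times> nat)) set" where
  "lex_less = {(x, y). x < y} <*lex*> less_than <*lex*> less_than"

subsection \<open>Monomials and quasi-monomials\<close>

definition monomial_at :: "'k::field \<times> 'k \<Rightarrow> 'k poly poly \<Rightarrow> bool" where
  "monomial_at a f \<longleftrightarrow> (\<exists>c\<in>local_coordinates. \<exists>\<alpha> \<beta> u.
     u dvd 1 \<and> expansion a c f = fps_y ^ \<alpha> * fps_z ^ \<beta> * u)"

definition quasi_monomial :: "'k::zero fps fps \<Rightarrow> bool" where
  "quasi_monomial F \<longleftrightarrow> width F = 1 \<and> ord_y F = 0"

definition quasi_monomial_at :: "'k::field \<times> 'k \<Rightarrow> 'k fps fps \<Rightarrow> 'k poly poly \<Rightarrow> bool" where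
  "quasi_monomial_at a h f \<longleftrightarrow> (\<exists>c\<in>realizing a h f. quasi_monomial (expansion a c f))"

subsection \<open>The point blowup\<close>

text \<open>
  The blowup of the plane in $a = (a_1,a_2)$ is covered by two affine planes, on which the blowup
  map is $(y,z) \mapsto (a_1 + yz, a_2 + z)$ resp. $(y,z) \mapsto (a_1 + y, a_2 + yz)$.
\<close>

datatype chart = Chart_Z | Chart_Y

fun chart_map :: "chart \<Rightarrow> 'k::comm_ring_1 poly poly \<times> 'k poly poly" where
  "chart_map Chart_Z = (poly_y * poly_z, poly_z)"
| "chart_map Chart_Y = (poly_y, poly_y * poly_z)"

fun exc_equation :: "chart \<Rightarrow> 'k::comm_ring_1 poly poly" where
  "exc_equation Chart_Z = poly_z"
| "exc_equation Chart_Y = poly_y"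

definition exc_points :: "chart \<Rightarrow> ('k::comm_ring_1 \<times> 'k) set" where
  "exc_points \<kappa> = {b. eval2 (\<lambda>x. x) (exc_equation \<kappa>) (fst b) (snd b) = 0}"

text \<open>The pullback of a polynomial to a chart of the blowup with center \<open>a\<close>.\<close>

definition total_transform ::
  "chart \<Rightarrow> 'k::comm_ring_1 \<times> 'k \<Rightarrow> 'k poly poly \<Rightarrow> 'k poly poly" where
  "total_transform \<kappa> a f = eval2 (\<lambda>x. [:[:x:]:]) f
     ([:[:fst a:]:] + fst (chart_map \<kappa>)) ([:[:snd a:]:] + snd (chart_map \<kappa>))"

text \<open>
  The map from the completed local ring at the center to the one at the exceptional point \<open>b\<close>.
\<close>

definition formal_pullback ::
  "chart \<Rightarrow> 'k::comm_ring_1 \<times> 'k \<Rightarrow> 'k fps fps \<Rightarrow> 'k fps fps" where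
  "formal_pullback \<kappa> b h = subst2 h (germ b (fst (chart_map \<kappa>))) (germ b (snd (chart_map \<kappa>)))"

text \<open>
  The equation of the strict transform at \<open>b\<close> (a unit if the strict transform misses \<open>b\<close>):
  the pullback divided by the highest possible power of the equation of the exceptional divisor.
\<close>

definition strict_transform ::
  "chart \<Rightarrow> 'k::comm_ring_1 \<times> 'k \<Rightarrow> 'k fps fps \<Rightarrow> 'k fps fps" where
  "strict_transform \<kappa> b h = (THE h'. \<exists>m.
     formal_pullback \<kappa> b h = germ b (exc_equation \<kappa>) ^ m * h' \<and>
     \<not> germ b (exc_equation \<kappa>) dvd h')"

definition induced_flag ::
  "chart \<Rightarrow> 'k::comm_ring_1 \<times> 'k \<Rightarrow> 'k fps fps \<Rightarrow> 'k fps fps" where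
  "induced_flag \<kappa> b h =
     (if strict_transform \<kappa> b h \<in> max_ideal then strict_transform \<kappa> b h
      else germ b (exc_equation \<kappa>))"

end

theory Submission
  imports Defs
begin

text \<open>
  Let $F$ be the expansion of $f$ in coordinates $(y,z)$ with $z$ defining the flag. By the implicit
  function theorem every subordinate coordinate system is, up to units, of the form $(y-g(z),z)$ with
  $g(0)=0$ (\<open>subordinate_param\<close>), and units do not change the Newton polygon. All invariants at $a$ are
  therefore read off from the single family $F(y+g(z),z)$ modulo $p$-th powers, denoted \<open>recoord g F\<close>.
  Along this family the order, \<open>ord_z\<close> and \<open>deg_y\<close> are constant (\<open>recoord_invariants\<close>). Hence the shade is
  realized exactly where \<open>ord_y\<close> is largest, and the defect depends on these constants only. If $f$ is
  not monomial, then no polygon of the family is a quadrant and \<open>deg_y\<close> is at least $2$.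

  If the strict transform of the flag passes through $a'$, then the pullback is $F(y,yz)$ in all
  subordinate coordinates. The new defect is nonnegative, so it suffices to bound the new shade, and
  the shade alone drops enough to absorb the old defect, the only exception being the
  quasi-monomials. When the complicacy is unchanged, the lowest form of $F$ is a single
  monomial whose $y$-exponent is \<open>ord_y\<close>, the polygon is sheared, and \<open>updent\<close> drops by \<open>indent\<close>
  (\<open>decrease_y\<close>).

  Otherwise, after a translation $y \mapsto y+tz$, the pullback is $F(yz,z)$, and the family at $a'$ is
  obtained from those members of the family at $a$ whose $g$ has no linear term. There are two cases.

  If the largest value of \<open>ord_y\<close> is not attained among these members, then the translation may
  increase the height of the polygon, but by Moh's bound by at most one (\<open>moh_bound\<close>: differentiate
  the lowest form, which removes the $p$-th powers, and count its zeros at $0$ and $t$). The loss in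
  \<open>ord_y\<close> makes the new series adjacent or close, or shortens it; since $\varepsilon<\delta$, the
  complicacy drops (\<open>decrease_z_dropping\<close>).

  If it is attained, the complicacy cannot increase, and it is unchanged only if the lowest form is the
  single monomial $y^d z^s$. Then the blowup shears the polygon: \<open>updent\<close> is preserved and \<open>indent\<close> drops by
  \<open>updent\<close> (\<open>blow_z_dent\<close>). To compare the optima over the two families, the members with a linear term
  in $g$ must be excluded; they have a bottom edge of slope one and are not better than $F$
  (\<open>recoord_slope_one\<close>). Finally the maximum defining the \<open>indent\<close> of a point exists, since arbitrarily
  steep bottom edges would converge to coordinates in which the polygon is a quadrant
  (\<open>not_arbitrarily_steep\<close>).
\<close>

section \<open>Power series in two indeterminates and substitution\<close>

lemma fps2_eqI: "(\<And>i j. coeff2 F i j = coeff2 G i j) \<Longrightarrow> F = G"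
  by (simp add: coeff2_def fps_eq_iff)

lemma coeff2_0 [simp]: "coeff2 0 i j = 0"
  by (simp add: coeff2_def)

lemma coeff2_1: "coeff2 1 i j = (if i = 0 \<and> j = 0 then 1 else 0)"
  by (simp add: coeff2_def)

lemma coeff2_add [simp]:
  fixes F G :: "'k::comm_ring_1 fps fps"
  shows "coeff2 (F + G) i j = coeff2 F i j + coeff2 G i j"
  by (simp add: coeff2_def)

lemma coeff2_diff [simp]:
  fixes F G :: "'k::comm_ring_1 fps fps"
  shows "coeff2 (F - G) i j = coeff2 F i j - coeff2 G i j"
  by (simp add: coeff2_def)

lemma coeff2_minus [simp]:
  fixes F :: "'k::comm_ring_1 fps fps"
  shows "coeff2 (- F) i j = - coeff2 F i j"
  by (simp add: coeff2_def)

lemma coeff2_sum [simp]: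
  fixes F :: "'a \<Rightarrow> 'k::comm_ring_1 fps fps"
  shows "coeff2 (\<Sum>x\<in>A. F x) i j = (\<Sum>x\<in>A. coeff2 (F x) i j)"
  by (simp add: coeff2_def fps_sum_nth)

lemma coeff2_const2: "coeff2 (const2 c) i j = (if i = 0 \<and> j = 0 then c else 0)"
  by (simp add: coeff2_def const2_def)

lemma coeff2_const2_mult [simp]:
  fixes F :: "'k::comm_ring_1 fps fps"
  shows "coeff2 (const2 c * F) i j = c * coeff2 F i j"
  by (simp add: coeff2_def const2_def)

lemma const2_hom:
  fixes c d :: "'k::comm_ring_1"
  shows "const2 (c + d) = const2 c + const2 d" "const2 (c * d) = const2 c * const2 d"
    "const2 (1 :: 'k) = 1" "const2 (0 :: 'k) = 0" "const2 (- c) = - const2 c"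
  by (auto simp: const2_def)

lemma coeff2_mult:
  fixes F G :: "'k::comm_ring_1 fps fps"
  shows "coeff2 (F * G) i j = (\<Sum>a\<le>i. \<Sum>b\<le>j. coeff2 F a b * coeff2 G (i - a) (j - b))"
  by (simp add: coeff2_def fps_mult_nth fps_sum_nth atLeast0AtMost)

lemma coeff2_monom_mult:
  fixes F :: "'k::comm_ring_1 fps fps"
  shows "coeff2 (fps_y ^ a * fps_z ^ b * F) i j =
    (if a \<le> i \<and> b \<le> j then coeff2 F (i - a) (j - b) else 0)"
proof -
  have "fps_y ^ a * fps_z ^ b * F = fps_X ^ a * (fps_const (fps_X ^ b) * F)"
    by (simp add: fps_y_def fps_z_def fps_const_power mult.assoc)
  then show ?thesis
    by (simp add: coeff2_def fps_X_power_mult_nth)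
qed

lemma coeff2_monom:
  "coeff2 (fps_y ^ a * fps_z ^ b :: 'k::comm_ring_1 fps fps) i j = (if i = a \<and> j = b then 1 else 0)"
  using coeff2_monom_mult[of a b "1::'k fps fps" i j] by (auto simp: coeff2_1)

lemma coeff2_fps_y: "coeff2 (fps_y :: 'k::comm_ring_1 fps fps) i j = (if i = 1 \<and> j = 0 then 1 else 0)"
  using coeff2_monom[of 1 0 i j, where 'k='k] by simp

lemma coeff2_fps_z: "coeff2 (fps_z :: 'k::comm_ring_1 fps fps) i j = (if i = 0 \<and> j = 1 then 1 else 0)"
  using coeff2_monom[of 0 1 i j, where 'k='k] by simp

definition order_ge :: "nat \<Rightarrow> 'k::zero fps fps \<Rightarrow> bool" where
  "order_ge n F \<longleftrightarrow> (\<forall>i j. i + j < n \<longrightarrow> coeff2 F i j = 0)"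

lemma order_ge_0 [simp]: "order_ge 0 F"
  by (simp add: order_ge_def)

lemma order_ge_diff: "order_ge n F \<Longrightarrow> order_ge n G \<Longrightarrow> order_ge n (F - G)"
  for F G :: "'k::comm_ring_1 fps fps"
  by (simp add: order_ge_def)

lemma order_ge_mono: "order_ge n F \<Longrightarrow> m \<le> n \<Longrightarrow> order_ge m F"
  by (simp add: order_ge_def)

lemma order_ge_mult:
  fixes F G :: "'k::comm_ring_1 fps fps"
  assumes "order_ge m F" "order_ge n G"
  shows "order_ge (m + n) (F * G)"
  unfolding order_ge_def coeff2_mult
proof (intro allI impI sum.neutral ballI)
  fix i j a b :: nat
  assume "i + j < m + n" "a \<in> {..i}" "b \<in> {..j}"
  then have "a + b < m \<or> (i - a) + (j - b) < n" by auto
  then show "coeff2 F a b * coeff2 G (i - a) (j - b) = 0"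
    using assms by (auto simp: order_ge_def)
qed

lemma order_ge_1_iff: "order_ge (Suc 0) F \<longleftrightarrow> F \<in> max_ideal"
  by (simp add: order_ge_def max_ideal_def)

lemma order_ge_power: "F \<in> max_ideal \<Longrightarrow> order_ge n (F ^ n)"
proof (induction n)
  case (Suc n)
  then show ?case using order_ge_mult[of 1 F n "F ^ n"] by (simp add: order_ge_1_iff)
qed simp

lemma order_ge_monom: "Y \<in> max_ideal \<Longrightarrow> Z \<in> max_ideal \<Longrightarrow> order_ge (a + b) (Y ^ a * Z ^ b)"
  by (intro order_ge_mult order_ge_power)

lemma order_ge_all_eq: "(\<And>n. order_ge n (F - G)) \<Longrightarrow> F = G"
  for F G :: "'k::comm_ring_1 fps fps"
proof (rule fps2_eqI)
  fix i j assume "\<And>n. order_ge n (F - G)"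
  then have "order_ge (Suc (i + j)) (F - G)" by blast
  then show "coeff2 F i j = coeff2 G i j" by (simp add: order_ge_def)
qed

definition trunc2 :: "nat \<Rightarrow> 'k::comm_ring_1 fps fps \<Rightarrow> 'k fps fps" where
  "trunc2 n F = (\<Sum>a\<le>n. \<Sum>b\<le>n. const2 (coeff2 F a b) * (fps_y ^ a * fps_z ^ b))"

lemma order_ge_trunc2: "order_ge (Suc n) (F - trunc2 n F)"
proof (unfold order_ge_def, intro allI impI)
  fix i j assume ij: "i + j < Suc n"
  have "coeff2 (trunc2 n F) i j = (\<Sum>a\<le>n. \<Sum>b\<le>n. if i = a \<and> j = b then coeff2 F a b else 0)"
    unfolding trunc2_def coeff2_sum
    by (intro sum.cong refl) (simp only: coeff2_const2_mult coeff2_monom, simp)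
  also have "\<dots> = (\<Sum>a\<le>n. if i = a then coeff2 F a j else 0)"
    using ij by (intro sum.cong refl) (auto)
  also have "\<dots> = coeff2 F i j" using ij by simp
  finally show "coeff2 (F - trunc2 n F) i j = 0" by simp
qed

definition lin_map :: "('k::comm_ring_1 fps fps \<Rightarrow> 'k fps fps) \<Rightarrow> bool" where
  "lin_map L \<longleftrightarrow> (\<forall>F G. L (F + G) = L F + L G) \<and>
     (\<forall>c F. L (const2 c * F) = const2 c * L F) \<and> (\<forall>n F. order_ge n F \<longrightarrow> order_ge n (L F))"

lemma lin_map_0: "lin_map L \<Longrightarrow> L 0 = 0"
  unfolding lin_map_def by (metis add_cancel_right_left add_0)

lemma lin_map_diff: "lin_map L \<Longrightarrow> L (F - G) = L F - L G"
  unfolding lin_map_def by (metis add_diff_cancel diff_add_cancel)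

lemma lin_map_sum: "lin_map L \<Longrightarrow> L (\<Sum>x\<in>A. F x) = (\<Sum>x\<in>A. L (F x))"
  by (induction A rule: infinite_finite_induct) (simp_all add: lin_map_0, simp add: lin_map_def)

text \<open>
  Such maps are determined by their values on monomials, because \<open>trunc2 n F\<close> approximates $F$ to any
  order. Every identity between substitutions below is reduced to monomials in this way.
\<close>

lemma lin_map_ext:
  assumes L: "lin_map L" "lin_map L'"
    and eq: "\<And>a b. L (fps_y ^ a * fps_z ^ b) = L' (fps_y ^ a * fps_z ^ b)"
  shows "L F = L' F"
proof (rule order_ge_all_eq)
  fix n
  have *: "L (trunc2 n F) = L' (trunc2 n F)"
    unfolding trunc2_def using L
    by (simp add: lin_map_sum) (simp add: lin_map_def eq)
  have "L F - L' F = L (F - trunc2 n F) - L' (F - trunc2 n F)"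
    using * by (simp add: lin_map_diff L)
  moreover have "order_ge n (F - trunc2 n F)"
    using order_ge_trunc2 order_ge_mono by (metis le_SucI order_refl)
  ultimately show "order_ge n (L F - L' F)"
    using L by (auto intro!: order_ge_diff simp: lin_map_def)
qed

text \<open>
  The truncation bound in the definition of substitution may be replaced by any larger one, which makes
  all coefficients up to a given degree available as one finite sum.
\<close>

lemma coeff2_subst2:
  assumes "Y \<in> max_ideal" "Z \<in> max_ideal" "i + j \<le> N"
  shows "coeff2 (subst2 F Y Z) i j =
    (\<Sum>a\<le>N. \<Sum>b\<le>N. coeff2 F a b * coeff2 (Y ^ a * Z ^ b) i j)"
proof -
  have z: "coeff2 (Y ^ a * Z ^ b) i j = 0" if "a + b > i + j" for a b
    using order_ge_monom[OF assms(1,2), of a b] that by (simp add: order_ge_def)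
  have "coeff2 (subst2 F Y Z) i j =
      (\<Sum>a\<le>i+j. \<Sum>b\<le>i+j. coeff2 F a b * coeff2 (Y ^ a * Z ^ b) i j)"
    by (simp add: subst2_def coeff2_def)
  also have "\<dots> = (\<Sum>a\<le>i+j. \<Sum>b\<le>N. coeff2 F a b * coeff2 (Y ^ a * Z ^ b) i j)"
    using assms(3) by (intro sum.cong refl sum.mono_neutral_left) (auto simp: z)
  also have "\<dots> = (\<Sum>a\<le>N. \<Sum>b\<le>N. coeff2 F a b * coeff2 (Y ^ a * Z ^ b) i j)"
    using assms(3) by (intro sum.mono_neutral_left) (auto simp: z)
  finally show ?thesis .
qed

lemma subst2_add: "subst2 (F + G) Y Z = subst2 F Y Z + subst2 G Y Z"
  by (rule fps2_eqI) (simp add: subst2_def coeff2_def sum.distrib algebra_simps)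

lemma subst2_const_mult: "subst2 (const2 c * F) Y Z = const2 c * subst2 F Y Z"
proof (rule fps2_eqI)
  fix i j
  show "coeff2 (subst2 (const2 c * F) Y Z) i j = coeff2 (const2 c * subst2 F Y Z) i j"
    unfolding coeff2_const2_mult
    by (simp add: subst2_def, subst (1 2) coeff2_def, simp add: sum_distrib_left mult.assoc)
qed

lemma order_ge_subst2:
  assumes "Y \<in> max_ideal" "Z \<in> max_ideal" "order_ge n F"
  shows "order_ge n (subst2 F Y Z)"
  unfolding order_ge_def
proof (intro allI impI)
  fix i j assume ij: "i + j < n"
  show "coeff2 (subst2 F Y Z) i j = 0"
    unfolding coeff2_subst2[OF assms(1,2) order_refl]
  proof (intro sum.neutral ballI)
    fix a b
    show "coeff2 F a b * coeff2 (Y ^ a * Z ^ b) i j = 0"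
    proof (cases "a + b < n")
      case True
      then show ?thesis using assms(3) by (simp add: order_ge_def)
    next
      case False
      then have "i + j < a + b" using ij by simp
      then show ?thesis using order_ge_monom[OF assms(1,2), of a b] by (simp add: order_ge_def)
    qed
  qed
qed

lemma lin_map_subst2:
  "Y \<in> max_ideal \<Longrightarrow> Z \<in> max_ideal \<Longrightarrow> lin_map (\<lambda>F. subst2 F Y Z)"
  by (simp add: lin_map_def subst2_add subst2_const_mult order_ge_subst2)

lemma subst2_monom:
  assumes "Y \<in> max_ideal" "Z \<in> max_ideal"
  shows "subst2 (fps_y ^ a * fps_z ^ b) Y Z = Y ^ a * Z ^ b"
proof (rule fps2_eqI)
  fix i j
  define N where "N = i + j + a + b"
  have "coeff2 (subst2 (fps_y ^ a * fps_z ^ b) Y Z) i j =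
    (\<Sum>a'\<le>N. \<Sum>b'\<le>N. coeff2 (fps_y ^ a * fps_z ^ b) a' b' * coeff2 (Y ^ a' * Z ^ b') i j)"
    by (rule coeff2_subst2[OF assms]) (simp add: N_def)
  also have "\<dots> = (\<Sum>a'\<le>N. \<Sum>b'\<le>N. if a' = a \<and> b' = b then coeff2 (Y ^ a * Z ^ b) i j else 0)"
    by (intro sum.cong refl) (simp add: coeff2_monom)
  also have "\<dots> = (\<Sum>a'\<le>N. if a' = a then coeff2 (Y ^ a * Z ^ b) i j else 0)"
    by (intro sum.cong refl) (auto simp: N_def)
  also have "\<dots> = coeff2 (Y ^ a * Z ^ b) i j" by (simp add: N_def)
  finally show "coeff2 (subst2 (fps_y ^ a * fps_z ^ b) Y Z) i j = coeff2 (Y ^ a * Z ^ b) i j" .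
qed

lemma lin_map_mult: "lin_map L \<Longrightarrow> lin_map (\<lambda>F. G * L F)" 
  unfolding lin_map_def using order_ge_mult[of 0 G]
  by (intro conjI allI impI) (simp_all add: distrib_left mult.left_commute)

lemma lin_map_comp: "lin_map L \<Longrightarrow> lin_map L' \<Longrightarrow> lin_map (\<lambda>F. L (L' F))" 
  unfolding lin_map_def by auto

lemma lin_map_id: "lin_map (\<lambda>F. F)"
  by (simp add: lin_map_def)

lemma subst2_mult:
  fixes Y Z :: "'k::comm_ring_1 fps fps"
  assumes YZ: "Y \<in> max_ideal" "Z \<in> max_ideal"
  shows "subst2 (F * G) Y Z = subst2 F Y Z * subst2 G Y Z"
proof -
  note l = lin_map_comp[OF lin_map_subst2[OF YZ] lin_map_mult[OF lin_map_id]]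
  note r = lin_map_mult[OF lin_map_subst2[OF YZ]]
  have 1: "subst2 (fps_y ^ a * fps_z ^ b * G) Y Z = Y ^ a * Z ^ b * subst2 G Y Z" for a b G
  proof (rule lin_map_ext[OF l r])
    fix c d
    have "fps_y ^ a * fps_z ^ b * (fps_y ^ c * fps_z ^ d) = (fps_y ^ (a + c) * fps_z ^ (b + d) :: 'k fps fps)"
      by (simp add: power_add algebra_simps)
    then have "subst2 (fps_y ^ a * fps_z ^ b * (fps_y ^ c * fps_z ^ d)) Y Z = Y ^ (a + c) * Z ^ (b + d)"
      by (simp only: subst2_monom YZ)
    then show "subst2 (fps_y ^ a * fps_z ^ b * (fps_y ^ c * fps_z ^ d)) Y Z =
        Y ^ a * Z ^ b * subst2 (fps_y ^ c * fps_z ^ d) Y Z"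
      by (simp add: subst2_monom YZ power_add mult.assoc mult.left_commute)
  qed
  have "subst2 (G * F) Y Z = subst2 G Y Z * subst2 F Y Z"
  proof (rule lin_map_ext[OF l r])
    fix a b
    show "subst2 (G * (fps_y ^ a * fps_z ^ b)) Y Z = subst2 G Y Z * subst2 (fps_y ^ a * fps_z ^ b) Y Z"
      using 1[of a b G] by (simp add: subst2_monom YZ mult.commute)
  qed
  then show ?thesis by (simp add: mult.commute)
qed

lemma subst2_simps:
  assumes "Y \<in> max_ideal" "Z \<in> max_ideal"
  shows "subst2 0 Y Z = 0" "subst2 1 Y Z = 1" "subst2 (const2 c) Y Z = const2 c"
    "subst2 fps_y Y Z = Y" "subst2 fps_z Y Z = Z"
    "subst2 (- F) Y Z = - subst2 F Y Z"
    "subst2 (F - G) Y Z = subst2 F Y Z - subst2 G Y Z"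
    "subst2 (F ^ n) Y Z = subst2 F Y Z ^ n"
proof -
  show 0: "subst2 0 Y Z = 0"
    using lin_map_0[OF lin_map_subst2[OF assms]] .
  show 1: "subst2 1 Y Z = 1"
    using subst2_monom[OF assms, of 0 0] by simp
  show "subst2 (const2 c) Y Z = const2 c"
    using subst2_const_mult[of c 1 Y Z] 1 by simp
  show "subst2 fps_y Y Z = Y" using subst2_monom[OF assms, of 1 0] by simp
  show "subst2 fps_z Y Z = Z" using subst2_monom[OF assms, of 0 1] by simp
  show d: "subst2 (F - G) Y Z = subst2 F Y Z - subst2 G Y Z" for F G
    using lin_map_diff[OF lin_map_subst2[OF assms]] .
  show "subst2 (- F) Y Z = - subst2 F Y Z" using d[of 0 F] 0 by simp
  show "subst2 (F ^ n) Y Z = subst2 F Y Z ^ n"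
    by (induction n) (simp_all add: 1 subst2_mult assms)
qed

lemma subst2_in_max_ideal:
  "Y \<in> max_ideal \<Longrightarrow> Z \<in> max_ideal \<Longrightarrow> F \<in> max_ideal \<Longrightarrow> subst2 F Y Z \<in> max_ideal"
  using order_ge_subst2[of Y Z 1 F] by (simp add: order_ge_1_iff)

lemma subst2_comp:
  assumes YZ: "Y \<in> max_ideal" "Z \<in> max_ideal" and UV: "U \<in> max_ideal" "V \<in> max_ideal"
  shows "subst2 (subst2 F Y Z) U V = subst2 F (subst2 Y U V) (subst2 Z U V)"
proof (rule lin_map_ext[OF lin_map_comp[OF lin_map_subst2[OF UV] lin_map_subst2[OF YZ]] lin_map_subst2])
  show Y': "subst2 Y U V \<in> max_ideal" and Z': "subst2 Z U V \<in> max_ideal"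
    using assms by (auto intro: subst2_in_max_ideal)
  fix a b
  show "subst2 (subst2 (fps_y ^ a * fps_z ^ b) Y Z) U V =
      subst2 (fps_y ^ a * fps_z ^ b) (subst2 Y U V) (subst2 Z U V)"
    by (simp add: subst2_monom YZ UV Y' Z' subst2_mult subst2_simps)
qed

lemma fps_y_max [simp]: "fps_y \<in> max_ideal" and fps_z_max [simp]: "fps_z \<in> max_ideal"
  by (auto simp: max_ideal_def coeff2_fps_y coeff2_fps_z)

lemma subst2_id: "subst2 F fps_y fps_z = F"
  by (rule lin_map_ext[OF lin_map_subst2 lin_map_id]) (simp_all add: subst2_monom)

lemma max_ideal_ops:
  fixes F G :: "'k::comm_ring_1 fps fps"
  shows "F \<in> max_ideal \<Longrightarrow> G \<in> max_ideal \<Longrightarrow> F + G \<in> max_ideal"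
    "F \<in> max_ideal \<Longrightarrow> G \<in> max_ideal \<Longrightarrow> F - G \<in> max_ideal"
    "F \<in> max_ideal \<Longrightarrow> - F \<in> max_ideal"
    "F \<in> max_ideal \<Longrightarrow> F * G \<in> max_ideal"
    "F \<in> max_ideal \<Longrightarrow> G * F \<in> max_ideal"
  by (auto simp: max_ideal_def coeff2_mult)

section \<open>Local coordinates and the implicit function theorem\<close>

lemma coeff2_mult_00: "coeff2 (F * G) 0 0 = coeff2 F 0 0 * coeff2 G 0 0"
  for F G :: "'k::comm_ring_1 fps fps"
  by (simp add: coeff2_mult)

lemma coeff2_mult_lin:
  fixes F G :: "'k::comm_ring_1 fps fps"
  shows "coeff2 (F * G) 1 0 = coeff2 F 0 0 * coeff2 G 1 0 + coeff2 F 1 0 * coeff2 G 0 0"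
    "coeff2 (F * G) (Suc 0) 0 = coeff2 F 0 0 * coeff2 G 1 0 + coeff2 F 1 0 * coeff2 G 0 0"
    "coeff2 (F * G) 0 1 = coeff2 F 0 0 * coeff2 G 0 1 + coeff2 F 0 1 * coeff2 G 0 0"
    "coeff2 (F * G) 0 (Suc 0) = coeff2 F 0 0 * coeff2 G 0 1 + coeff2 F 0 1 * coeff2 G 0 0"
  by (simp_all add: coeff2_mult)

lemma max_ideal_iff: "F \<in> max_ideal \<longleftrightarrow> coeff2 F 0 0 = 0"
  by (simp add: max_ideal_def)

lemma unit2_iff: "U dvd 1 \<longleftrightarrow> coeff2 U 0 0 \<noteq> 0" for U :: "'k::field fps fps"
proof
  assume "U dvd 1"
  then obtain V where "U * V = 1" by (metis dvdE)
  then have "coeff2 U 0 0 * coeff2 V 0 0 = 1" by (metis coeff2_mult_00 coeff2_1)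
  then show "coeff2 U 0 0 \<noteq> 0" by auto
next
  assume "coeff2 U 0 0 \<noteq> 0"
  then have "fps_nth U 0 * inverse (fps_nth U 0) = 1"
    by (simp add: coeff2_def inverse_mult_eq_1')
  then have "U * fps_right_inverse U (inverse (fps_nth U 0)) = 1"
    by (rule fps_right_inverse)
  then show "U dvd 1" by (metis dvdI)
qed

lemma unit2_inverse:
  fixes U :: "'k::field fps fps"
  assumes "U dvd 1"
  obtains V where "U * V = 1" "V * U = 1" "V dvd 1"
  using assms by (metis dvdE dvdI mult.commute)

definition jac :: "'k::comm_ring_1 fps fps \<Rightarrow> 'k fps fps \<Rightarrow> 'k" where
  "jac Y Z = coeff2 Y 1 0 * coeff2 Z 0 1 - coeff2 Y 0 1 * coeff2 Z 1 0"

lemma max_ideal_decomp: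
  fixes M :: "'k::comm_ring_1 fps fps"
  assumes "M \<in> max_ideal"
  obtains A B where "M = A * fps_y + B * fps_z" "coeff2 A 0 0 = coeff2 M 1 0"
    "coeff2 B 0 0 = coeff2 M 0 1"
proof
  define A where "A = Abs_fps (\<lambda>i. fps_nth M (Suc i))"
  define B where "B = fps_const (Abs_fps (\<lambda>j. fps_nth (fps_nth M 0) (Suc j)))"
  show "M = A * fps_y + B * fps_z"
  proof (rule fps2_eqI)
    fix i j
    have "coeff2 (A * fps_y) i j = (if 1 \<le> i then coeff2 M i j else 0)"
      using coeff2_monom_mult[of 1 0 A i j] by (simp add: mult.commute A_def coeff2_def)
    moreover have "coeff2 (B * fps_z) i j = (if 1 \<le> j \<and> i = 0 then coeff2 M i j else 0)"
      using coeff2_monom_mult[of 0 1 B i j] by (simp add: mult.commute B_def coeff2_def)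
    moreover have "coeff2 M 0 0 = 0" using assms by (simp add: max_ideal_def)
    ultimately show "coeff2 M i j = coeff2 (A * fps_y + B * fps_z) i j"
      by (cases "i = 0"; cases "j = 0") auto
  qed
qed (auto simp: coeff2_def)

text \<open>
  A power series version of Nakayama's lemma: generating the maximal ideal is decided by the linear parts.
\<close>

lemma local_coordinates_iff:
  fixes Y Z :: "'k::field fps fps"
  shows "(Y, Z) \<in> local_coordinates \<longleftrightarrow> Y \<in> max_ideal \<and> Z \<in> max_ideal \<and> jac Y Z \<noteq> 0"
proof
  assume "(Y, Z) \<in> local_coordinates"
  then have eq: "{A * Y + B * Z | A B. True} = max_ideal" by (simp add: local_coordinates_def)
  have "Y = 1 * Y + 0 * Z" "Z = 0 * Y + 1 * Z" by simp_all
  then have m: "Y \<in> max_ideal" "Z \<in> max_ideal" using eq by blast+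
  have "fps_y \<in> {A * Y + B * Z | A B. True}" "fps_z \<in> {A * Y + B * Z | A B. True}"
    unfolding eq by simp_all
  then obtain A B C D where e: "fps_y = A * Y + B * Z" "fps_z = C * Y + D * Z" by blast
  have "coeff2 fps_y 1 0 = coeff2 A 0 0 * coeff2 Y 1 0 + coeff2 B 0 0 * coeff2 Z 1 0"
    "coeff2 fps_y 0 1 = coeff2 A 0 0 * coeff2 Y 0 1 + coeff2 B 0 0 * coeff2 Z 0 1"
    "coeff2 fps_z 1 0 = coeff2 C 0 0 * coeff2 Y 1 0 + coeff2 D 0 0 * coeff2 Z 1 0"
    "coeff2 fps_z 0 1 = coeff2 C 0 0 * coeff2 Y 0 1 + coeff2 D 0 0 * coeff2 Z 0 1"
    using m unfolding e by (simp_all add: coeff2_mult_lin max_ideal_def)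
  then have "(coeff2 A 0 0 * coeff2 D 0 0 - coeff2 B 0 0 * coeff2 C 0 0) * jac Y Z = 1"
    unfolding jac_def coeff2_fps_y coeff2_fps_z by simp algebra
  then show "Y \<in> max_ideal \<and> Z \<in> max_ideal \<and> jac Y Z \<noteq> 0" using m by auto
next
  assume *: "Y \<in> max_ideal \<and> Z \<in> max_ideal \<and> jac Y Z \<noteq> 0"
  obtain a b where Y: "Y = a * fps_y + b * fps_z" and ab: "coeff2 a 0 0 = coeff2 Y 1 0" "coeff2 b 0 0 = coeff2 Y 0 1"
    using * max_ideal_decomp[of Y] by blast
  obtain c d where Z: "Z = c * fps_y + d * fps_z" and cd: "coeff2 c 0 0 = coeff2 Z 1 0" "coeff2 d 0 0 = coeff2 Z 0 1"
    using * max_ideal_decomp[of Z] by blast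
  have "coeff2 (a * d - b * c) 0 0 \<noteq> 0" using * ab cd by (simp add: coeff2_mult_00 jac_def)
  then obtain e where e: "(a * d - b * c) * e = 1" using unit2_iff by (metis dvdE)
  have "M \<in> {A * Y + B * Z | A B. True}" if M_in: "M \<in> max_ideal" for M
  proof -
    obtain P Q where M: "M = P * fps_y + Q * fps_z" using M_in max_ideal_decomp[of M] by blast
    have "M = (e * (P * d - Q * c)) * Y + (e * (Q * a - P * b)) * Z"
    proof -
      have "(e * (P * d - Q * c)) * Y + (e * (Q * a - P * b)) * Z
          = ((a * d - b * c) * e) * (P * fps_y + Q * fps_z)"
        unfolding Y Z by (simp add: algebra_simps)
      then show ?thesis unfolding e M by simp
    qed
    then show ?thesis by blast
  qed
  moreover have "A * Y + B * Z \<in> max_ideal" for A B using * by (intro max_ideal_ops) auto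
  ultimately show "(Y, Z) \<in> local_coordinates" by (auto simp: local_coordinates_def)
qed

text \<open>
  Writing each coefficient repeatedly as a constant plus a combination of $Y$ and $Z$ produces the
  expansion of $G$ in powers of $Y$ and $Z$ degree by degree.
\<close>

lemma subst2_surj:
  fixes Y Z G :: "'k::field fps fps"
  assumes "(Y, Z) \<in> local_coordinates"
  shows "\<exists>F. subst2 F Y Z = G"
proof -
  have m: "Y \<in> max_ideal" "Z \<in> max_ideal" using assms by (auto simp: local_coordinates_iff)
  have "\<exists>A B. H = const2 (coeff2 H 0 0) + A * Y + B * Z" for H
  proof -
    have "H - const2 (coeff2 H 0 0) \<in> max_ideal" by (simp add: max_ideal_def coeff2_const2)
    then have "H - const2 (coeff2 H 0 0) \<in> {A * Y + B * Z | A B. True}"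
      using assms by (simp add: local_coordinates_def)
    then obtain A B where "H - const2 (coeff2 H 0 0) = A * Y + B * Z" by blast
    then have "H = const2 (coeff2 H 0 0) + A * Y + B * Z" by (simp add: algebra_simps)
    then show ?thesis by blast
  qed
  then obtain A B where AB: "\<And>H. H = const2 (coeff2 H 0 0) + A H * Y + B H * Z" by metis
  \<comment> \<open>\<open>R n i\<close> is the remainder of degree \<open>n\<close> that multiplies \<open>Y ^ i * Z ^ (n - i)\<close>.\<close>
  define R where "R = rec_nat (\<lambda>i::nat. if i = 0 then G else 0)
    (\<lambda>n r i. (if 1 \<le> i then A (r (i - 1)) else 0) + (if i \<le> n then B (r i) else 0))"
  have R0: "R 0 0 = G" by (simp add: R_def)
  have RS: "R (Suc n) i = (if 1 \<le> i then A (R n (i - 1)) else 0) + (if i \<le> n then B (R n i) else 0)" for n i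
    by (simp add: R_def)
  define S where "S k = (\<Sum>i\<le>k. const2 (coeff2 (R k i) 0 0) * (Y ^ i * Z ^ (k - i)))" for k
  have exp: "G = (\<Sum>k<n. S k) + (\<Sum>i\<le>n. R n i * (Y ^ i * Z ^ (n - i)))" for n
  proof (induction n)
    case 0
    then show ?case by (simp add: R0)
  next
    case (Suc n)
    have "(\<Sum>i\<le>Suc n. R (Suc n) i * (Y ^ i * Z ^ (Suc n - i))) =
       (\<Sum>i\<le>Suc n. (if 1 \<le> i then A (R n (i - 1)) else 0) * (Y ^ i * Z ^ (Suc n - i))) +
       (\<Sum>i\<le>Suc n. (if i \<le> n then B (R n i) else 0) * (Y ^ i * Z ^ (Suc n - i)))"
      by (simp only: RS distrib_right sum.distrib)
    also have "(\<Sum>i\<le>Suc n. (if 1 \<le> i then A (R n (i - 1)) else 0) * (Y ^ i * Z ^ (Suc n - i))) =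
        (\<Sum>i\<le>n. A (R n i) * (Y ^ Suc i * Z ^ (n - i)))"
      by (subst sum.atMost_Suc_shift) simp
    also have "(\<Sum>i\<le>Suc n. (if i \<le> n then B (R n i) else 0) * (Y ^ i * Z ^ (Suc n - i))) =
       (\<Sum>i\<le>n. B (R n i) * (Y ^ i * (Z * Z ^ (n - i))))"
      by (simp add: Suc_diff_le)
    finally have "S n + (\<Sum>i\<le>Suc n. R (Suc n) i * (Y ^ i * Z ^ (Suc n - i))) =
       (\<Sum>i\<le>n. (const2 (coeff2 (R n i) 0 0) + A (R n i) * Y + B (R n i) * Z) * (Y ^ i * Z ^ (n - i)))"
      by (simp add: S_def sum.distrib algebra_simps)
    also have "\<dots> = (\<Sum>i\<le>n. R n i * (Y ^ i * Z ^ (n - i)))"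
      by (simp only: AB[symmetric])
    finally show ?case using Suc.IH by (simp add: add.assoc)
  qed
  define F where "F = Abs_fps (\<lambda>i. Abs_fps (\<lambda>j. coeff2 (R (i + j) i) 0 0))"
  have cF: "coeff2 F i j = coeff2 (R (i + j) i) 0 0" for i j by (simp add: F_def coeff2_def)
  have "subst2 F Y Z = G"
  proof (rule order_ge_all_eq)
    fix n
    define T where "T = (\<Sum>k<n. \<Sum>i\<le>k. const2 (coeff2 (R k i) 0 0) * (fps_y ^ i * fps_z ^ (k - i)))"
    have "subst2 T Y Z = (\<Sum>k<n. S k)"
      unfolding T_def S_def
      by (simp add: lin_map_sum[OF lin_map_subst2[OF m]] subst2_const_mult subst2_monom[OF m])
    then have 1: "subst2 F Y Z - G = subst2 (F - T) Y Z - (\<Sum>i\<le>n. R n i * (Y ^ i * Z ^ (n - i)))"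
      using exp[of n] by (simp add: subst2_simps[OF m] algebra_simps)
    have "order_ge n (F - T)"
      unfolding order_ge_def
    proof (intro allI impI)
      fix i j assume ij: "i + j < n"
      have "coeff2 T i j = (\<Sum>k<n. \<Sum>i'\<le>k. if i = i' \<and> j = k - i' then coeff2 (R k i') 0 0 else 0)"
        unfolding T_def coeff2_sum
        by (intro sum.cong refl) (simp only: coeff2_const2_mult coeff2_monom, simp)
      also have "\<dots> = (\<Sum>k<n. if k = i + j then coeff2 (R k i) 0 0 else 0)"
      proof (intro sum.cong refl)
        fix k
        have "(\<Sum>i'\<le>k. if i = i' \<and> j = k - i' then coeff2 (R k i') 0 0 else 0) =
          (\<Sum>i'\<le>k. if i = i' then (if j = k - i then coeff2 (R k i) 0 0 else 0) else 0)"
          by (intro sum.cong refl) auto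
        also have "\<dots> = (if k = i + j then coeff2 (R k i) 0 0 else 0)" by auto
        finally show "(\<Sum>i'\<le>k. if i = i' \<and> j = k - i' then coeff2 (R k i') 0 0 else 0) = \<dots>" .
      qed
      also have "\<dots> = coeff2 F i j" using ij by (simp add: cF)
      finally show "coeff2 (F - T) i j = 0" by simp
    qed
    then have "order_ge n (subst2 (F - T) Y Z)" by (rule order_ge_subst2[OF m])
    moreover have "order_ge n (\<Sum>i\<le>n. R n i * (Y ^ i * Z ^ (n - i)))"
    proof -
      have "order_ge n (R n i * (Y ^ i * Z ^ (n - i)))" if "i \<le> n" for i
        using order_ge_mult[OF order_ge_0[of "R n i"] order_ge_monom[OF m, of i "n - i"]] that by simp
      then show ?thesis by (simp add: order_ge_def)
    qed
    ultimately show "order_ge n (subst2 F Y Z - G)" unfolding 1 by (rule order_ge_diff)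
  qed
  then show ?thesis by blast
qed

lemma coeff2_subst2_00:
  assumes "Y \<in> max_ideal" "Z \<in> max_ideal"
  shows "coeff2 (subst2 F Y Z) 0 0 = coeff2 F 0 0"
  by (subst coeff2_subst2[OF assms order_refl]) (simp add: coeff2_1)

lemma coeff2_subst2_lin:
  fixes F :: "'k::comm_ring_1 fps fps"
  assumes m: "Y \<in> max_ideal" "Z \<in> max_ideal"
  shows "coeff2 (subst2 F Y Z) 1 0 = coeff2 F 1 0 * coeff2 Y 1 0 + coeff2 F 0 1 * coeff2 Z 1 0"
    "coeff2 (subst2 F Y Z) 0 1 = coeff2 F 1 0 * coeff2 Y 0 1 + coeff2 F 0 1 * coeff2 Z 0 1"
  using m by (simp_all add: coeff2_subst2[OF m order_refl] coeff2_1 coeff2_mult_lin max_ideal_def)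

lemma jac_subst2:
  fixes U V :: "'k::comm_ring_1 fps fps"
  assumes m: "Y \<in> max_ideal" "Z \<in> max_ideal"
  shows "jac (subst2 U Y Z) (subst2 V Y Z) = jac U V * jac Y Z"
  unfolding jac_def coeff2_subst2_lin[OF m] by (simp add: algebra_simps)

lemma local_coordinates_subst2:
  fixes U V :: "'k::field fps fps"
  assumes "(Y, Z) \<in> local_coordinates"
  shows "(subst2 U Y Z, subst2 V Y Z) \<in> local_coordinates \<longleftrightarrow> (U, V) \<in> local_coordinates"
proof -
  have m: "Y \<in> max_ideal" "Z \<in> max_ideal" and j: "jac Y Z \<noteq> 0"
    using assms by (auto simp: local_coordinates_iff)
  show ?thesis using j unfolding local_coordinates_iff jac_subst2[OF m]
    by (simp add: max_ideal_iff coeff2_subst2_00[OF m])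
qed

lemma local_coordinates_yz: "(fps_y, fps_z :: 'k::field fps fps) \<in> local_coordinates"
  by (simp add: local_coordinates_iff jac_def coeff2_fps_y coeff2_fps_z)

lemma local_coordinates_max:
  fixes Y Z :: "'k::field fps fps"
  assumes "(Y, Z) \<in> local_coordinates"
  shows "Y \<in> max_ideal" "Z \<in> max_ideal"
  using assms by (auto simp: local_coordinates_iff)

text \<open>
  A right inverse of the substitution is again given by local coordinates, hence is itself surjective.
\<close>

lemma subst2_inj:
  fixes F G Y Z :: "'k::field fps fps"
  assumes c: "(Y, Z) \<in> local_coordinates" and eq: "subst2 F Y Z = subst2 G Y Z"
  shows "F = G"
proof -
  note m = local_coordinates_max[OF c]
  obtain U V where UV: "subst2 U Y Z = fps_y" "subst2 V Y Z = fps_z"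
    using subst2_surj[OF c] by metis
  have c': "(U, V) \<in> local_coordinates"
    using local_coordinates_subst2[OF c, of U V] local_coordinates_yz[where 'k='k] by (simp add: UV)
  obtain F' G' where FG: "subst2 F' U V = F" "subst2 G' U V = G"
    using subst2_surj[OF c'] by metis
  have "subst2 (subst2 H U V) Y Z = H" for H
    by (simp add: subst2_comp local_coordinates_max[OF c'] m UV subst2_id)
  then show ?thesis using eq FG by metis
qed

lemma subst2_const_z:
  fixes g :: "'k::comm_ring_1 fps"
  assumes "Y \<in> max_ideal"
  shows "subst2 (fps_const g) Y fps_z = fps_const g"
proof (rule fps2_eqI)
  fix i j
  have "coeff2 (subst2 (fps_const g) Y fps_z) i j =
    (\<Sum>a\<le>i+j. \<Sum>b\<le>i+j. coeff2 (fps_const g) a b * coeff2 (Y ^ a * fps_z ^ b) i j)"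
    by (rule coeff2_subst2) (auto simp: assms)
  also have "\<dots> = (\<Sum>a\<le>i+j. if a = 0 then (\<Sum>b\<le>i+j. coeff2 (fps_const g) 0 b * coeff2 (fps_z ^ b) i j) else 0)"
    by (intro sum.cong refl) (auto simp: coeff2_def)
  also have "\<dots> = (\<Sum>b\<le>i+j. coeff2 (fps_const g) 0 b * (if i = 0 \<and> j = b then 1 else 0))"
    using coeff2_monom[of 0 _ i j, where 'k='k] by simp
  also have "\<dots> = (\<Sum>b\<le>i+j. if j = b then (if i = 0 then coeff2 (fps_const g) 0 b else 0) else 0)"
    by (intro sum.cong refl) auto
  also have "\<dots> = coeff2 (fps_const g) i j" by (simp add: coeff2_def)
  finally show "coeff2 (subst2 (fps_const g) Y fps_z) i j = coeff2 (fps_const g) i j" .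
qed

lemma coeff2_fps_const: "coeff2 (fps_const g) i j = (if i = 0 then fps_nth g j else 0)"
  by (simp add: coeff2_def)

text \<open>
  Since $(E,z)$ are coordinates, $y$ is a series $\Phi(E,z)$. The root is $g(z)=\Phi(0,z)$,
  because $E$ divides $\Phi(E,z)-\Phi(0,z)=y-g(z)$; comparing linear parts shows that the cofactor is a unit.
\<close>

lemma implicit_function:
  fixes E :: "'k::field fps fps"
  assumes "E \<in> max_ideal" "coeff2 E 1 0 \<noteq> 0"
  obtains g U where "fps_nth g 0 = 0" "U dvd 1" "E = U * (fps_y - fps_const g)"
proof -
  have c: "(E, fps_z) \<in> local_coordinates"
    using assms by (simp add: local_coordinates_iff jac_def coeff2_fps_z)
  note m = local_coordinates_max[OF c]
  obtain \<Phi> where \<Phi>: "subst2 \<Phi> E fps_z = fps_y" using subst2_surj[OF c] by blast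
  define g where "g = fps_nth \<Phi> 0"
  define \<Phi>' where "\<Phi>' = Abs_fps (\<lambda>i. fps_nth \<Phi> (Suc i))"
  have "\<Phi> = fps_const g + fps_y * \<Phi>'"
  proof (rule fps2_eqI)
    fix i j
    show "coeff2 \<Phi> i j = coeff2 (fps_const g + fps_y * \<Phi>') i j"
      using coeff2_monom_mult[of 1 0 \<Phi>' i j] by (cases i) (simp_all add: coeff2_def g_def \<Phi>'_def)
  qed
  then have e: "fps_y - fps_const g = E * subst2 \<Phi>' E fps_z"
    using \<Phi> by (simp add: subst2_add subst2_mult[OF m] subst2_simps[OF m] subst2_const_z m eq_diff_eq diff_eq_eq add.commute)
  define W where "W = subst2 \<Phi>' E fps_z"
  have "coeff2 (fps_y - fps_const g) 1 0 = coeff2 E 1 0 * coeff2 W 0 0"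
    unfolding e W_def[symmetric] using assms(1) by (simp add: coeff2_mult_lin max_ideal_def)
  then have "coeff2 W 0 0 \<noteq> 0" by (auto simp: coeff2_fps_y coeff2_fps_const)
  then obtain U where U: "W * U = 1" "U dvd 1" using unit2_iff unit2_inverse by metis
  have "E = U * (fps_y - fps_const g)"
    using U(1) unfolding e W_def[symmetric] by (metis mult.commute mult.left_commute mult.right_neutral)
  moreover have "fps_nth g 0 = 0"
    using coeff2_subst2_00[OF m, of \<Phi>] \<Phi> by (simp add: g_def coeff2_fps_y coeff2_def[of \<Phi>])
  ultimately show ?thesis using that U(2) by blast
qed

lemma subordinate_iff:
  fixes h Y Z :: "'k::field fps fps"
  shows "(Y, Z) \<in> subordinate h \<longleftrightarrow> (Y, Z) \<in> local_coordinates \<and> (\<exists>v. v dvd 1 \<and> Z = v * h)"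
proof -
  have "{A * Z | A. True} = {A * h | A. True} \<longleftrightarrow> (\<exists>v. v dvd 1 \<and> Z = v * h)"
    if "(Y, Z) \<in> local_coordinates"
  proof
    assume eq: "{A * Z | A. True} = {A * h | A. True}"
    have "Z = 1 * Z" "h = 1 * h" by simp_all
    then have "Z \<in> {A * h | A. True}" "h \<in> {A * Z | A. True}" using eq by blast+
    then obtain v w where vw: "Z = v * h" "h = w * Z" by blast
    have "Z \<noteq> 0" using that by (auto simp: local_coordinates_iff jac_def)
    moreover have "(v * w) * Z = 1 * Z" using vw by (simp add: mult.assoc)
    ultimately have "v * w = 1" by (simp only: mult_cancel_right) simp
    then show "\<exists>v. v dvd 1 \<and> Z = v * h" using vw(1) by (metis dvdI)
  next
    assume "\<exists>v. v dvd 1 \<and> Z = v * h"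
    then obtain v w where v: "Z = v * h" "v * w = 1" by (metis dvdE)
    have 1: "A * Z = (A * v) * h" "A * h = (A * w) * Z" for A
      using v by (simp_all add: mult.assoc mult.left_commute) 
    show "{A * Z | A. True} = {A * h | A. True}"
    proof (intro equalityI subsetI)
      fix x assume "x \<in> {A * Z | A. True}" then show "x \<in> {A * h | A. True}" using 1(1) by blast
    next
      fix x assume "x \<in> {A * h | A. True}" then show "x \<in> {A * Z | A. True}" using 1(2) by blast
    qed
  qed
  then show ?thesis unfolding subordinate_def mem_Collect_eq case_prod_conv by (rule conj_cong[OF refl])
qed

section \<open>Expansions modulo p-th powers\<close>

lemma order_ge_power_pos:
  fixes R :: "'k::comm_ring_1 fps fps"
  shows "order_ge m R \<Longrightarrow> n > 0 \<Longrightarrow> order_ge m (R ^ n)"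
  using order_ge_mult[of m R 0 "R ^ (n - 1)"] by (cases n) auto

lemma const2_power: "const2 (c ^ n) = const2 c ^ n" for c :: "'k::comm_ring_1"
  by (simp add: const2_def)

lemma mult_if_1_0: "(c :: 'k::comm_ring_1) * (if b then 1 else 0) = (if b then c else 0)"
  by simp

text \<open>
  In characteristic $p$ the $p$-th power of a series is computed termwise.
\<close>

lemma coeff2_frobenius:
  fixes F :: "'k::comm_ring_1 fps fps"
  assumes p: "prime CHAR('k)"
  shows "coeff2 (F ^ CHAR('k)) i j =
    (if CHAR('k) dvd i \<and> CHAR('k) dvd j then coeff2 F (i div CHAR('k)) (j div CHAR('k)) ^ CHAR('k) else 0)"
proof -
  define p where "p = CHAR('k)"
  have p0: "p > 0" using p by (simp add: p_def prime_gt_0_nat)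
  have char: "prime CHAR('k fps fps)" "p = CHAR('k fps fps)" using p by (simp_all add: p_def)
  define n where "n = i + j"
  define R where "R = F - trunc2 n F"
  have "F ^ p = (trunc2 n F + R) ^ p" by (simp add: R_def)
  also have "\<dots> = trunc2 n F ^ p + R ^ p" by (rule freshmans_dream[OF char])
  finally have 1: "F ^ p = trunc2 n F ^ p + R ^ p" .
  have "order_ge (Suc n) (R ^ p)"
    unfolding R_def by (rule order_ge_power_pos[OF order_ge_trunc2 p0])
  then have 2: "coeff2 (R ^ p) i j = 0" by (simp add: order_ge_def n_def)
  have "trunc2 n F ^ p = (\<Sum>a\<le>n. \<Sum>b\<le>n. (const2 (coeff2 F a b) * (fps_y ^ a * fps_z ^ b)) ^ p)"
    unfolding trunc2_def by (simp add: freshmans_dream_sum[OF char])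
  also have "\<dots> = (\<Sum>a\<le>n. \<Sum>b\<le>n. const2 (coeff2 F a b ^ p) * (fps_y ^ (a * p) * fps_z ^ (b * p)))"
    by (simp only: power_mult_distrib power_mult const2_power)
  finally have tp: "trunc2 n F ^ p =
    (\<Sum>a\<le>n. \<Sum>b\<le>n. const2 (coeff2 F a b ^ p) * (fps_y ^ (a * p) * fps_z ^ (b * p)))" .
  have cf: "coeff2 (const2 c * (fps_y ^ (a * p) * fps_z ^ (b * p))) i j =
    (if i = a * p \<and> j = b * p then c else 0)" for a b and c :: 'k
    unfolding coeff2_const2_mult coeff2_monom by (rule mult_if_1_0)
  have "coeff2 (trunc2 n F ^ p) i j =
      (\<Sum>a\<le>n. \<Sum>b\<le>n. if i = a * p \<and> j = b * p then coeff2 F a b ^ p else 0)"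
    unfolding tp coeff2_sum cf ..
  also have "\<dots> = (if p dvd i \<and> p dvd j then coeff2 F (i div p) (j div p) ^ p else 0)"
  proof (cases "p dvd i \<and> p dvd j")
    case True
    have le: "i div p \<le> n" "j div p \<le> n" by (simp_all add: n_def trans_le_add1 trans_le_add2)
    have "(\<Sum>a\<le>n. \<Sum>b\<le>n. if i = a * p \<and> j = b * p then coeff2 F a b ^ p else 0) =
      (\<Sum>a\<le>n. if a = i div p then (\<Sum>b\<le>n. if b = j div p then coeff2 F a b ^ p else 0) else 0)"
    proof (intro sum.cong refl)
      fix a
      have "(i = a * p \<and> j = b * p) = (a = i div p \<and> b = j div p)" for b
        using True p0 by auto
      then show "(\<Sum>b\<le>n. if i = a * p \<and> j = b * p then coeff2 F a b ^ p else 0) =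
        (if a = i div p then (\<Sum>b\<le>n. if b = j div p then coeff2 F a b ^ p else 0) else 0)"
        by simp
    qed
    also have "\<dots> = coeff2 F (i div p) (j div p) ^ p" using le by simp
    finally show ?thesis using True by simp
  next
    case False
    then show ?thesis by (auto intro!: sum.neutral)
  qed
  finally show ?thesis using 1 2 by (simp add: p_def)
qed

text \<open>
  The exponents of \<open>F\<close> lie outside $p\mathbb{N}^2$; such series represent the classes modulo $p$-th powers uniquely.
\<close>

definition off_powers :: "'k::field fps fps \<Rightarrow> bool" where
  "off_powers F \<longleftrightarrow> (\<forall>\<alpha> \<beta>. CHAR('k) dvd \<alpha> \<and> CHAR('k) dvd \<beta> \<longrightarrow> coeff2 F \<alpha> \<beta> = 0)"

definition mod_powers :: "'k::field fps fps \<Rightarrow> 'k fps fps" where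
  "mod_powers F = Abs_fps (\<lambda>i. Abs_fps (\<lambda>j. if CHAR('k) dvd i \<and> CHAR('k) dvd j then 0 else coeff2 F i j))"

lemma coeff2_mod_powers:
  "coeff2 (mod_powers F) i j = (if CHAR('k) dvd i \<and> CHAR('k) dvd j then 0 else coeff2 F i j)"
  for F :: "'k::field fps fps"
  by (simp add: mod_powers_def coeff2_def)

lemma off_powers_mod_powers [simp]: "off_powers (mod_powers F)"
  unfolding off_powers_def coeff2_mod_powers by simp

lemma mod_powers_off_powers: "off_powers F \<Longrightarrow> mod_powers F = F"
  unfolding off_powers_def by (rule fps2_eqI) (simp add: coeff2_mod_powers)

lemma mod_powers_mod_powers [simp]: "mod_powers (mod_powers F) = mod_powers F"
  by (simp add: mod_powers_off_powers)

lemma mod_powers_add_power: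
  fixes F :: "'k::field fps fps"
  assumes "prime CHAR('k)"
  shows "mod_powers (F + q ^ CHAR('k)) = mod_powers F"
  by (rule fps2_eqI) (simp add: coeff2_mod_powers coeff2_frobenius assms)

text \<open>
  Over a perfect field every series in $y^p$ and $z^p$ is a $p$-th power.
\<close>

lemma mod_powers_eqD:
  fixes F G :: "'k::alg_closed_field fps fps"
  assumes p: "prime CHAR('k)" and eq: "mod_powers F = mod_powers G"
  shows "\<exists>q. F = G + q ^ CHAR('k)"
proof -
  define p where "p = CHAR('k)"
  have p0: "p > 0" using p by (simp add: p_def prime_gt_0_nat)
  have "\<forall>c. \<exists>r::'k. r ^ p = c" using nth_root_exists[OF p0] by blast
  then obtain rt where rt: "\<And>c::'k. rt c ^ p = c" by metis
  define q where "q = Abs_fps (\<lambda>i. Abs_fps (\<lambda>j. rt (coeff2 (F - G) (p * i) (p * j))))"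
  have cq: "coeff2 q i j = rt (coeff2 (F - G) (p * i) (p * j))" for i j
    by (simp add: q_def coeff2_def)
  have "F = G + q ^ CHAR('k)"
  proof (rule fps2_eqI)
    fix i j
    have "coeff2 (mod_powers F) i j = coeff2 (mod_powers G) i j" by (simp add: eq)
    then have "p dvd i \<and> p dvd j \<or> coeff2 F i j = coeff2 G i j"
      unfolding coeff2_mod_powers p_def by argo
    moreover have "coeff2 (q ^ p) i j = (if p dvd i \<and> p dvd j then coeff2 (F - G) i j else 0)"
      unfolding p_def coeff2_frobenius[OF p] by (simp add: cq rt[unfolded p_def] p_def)
    ultimately show "coeff2 F i j = coeff2 (G + q ^ CHAR('k)) i j"
      unfolding p_def by (simp split: if_splits)
  qed
  then show ?thesis by blast
qed

lemma mod_powers_eq_iff: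
  fixes F G :: "'k::alg_closed_field fps fps"
  assumes p: "prime CHAR('k)"
  shows "mod_powers F = mod_powers G \<longleftrightarrow> (\<exists>q. F = G + q ^ CHAR('k))"
  using mod_powers_eqD[OF p] mod_powers_add_power[OF p] by metis

lemma mod_powers_subst2_cong:
  fixes F G :: "'k::alg_closed_field fps fps"
  assumes p: "prime CHAR('k)" and m: "Y \<in> max_ideal" "Z \<in> max_ideal" and eq: "mod_powers F = mod_powers G"
  shows "mod_powers (subst2 F Y Z) = mod_powers (subst2 G Y Z)"
proof -
  obtain q where "F = G + q ^ CHAR('k)" using mod_powers_eqD[OF p eq] by blast
  then have "subst2 F Y Z = subst2 G Y Z + subst2 q Y Z ^ CHAR('k)"
    by (simp add: subst2_add subst2_simps[OF m])
  then show ?thesis by (simp add: mod_powers_add_power[OF p])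
qed

lemma mod_powers_subst2_mod_powers:
  fixes F :: "'k::alg_closed_field fps fps"
  assumes "prime CHAR('k)" "Y \<in> max_ideal" "Z \<in> max_ideal"
  shows "mod_powers (subst2 (mod_powers F) Y Z) = mod_powers (subst2 F Y Z)"
  by (rule mod_powers_subst2_cong[OF assms]) simp

lemma mod_powers_subst2_inj:
  fixes F G :: "'k::alg_closed_field fps fps"
  assumes p: "prime CHAR('k)" and c: "(Y, Z) \<in> local_coordinates"
    and eq: "mod_powers (subst2 F Y Z) = mod_powers (subst2 G Y Z)"
  shows "mod_powers F = mod_powers G"
proof -
  note m = local_coordinates_max[OF c]
  obtain q where q: "subst2 F Y Z = subst2 G Y Z + q ^ CHAR('k)" using mod_powers_eqD[OF p eq] by blast
  obtain w where w: "subst2 w Y Z = q" using subst2_surj[OF c] by blast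
  have "subst2 F Y Z = subst2 (G + w ^ CHAR('k)) Y Z"
    by (simp add: q subst2_add subst2_simps[OF m] w)
  then have "F = G + w ^ CHAR('k)" by (rule subst2_inj[OF c])
  then show ?thesis by (simp add: mod_powers_add_power[OF p])
qed

text \<open>
  Congruences modulo $p$-th powers are stated as equality of the reduced series, so that an expansion
  is recognized by two equational conditions.
\<close>

lemma expansion_eqI:
  fixes F :: "'k::alg_closed_field fps fps"
  assumes p: "prime CHAR('k)" and c: "(Y, Z) \<in> local_coordinates"
    and F: "off_powers F" "mod_powers (subst2 F Y Z) = mod_powers (germ a f)"
  shows "expansion a (Y, Z) f = F"
  unfolding expansion_def fst_conv snd_conv
proof (rule the_equality)
  show "(\<forall>\<alpha> \<beta>. CHAR('k) dvd \<alpha> \<and> CHAR('k) dvd \<beta> \<longrightarrow> coeff2 F \<alpha> \<beta> = 0) \<and>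
    (\<exists>q. subst2 F Y Z = germ a f + q ^ CHAR('k))"
    using F(1)[unfolded off_powers_def] F(2)[unfolded mod_powers_eq_iff[OF p]] by (rule conjI)
next
  fix G
  assume "(\<forall>\<alpha> \<beta>. CHAR('k) dvd \<alpha> \<and> CHAR('k) dvd \<beta> \<longrightarrow> coeff2 G \<alpha> \<beta> = 0) \<and>
    (\<exists>q. subst2 G Y Z = germ a f + q ^ CHAR('k))"
  then have G: "off_powers G" "mod_powers (subst2 G Y Z) = mod_powers (germ a f)"
    unfolding off_powers_def mod_powers_eq_iff[OF p] by - (erule conjunct1, erule conjunct2)
  then have "mod_powers G = mod_powers F" using F by (metis mod_powers_subst2_inj[OF p c])
  then show "G = F" using F G by (simp add: mod_powers_off_powers)
qed

lemma expansion_props: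
  fixes f :: "'k::alg_closed_field poly poly"
  assumes p: "prime CHAR('k)" and c: "(Y, Z) \<in> local_coordinates"
  shows "off_powers (expansion a (Y, Z) f)"
    "mod_powers (subst2 (expansion a (Y, Z) f) Y Z) = mod_powers (germ a f)"
proof -
  note m = local_coordinates_max[OF c]
  obtain G where G: "subst2 G Y Z = germ a f" using subst2_surj[OF c] by blast
  have "mod_powers (subst2 (mod_powers G) Y Z) = mod_powers (germ a f)" by (simp add: mod_powers_subst2_mod_powers[OF p m] G)
  with expansion_eqI[OF p c off_powers_mod_powers this]
  show "off_powers (expansion a (Y, Z) f)" "mod_powers (subst2 (expansion a (Y, Z) f) Y Z) = mod_powers (germ a f)"
    by simp_all
qed

text \<open>
  The Newton polygon depends only on the set of exponents up to this preorder.
\<close>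

definition supp_dom :: "'k::zero fps fps \<Rightarrow> 'k fps fps \<Rightarrow> bool" where
  "supp_dom F G \<longleftrightarrow> (\<forall>i j. coeff2 F i j \<noteq> 0 \<longrightarrow> (\<exists>i'\<le>i. \<exists>j'\<le>j. coeff2 G i' j' \<noteq> 0))"

lemma supp_dom_trans: "supp_dom F G \<Longrightarrow> supp_dom G H \<Longrightarrow> supp_dom F H"
  unfolding supp_dom_def by (meson order_trans)

lemma supp_dom_mod_powers: "supp_dom (mod_powers F) F"
  unfolding supp_dom_def coeff2_mod_powers by (metis order_refl)

lemma newton_polygon_mono:
  assumes "supp_dom F G"
  shows "newton_polygon F \<subseteq> newton_polygon G"
  unfolding newton_polygon_def
proof (rule hull_mono, rule subsetI)
  fix x
  assume "x \<in> {(real \<alpha> + s, real \<beta> + t) | \<alpha> \<beta> s t. coeff2 F \<alpha> \<beta> \<noteq> 0 \<and> 0 \<le> s \<and> 0 \<le> t}"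
  then obtain \<alpha> \<beta> s t where x: "x = (real \<alpha> + s, real \<beta> + t)" "coeff2 F \<alpha> \<beta> \<noteq> 0" "0 \<le> s" "0 \<le> t"
    by blast
  then obtain i j where ij: "i \<le> \<alpha>" "j \<le> \<beta>" "coeff2 G i j \<noteq> 0"
    using assms x(2) unfolding supp_dom_def by blast
  have "x = (real i + (real (\<alpha> - i) + s), real j + (real (\<beta> - j) + t))"
    using ij x by (simp add: of_nat_diff)
  then show "x \<in> {(real \<alpha> + s, real \<beta> + t) | \<alpha> \<beta> s t. coeff2 G \<alpha> \<beta> \<noteq> 0 \<and> 0 \<le> s \<and> 0 \<le> t}"
    using x(3,4) ij(3) by (intro CollectI exI[of _ i] exI[of _ j]
      exI[of _ "real (\<alpha> - i) + s"] exI[of _ "real (\<beta> - j) + t"]) simp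
qed

lemma supp_dom_subst2_units:
  fixes F U V :: "'k::comm_ring_1 fps fps"
  shows "supp_dom (subst2 F (U * fps_y) (V * fps_z)) F"
  unfolding supp_dom_def
proof (intro allI impI)
  fix i j
  assume in_supp: "coeff2 (subst2 F (U * fps_y) (V * fps_z)) i j \<noteq> 0"
  have "coeff2 (subst2 F (U * fps_y) (V * fps_z)) i j =
    (\<Sum>a\<le>i+j. \<Sum>b\<le>i+j. coeff2 F a b * coeff2 ((U * fps_y) ^ a * (V * fps_z) ^ b) i j)"
    by (rule coeff2_subst2) (simp_all add: max_ideal_ops)
  with in_supp have "(\<Sum>a\<le>i+j. \<Sum>b\<le>i+j. coeff2 F a b * coeff2 ((U * fps_y) ^ a * (V * fps_z) ^ b) i j) \<noteq> 0"
    by simp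
  then obtain a where "(\<Sum>b\<le>i+j. coeff2 F a b * coeff2 ((U * fps_y) ^ a * (V * fps_z) ^ b) i j) \<noteq> 0"
    by (rule sum.not_neutral_contains_not_neutral)
  then obtain b where ab: "coeff2 F a b * coeff2 ((U * fps_y) ^ a * (V * fps_z) ^ b) i j \<noteq> 0"
    by (rule sum.not_neutral_contains_not_neutral)
  have "(U * fps_y) ^ a * (V * fps_z) ^ b = fps_y ^ a * fps_z ^ b * (U ^ a * V ^ b)"
    by (simp add: power_mult_distrib algebra_simps)
  then have "a \<le> i \<and> b \<le> j" using ab by (auto simp: coeff2_monom_mult split: if_splits)
  moreover have "coeff2 F a b \<noteq> 0" using ab by auto
  ultimately show "\<exists>i'\<le>i. \<exists>j'\<le>j. coeff2 F i' j' \<noteq> 0" by blast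
qed

lemma local_coordinates_units:
  fixes Y Z :: "'k::field fps fps"
  assumes "(Y, Z) \<in> local_coordinates" "U dvd 1" "V dvd 1"
  shows "(U * Y, V * Z) \<in> local_coordinates"
proof -
  have "jac (U * Y) (V * Z) = coeff2 U 0 0 * coeff2 V 0 0 * jac Y Z"
    using local_coordinates_max[OF assms(1)]
    by (simp add: jac_def coeff2_mult_lin max_ideal_iff algebra_simps)
  then show ?thesis using assms by (auto simp: local_coordinates_iff unit2_iff intro: max_ideal_ops)
qed

lemma newton_polygon_units_subset:
  fixes Y Z :: "'k::alg_closed_field fps fps"
  assumes p: "prime CHAR('k)" and c: "(Y, Z) \<in> local_coordinates" and UV: "U dvd 1" "V dvd 1"
  shows "newton_polygon (expansion a (Y, Z) f) \<subseteq> newton_polygon (expansion a (U * Y, V * Z) f)"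
proof -
  note m = local_coordinates_max[OF c]
  define F where "F = expansion a (U * Y, V * Z) f"
  have F: "off_powers F" "mod_powers (subst2 F (U * Y) (V * Z)) = mod_powers (germ a f)"
    unfolding F_def by (rule expansion_props[OF p local_coordinates_units[OF c UV]])+
  obtain U' V' where U': "subst2 U' Y Z = U" "subst2 V' Y Z = V" using subst2_surj[OF c] by metis
  define G where "G = subst2 F (U' * fps_y) (V' * fps_z)"
  have "subst2 G Y Z = subst2 F (U * Y) (V * Z)"
    unfolding G_def by (simp add: subst2_comp m max_ideal_ops subst2_mult subst2_simps U')
  then have "expansion a (Y, Z) f = mod_powers G"
    using F(2) by (intro expansion_eqI[OF p c off_powers_mod_powers]) (simp add: mod_powers_subst2_mod_powers[OF p m])
  moreover have "supp_dom (mod_powers G) F"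
    unfolding G_def by (rule supp_dom_trans[OF supp_dom_mod_powers supp_dom_subst2_units])
  ultimately show ?thesis unfolding F_def[symmetric] by (simp add: newton_polygon_mono)
qed

text \<open>
  Multiplying both coordinates by units moves exponents only upwards, and the inverse units move them back.
\<close>

lemma newton_polygon_units:
  fixes Y Z :: "'k::alg_closed_field fps fps"
  assumes p: "prime CHAR('k)" and c: "(Y, Z) \<in> local_coordinates" and UV: "U dvd 1" "V dvd 1"
  shows "newton_polygon (expansion a (U * Y, V * Z) f) = newton_polygon (expansion a (Y, Z) f)"
proof (rule antisym)
  obtain U' V' where U': "U' * U = 1" "U' dvd 1" "V' * V = 1" "V' dvd 1"
    using unit2_inverse[OF UV(1)] unit2_inverse[OF UV(2)] by metis
  then have e: "U' * (U * Y) = Y" "V' * (V * Z) = Z" by (simp_all flip: mult.assoc)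
  show "newton_polygon (expansion a (U * Y, V * Z) f) \<subseteq> newton_polygon (expansion a (Y, Z) f)"
    using newton_polygon_units_subset[OF p local_coordinates_units[OF c UV] U'(2,4), of a f] unfolding e .
qed (rule newton_polygon_units_subset[OF assms])

definition shift :: "'k::comm_ring_1 fps \<Rightarrow> 'k fps fps \<Rightarrow> 'k fps fps" where
  "shift g F = subst2 F (fps_y + fps_const g) fps_z"

text \<open>
  The expansion after replacing the first coordinate \<open>Y\<close> by \<open>Y - g(Z)\<close>.
\<close>

definition recoord :: "'k::field fps \<Rightarrow> 'k fps fps \<Rightarrow> 'k fps fps" where
  "recoord g F = mod_powers (shift g F)"

lemma fps_const_max: "fps_nth g 0 = 0 \<Longrightarrow> fps_const g \<in> max_ideal"
  by (simp add: max_ideal_iff coeff2_fps_const)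

lemma subst2_fps_const_indep:
  fixes Y Y' Z :: "'k::comm_ring_1 fps fps"
  assumes "Y \<in> max_ideal" "Y' \<in> max_ideal" "Z \<in> max_ideal"
  shows "subst2 (fps_const g) Y Z = subst2 (fps_const g) Y' Z"
proof (rule fps2_eqI)
  fix i j
  show "coeff2 (subst2 (fps_const g) Y Z) i j = coeff2 (subst2 (fps_const g) Y' Z) i j"
    unfolding coeff2_subst2[OF assms(1,3) order_refl] coeff2_subst2[OF assms(2,3) order_refl]
    by (intro sum.cong refl) (auto simp: coeff2_fps_const)
qed

lemma base_change:
  fixes Y Z :: "'k::alg_closed_field fps fps"
  assumes p: "prime CHAR('k)" and c: "(Y, Z) \<in> local_coordinates" and g: "fps_nth g 0 = 0"
  defines "Y' \<equiv> Y - subst2 (fps_const g) Y Z"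
  shows "(Y', Z) \<in> local_coordinates" "expansion a (Y', Z) f = recoord g (expansion a (Y, Z) f)"
proof -
  note m = local_coordinates_max[OF c]
  note gm = fps_const_max[OF g]
  have Y': "Y' = subst2 (fps_y - fps_const g) Y Z"
    by (simp add: Y'_def subst2_simps[OF m])
  have "(subst2 (fps_y - fps_const g) Y Z, subst2 fps_z Y Z) \<in> local_coordinates"
    unfolding local_coordinates_subst2[OF c]
    by (simp add: local_coordinates_iff max_ideal_ops gm jac_def coeff2_fps_y coeff2_fps_z coeff2_fps_const)
  then show c': "(Y', Z) \<in> local_coordinates" by (simp add: Y' subst2_simps[OF m])
  note m' = local_coordinates_max[OF c']
  define F where "F = expansion a (Y, Z) f"
  have F: "off_powers F" "mod_powers (subst2 F Y Z) = mod_powers (germ a f)"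
    unfolding F_def by (rule expansion_props[OF p c])+
  have "subst2 (shift g F) Y' Z = subst2 F (Y' + subst2 (fps_const g) Y' Z) Z"
    by (simp add: shift_def subst2_comp m' max_ideal_ops gm subst2_add subst2_simps)
  also have "subst2 (fps_const g) Y' Z = subst2 (fps_const g) Y Z"
    by (rule subst2_fps_const_indep[OF m'(1) m])
  finally have "subst2 (shift g F) Y' Z = subst2 F Y Z" by (simp add: Y'_def)
  then show "expansion a (Y', Z) f = recoord g (expansion a (Y, Z) f)"
    unfolding F_def[symmetric] recoord_def using F
    by (intro expansion_eqI[OF p c']) (simp_all add: mod_powers_subst2_mod_powers[OF p m'])
qed

text \<open>
  The new first coordinate is a series $E$ in the old coordinates with nonzero linear coefficient in $y$,
  so the implicit function theorem writes it as a unit times $y-g(z)$.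
\<close>

lemma subordinate_param:
  fixes Y Z :: "'k::alg_closed_field fps fps"
  assumes p: "prime CHAR('k)" and c0: "(Y0, Z0) \<in> subordinate h" and c: "(Y, Z) \<in> subordinate h"
  shows "\<exists>g. fps_nth g 0 = 0 \<and>
    newton_polygon (expansion a (Y, Z) f) = newton_polygon (recoord g (expansion a (Y0, Z0) f))"
proof -
  obtain v0 v where lc0: "(Y0, Z0) \<in> local_coordinates" and v0: "v0 dvd 1" "Z0 = v0 * h"
    and lc: "(Y, Z) \<in> local_coordinates" and v: "v dvd 1" "Z = v * h"
    using c0 c by (auto simp: subordinate_iff)
  obtain v1 where v1: "v1 * v0 = 1" "v1 dvd 1" using unit2_inverse[OF v0(1)] by metis
  define w where "w = v * v1"
  have w: "Z = w * Z0" "w dvd 1"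
  proof -
    have "w * Z0 = v * (v1 * v0) * h" by (simp add: w_def v0 mult.assoc)
    then show "Z = w * Z0" by (simp add: v1 v)
    show "w dvd 1" unfolding w_def using v(1) v1(2) by (simp add: unit2_iff coeff2_mult_00)
  qed
  note m0 = local_coordinates_max[OF lc0]
  obtain E w' where E: "subst2 E Y0 Z0 = Y" "subst2 w' Y0 Z0 = w" using subst2_surj[OF lc0] by metis
  have "subst2 (w' * fps_z) Y0 Z0 = Z" by (simp add: subst2_mult m0 subst2_simps E w)
  then have "(E, w' * fps_z) \<in> local_coordinates"
    using local_coordinates_subst2[OF lc0, of E "w' * fps_z"] lc E by simp
  then have "E \<in> max_ideal" "coeff2 E 1 0 \<noteq> 0"
    by (auto simp: local_coordinates_iff jac_def coeff2_mult_lin coeff2_fps_z)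
  then obtain g U where g: "fps_nth g 0 = 0" "U dvd 1" "E = U * (fps_y - fps_const g)"
    using implicit_function by metis
  define Y1 where "Y1 = Y0 - subst2 (fps_const g) Y0 Z0"
  define u where "u = subst2 U Y0 Z0"
  have u: "u dvd 1" using g(2) by (simp add: u_def unit2_iff coeff2_subst2_00 m0)
  have Y: "Y = u * Y1"
    unfolding E(1)[symmetric] g(3) Y1_def u_def by (simp add: subst2_mult m0 subst2_simps)
  have "newton_polygon (expansion a (Y, Z) f) = newton_polygon (expansion a (Y1, Z0) f)"
    unfolding Y w(1)
    by (rule newton_polygon_units[OF p _ u w(2)]) (simp add: Y1_def base_change[OF p lc0 g(1)])
  also have "expansion a (Y1, Z0) f = recoord g (expansion a (Y0, Z0) f)"
    unfolding Y1_def by (rule base_change[OF p lc0 g(1)])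
  finally show ?thesis using g(1) by blast
qed

section \<open>Newton polygons\<close>

definition in_supp :: "'k::zero fps fps \<Rightarrow> nat \<Rightarrow> nat \<Rightarrow> bool" where
  "in_supp F i j \<longleftrightarrow> coeff2 F i j \<noteq> 0"

lemma in_newton_polygon: "in_supp F i j \<Longrightarrow> 0 \<le> s \<Longrightarrow> 0 \<le> t \<Longrightarrow> (real i + s, real j + t) \<in> newton_polygon F"
  unfolding newton_polygon_def in_supp_def by (rule hull_inc) blast

lemma convex_newton_polygon: "convex (newton_polygon F)"
  unfolding newton_polygon_def by (rule convex_convex_hull)

lemma not_extreme_between:
  fixes x p q :: "real \<times> real"
  assumes "convex N" "p \<in> N" "q \<in> N" "p \<noteq> q" "x = (1 - t) *\<^sub>R p + t *\<^sub>R q" "0 < t" "t < 1"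
  shows "\<not> x extreme_point_of N"
proof -
  have "x \<in> open_segment p q" using assms by (auto simp: in_segment)
  then show ?thesis using assms by (auto simp: extreme_point_of_def)
qed

text \<open>
  A point of the support that is the only minimum of a positive linear functional is a vertex. All
  vertices needed below are found as lexicographic minima, with weights large enough to break ties.
\<close>

lemma vertexI:
  fixes u v :: nat
  assumes in_supp: "in_supp F a b" and uv: "u > 0" "v > 0"
    and less: "\<And>i j. in_supp F i j \<Longrightarrow> (i, j) \<noteq> (a, b) \<Longrightarrow> u * a + v * b < u * i + v * j"
  shows "(a, b) \<in> vertices F"
proof -
  define l :: "real \<times> real \<Rightarrow> real" where "l w = real u * fst w + real v * snd w" for w
  define x where "x = (real a, real b)"
  \<comment> \<open>A convex set containing the polygon in which $x$ is visibly extreme.\<close>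
  define C where "C = {w. w = x \<or> l w > l x}"
  have lin: "l (s *\<^sub>R p + t *\<^sub>R q) = s * l p + t * l q" for s t p q
    by (simp add: l_def algebra_simps)
  have "convex C"
  proof (rule convexI)
    fix p q :: "real \<times> real" and s t :: real
    assume pq: "p \<in> C" "q \<in> C" and st: "0 \<le> s" "0 \<le> t" "s + t = 1"
    consider "s = 0" | "t = 0" | "p = x" "q = x" | "s > 0" "t > 0" "p \<noteq> x \<or> q \<noteq> x" using st by linarith
    then show "s *\<^sub>R p + t *\<^sub>R q \<in> C"
    proof cases
      case 3
      then have "s *\<^sub>R p + t *\<^sub>R q = (s + t) *\<^sub>R x" by (simp add: scaleR_add_left)
      then show ?thesis using pq st 3 by simp
    next
      case 4
      have ge: "l p \<ge> l x" "l q \<ge> l x" using pq by (auto simp: C_def)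
      have "s * l x + t * l x < s * l p + t * l q"
      proof (cases "p \<noteq> x")
        case True
        then have "l p > l x" using pq by (auto simp: C_def)
        then have "s * l x < s * l p" "t * l x \<le> t * l q" using 4 ge by (auto intro: mult_left_mono)
        then show ?thesis by linarith
      next
        case False
        then have "l q > l x" using pq 4 by (auto simp: C_def)
        then have "s * l x \<le> s * l p" "t * l x < t * l q" using 4 ge by (auto intro: mult_left_mono)
        then show ?thesis by linarith
      qed
      moreover have "s * l x + t * l x = l x" using st(3) by (metis distrib_right mult_1)
      ultimately show ?thesis by (simp add: C_def lin)
    qed (use pq st in auto)
  qed
  moreover have "{(real \<alpha> + s, real \<beta> + t) | \<alpha> \<beta> s t. coeff2 F \<alpha> \<beta> \<noteq> 0 \<and> 0 \<le> s \<and> 0 \<le> t} \<subseteq> C"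
  proof clarify
    fix i j and s t :: real
    assume h: "coeff2 F i j \<noteq> 0" "0 \<le> s" "0 \<le> t"
    have st: "0 \<le> u * s" "0 \<le> v * t" using h by auto
    show "(real i + s, real j + t) \<in> C"
    proof (cases "(i, j) = (a, b)")
      case True
      show ?thesis
      proof (cases "s = 0 \<and> t = 0")
        case True
        then show ?thesis using \<open>(i, j) = (a, b)\<close> by (simp add: C_def x_def)
      next
        case False
        then have "0 < u * s \<or> 0 < v * t" using h uv by auto
        then show ?thesis using st \<open>(i, j) = (a, b)\<close> by (auto simp: C_def l_def x_def algebra_simps)
      qed
    next
      case False
      then have "u * a + v * b < u * i + v * j" using less h by (simp add: in_supp_def)
      then have "real u * a + v * b < u * i + v * j" by (metis of_nat_add of_nat_less_iff of_nat_mult)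
      then show ?thesis using st by (simp add: C_def l_def x_def algebra_simps)
    qed
  qed
  ultimately have NC: "newton_polygon F \<subseteq> C" unfolding newton_polygon_def by (rule hull_minimal[rotated])
  have "x \<in> newton_polygon F" using in_newton_polygon[OF in_supp, of 0 0] by (simp add: x_def)
  moreover have "x \<notin> open_segment p q" if pq: "p \<in> newton_polygon F" "q \<in> newton_polygon F" for p q
  proof
    assume "x \<in> open_segment p q"
    then obtain t where t: "0 < t" "t < 1" "x = (1 - t) *\<^sub>R p + t *\<^sub>R q" "p \<noteq> q"
      by (auto simp: in_segment)
    have C: "p \<in> C" "q \<in> C" using pq NC by auto
    have "l x = (1 - t) * l p + t * l q" using lin t(3) by metis
    then have e: "(1 - t) * (l p - l x) + t * (l q - l x) = 0" by (simp add: algebra_simps)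
    have "(1 - t) * (l p - l x) \<ge> 0" "t * (l q - l x) \<ge> 0" using C t by (auto simp: C_def)
    with e have "(1 - t) * (l p - l x) = 0" "t * (l q - l x) = 0" by linarith+
    then have "l p = l x" "l q = l x" using t(1,2) unfolding mult_eq_0_iff by linarith+
    then have "p = x" "q = x" using C by (auto simp: C_def)
    then show False using t(4) by simp
  qed
  ultimately show ?thesis by (simp add: vertices_def extreme_point_of_def x_def)
qed

lemma vertex_no_offset:
  assumes "(a, b) \<in> vertices F" "in_supp F i j" "real a = real i + s" "real b = real j + t" "0 \<le> s" "0 \<le> t"
  shows "s = 0 \<and> t = 0"
proof (rule ccontr)
  assume "\<not> (s = 0 \<and> t = 0)"
  then have st: "(0::real, 0::real) \<noteq> (2 * s, 2 * t)" by auto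
  have "\<not> (real a, real b) extreme_point_of newton_polygon F"
  proof (rule not_extreme_between[OF convex_newton_polygon])
    show "(real i + 0, real j + 0) \<in> newton_polygon F" "(real i + 2 * s, real j + 2 * t) \<in> newton_polygon F"
      by (rule in_newton_polygon; use assms in simp)+
    show "(real a, real b) = (1 - 1/2) *\<^sub>R (real i + 0, real j + 0) + (1/2) *\<^sub>R (real i + 2 * s, real j + 2 * t)"
      using assms by (simp add: field_simps)
  qed (use st in auto)
  then show False using assms(1) by (simp add: vertices_def)
qed

lemma vertex_in_supp: "(a, b) \<in> vertices F \<Longrightarrow> in_supp F a b"
proof -
  assume v: "(a, b) \<in> vertices F"
  then have "(real a, real b) extreme_point_of newton_polygon F" by (simp add: vertices_def)
  then have "(real a, real b) \<in> {(real \<alpha> + s, real \<beta> + t) | \<alpha> \<beta> s t. coeff2 F \<alpha> \<beta> \<noteq> 0 \<and> 0 \<le> s \<and> 0 \<le> t}"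
    unfolding newton_polygon_def by (rule extreme_point_of_convex_hull)
  then obtain i j s t where h: "real a = real i + s" "real b = real j + t" "in_supp F i j" "0 \<le> s" "0 \<le> t"
    unfolding in_supp_def by blast
  from vertex_no_offset[OF v h(3,1,2,4,5)] show "in_supp F a b" using h by simp
qed

lemma vertex_minimal:
  assumes "(a, b) \<in> vertices F" "in_supp F i j" "i \<le> a" "j \<le> b"
  shows "i = a \<and> j = b"
  using vertex_no_offset[OF assms(1,2), of "real a - real i" "real b - real j"] assms(3,4) by auto

lemma vertex_inj: "(a, b) \<in> vertices F \<Longrightarrow> (a, c) \<in> vertices F \<Longrightarrow> b = c"
  by (metis vertex_minimal vertex_in_supp nle_le)

text \<open>
  Vertices form an antichain, hence are finitely many; therefore the minima and maxima over the
  vertices in the definitions of the measures are meaningful.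
\<close>

lemma finite_vertices: "finite (vertices F)"
proof (cases "vertices F = {}")
  case False
  then obtain a b where ab: "(a, b) \<in> vertices F" by auto
  have 1: "inj_on fst (vertices F)" by (auto simp: inj_on_def intro: vertex_inj)
  have 2: "inj_on snd (vertices F)"
    by (auto simp: inj_on_def) (metis vertex_minimal vertex_in_supp nle_le order_refl)
  have "finite {v \<in> vertices F. fst v \<le> a}"
    by (rule finite_imageD[of fst]) (auto intro: finite_subset[of _ "{..a}"] inj_on_subset[OF 1])
  moreover have "finite {v \<in> vertices F. snd v \<le> b}"
    by (rule finite_imageD[of snd]) (auto intro: finite_subset[of _ "{..b}"] inj_on_subset[OF 2])
  moreover have "vertices F \<subseteq> {v \<in> vertices F. fst v \<le> a} \<union> {v \<in> vertices F. snd v \<le> b}"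
    using ab by (auto dest: vertex_minimal[OF _ vertex_in_supp[OF ab]])
  ultimately show ?thesis by (meson finite_UnI finite_subset)
qed simp

lemma ord_eqI:
  assumes "in_supp F a b" "a + b = n" and min: "\<And>i j. in_supp F i j \<Longrightarrow> n \<le> i + j"
  shows "ord F = n"
proof -
  define c where "c = (LEAST c. \<exists>b. in_supp F c b \<and> c + b = n)"
  have "\<exists>b. in_supp F c b \<and> c + b = n" unfolding c_def by (rule LeastI_ex) (use assms in blast)
  then obtain b' where b': "in_supp F c b'" "c + b' = n" by blast
  have least: "c \<le> i" if "in_supp F i j" "i + j = n" for i j
    unfolding c_def by (rule Least_le) (use that in blast)
  have "(c, b') \<in> vertices F"
  proof (rule vertexI[OF b'(1), of "c + 2" "c + 1"])
    fix i j assume ij: "in_supp F i j" "(i, j) \<noteq> (c, b')"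
    have e: "(c + 2) * x + (c + 1) * y = (c + 1) * (x + y) + x" for x y :: nat by (simp add: algebra_simps)
    show "(c + 2) * c + (c + 1) * b' < (c + 2) * i + (c + 1) * j"
    proof (cases "i + j = n")
      case True
      then have "c < i" using least[OF ij(1) True] ij b' by (cases "i = c") auto
      then show ?thesis unfolding e b'(2) True by simp
    next
      case False
      then have "n + 1 \<le> i + j" using min[OF ij(1)] by simp
      then have "(c + 1) * (n + 1) \<le> (c + 1) * (i + j)" by (rule mult_le_mono2)
      then show ?thesis unfolding e b'(2) by simp
    qed
  qed auto
  then have "n \<in> (\<lambda>(\<alpha>, \<beta>). \<alpha> + \<beta>) ` vertices F" using b'(2) by force
  moreover have "n \<le> i + j" if "(i, j) \<in> vertices F" for i j using min[OF vertex_in_supp[OF that]] .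
  ultimately show ?thesis unfolding ord_def
    by (intro Min_eqI) (auto simp: finite_vertices)
qed

lemma ord_y_vertex:
  assumes "in_supp F a b" and min: "\<And>i j. in_supp F i j \<Longrightarrow> a \<le> i" and minb: "\<And>j. in_supp F a j \<Longrightarrow> b \<le> j"
  shows "(a, b) \<in> vertices F"
proof (rule vertexI[OF assms(1), of "b + 1" 1])
  fix i j assume ij: "in_supp F i j" "(i, j) \<noteq> (a, b)"
  show "(b + 1) * a + 1 * b < (b + 1) * i + 1 * j"
  proof (cases "i = a")
    case True
    then show ?thesis using minb[of j] ij by auto
  next
    case False
    then have "a + 1 \<le> i" using min[OF ij(1)] by simp
    then have "(b + 1) * (a + 1) \<le> (b + 1) * i" by (rule mult_le_mono2)
    then show ?thesis by simp
  qed
qed auto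

lemma ord_z_vertex:
  assumes "in_supp F a b" and min: "\<And>i j. in_supp F i j \<Longrightarrow> b \<le> j" and mina: "\<And>i. in_supp F i b \<Longrightarrow> a \<le> i"
  shows "(a, b) \<in> vertices F"
proof (rule vertexI[OF assms(1), of 1 "a + 1"])
  fix i j assume ij: "in_supp F i j" "(i, j) \<noteq> (a, b)"
  show "1 * a + (a + 1) * b < 1 * i + (a + 1) * j"
  proof (cases "j = b")
    case True
    then show ?thesis using mina[of i] ij by auto
  next
    case False
    then have "b + 1 \<le> j" using min[OF ij(1)] by simp
    then have "(a + 1) * (b + 1) \<le> (a + 1) * j" by (rule mult_le_mono2)
    then show ?thesis by simp
  qed
qed auto

lemma least_in_supp_z: "in_supp F a b \<Longrightarrow> \<exists>b'. in_supp F a b' \<and> (\<forall>j. in_supp F a j \<longrightarrow> b' \<le> j)"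
  by (metis LeastI Least_le)

lemma least_in_supp_y: "in_supp F a b \<Longrightarrow> \<exists>a'. in_supp F a' b \<and> (\<forall>i. in_supp F i b \<longrightarrow> a' \<le> i)"
  using LeastI[of "\<lambda>a. in_supp F a b"] Least_le[of "\<lambda>a. in_supp F a b"] by blast

lemma ord_y_eqI:
  assumes "in_supp F a b" and min: "\<And>i j. in_supp F i j \<Longrightarrow> a \<le> i"
  shows "ord_y F = a"
proof -
  obtain b' where b': "in_supp F a b'" "\<And>j. in_supp F a j \<Longrightarrow> b' \<le> j" using least_in_supp_z[OF assms(1)] by blast
  have "(a, b') \<in> vertices F" by (rule ord_y_vertex[OF b'(1) min b'(2)])
  then have "a \<in> fst ` vertices F" by force
  moreover have "a \<le> i" if "(i, j) \<in> vertices F" for i j using min[OF vertex_in_supp[OF that]] .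
  ultimately show ?thesis unfolding ord_y_def
    by (intro Min_eqI) (auto simp: finite_vertices)
qed

lemma ord_z_eqI:
  assumes "in_supp F a b" and min: "\<And>i j. in_supp F i j \<Longrightarrow> b \<le> j"
  shows "ord_z F = b"
proof -
  obtain a' where a': "in_supp F a' b" "\<And>i. in_supp F i b \<Longrightarrow> a' \<le> i" using least_in_supp_y[OF assms(1)] by blast
  have "(a', b) \<in> vertices F" by (rule ord_z_vertex[OF a'(1) min a'(2)])
  then have "b \<in> snd ` vertices F" by force
  moreover have "b \<le> j" if "(i, j) \<in> vertices F" for i j using min[OF vertex_in_supp[OF that]] .
  ultimately show ?thesis unfolding ord_z_def
    by (intro Min_eqI) (auto simp: finite_vertices)
qed

lemma fst_vertex_le:
  assumes "in_supp F d s" and min: "\<And>i j. in_supp F i j \<Longrightarrow> s \<le> j" and v: "(a, b) \<in> vertices F"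
  shows "a \<le> d"
  using vertex_minimal[OF v assms(1)] min[OF vertex_in_supp[OF v]] by (cases "d \<le> a") auto

lemma deg_y_eqI:
  assumes "in_supp F d s" and min: "\<And>i j. in_supp F i j \<Longrightarrow> s \<le> j" and mind: "\<And>i. in_supp F i s \<Longrightarrow> d \<le> i"
  shows "deg_y F = d"
proof -
  have "(d, s) \<in> vertices F" by (rule ord_z_vertex[OF assms])
  then have "d \<in> fst ` vertices F" by force
  then show ?thesis unfolding deg_y_def
    by (intro Max_eqI) (auto simp: finite_vertices intro: fst_vertex_le[OF assms(1,2)])
qed

lemma deg_z_eqI:
  assumes "in_supp F a b" and min: "\<And>i j. in_supp F i j \<Longrightarrow> a \<le> i" and minb: "\<And>j. in_supp F a j \<Longrightarrow> b \<le> j"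
  shows "deg_z F = b"
proof -
  have v: "(a, b) \<in> vertices F" by (rule ord_y_vertex[OF assms])
  then have "b \<in> snd ` vertices F" by force
  moreover have "y \<le> b" if "(x, y) \<in> vertices F" for x y
    using vertex_minimal[OF that assms(1)] min[OF vertex_in_supp[OF that]] by (cases "b \<le> y") auto
  ultimately show ?thesis unfolding deg_z_def
    by (intro Max_eqI) (auto simp: finite_vertices)
qed

lemma in_supp_ex: "F \<noteq> 0 \<Longrightarrow> \<exists>i j. in_supp F i j"
  unfolding in_supp_def by (auto simp: coeff2_def fps_eq_iff)

lemma ord_spec:
  assumes "F \<noteq> 0"
  shows "\<exists>i j. in_supp F i j \<and> i + j = ord F" "\<And>i j. in_supp F i j \<Longrightarrow> ord F \<le> i + j"
proof -
  define n where "n = (LEAST n. \<exists>i j. in_supp F i j \<and> i + j = n)"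
  have "\<exists>i j. in_supp F i j \<and> i + j = n" unfolding n_def by (rule LeastI_ex) (use in_supp_ex[OF assms] in blast)
  then obtain i j where ij: "in_supp F i j" "i + j = n" by blast
  have min: "n \<le> i + j" if "in_supp F i j" for i j unfolding n_def by (rule Least_le) (use that in blast)
  have "ord F = n" by (rule ord_eqI[OF ij min])
  then show "\<exists>i j. in_supp F i j \<and> i + j = ord F" "\<And>i j. in_supp F i j \<Longrightarrow> ord F \<le> i + j"
    using ij min by auto
qed

lemma ord_y_spec:
  assumes "F \<noteq> 0"
  shows "\<exists>j. in_supp F (ord_y F) j" "\<And>i j. in_supp F i j \<Longrightarrow> ord_y F \<le> i"
proof -
  define n where "n = (LEAST i. \<exists>j. in_supp F i j)"
  have "\<exists>j. in_supp F n j" unfolding n_def by (rule LeastI_ex) (use in_supp_ex[OF assms] in blast)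
  then obtain j where j: "in_supp F n j" by blast
  have min: "n \<le> i" if "in_supp F i j" for i j unfolding n_def by (rule Least_le) (use that in blast)
  have "ord_y F = n" by (rule ord_y_eqI[OF j min])
  then show "\<exists>j. in_supp F (ord_y F) j" "\<And>i j. in_supp F i j \<Longrightarrow> ord_y F \<le> i"
    using j min by auto
qed

lemma ord_z_spec:
  assumes "F \<noteq> 0"
  shows "\<And>i j. in_supp F i j \<Longrightarrow> ord_z F \<le> j" "in_supp F (deg_y F) (ord_z F)"
    "\<And>i. in_supp F i (ord_z F) \<Longrightarrow> deg_y F \<le> i"
proof -
  define n where "n = (LEAST j. \<exists>i. in_supp F i j)"
  have "\<exists>i. in_supp F i n" unfolding n_def by (rule LeastI_ex) (use in_supp_ex[OF assms] in blast)
  then obtain i0 where "in_supp F i0 n" by blast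
  from least_in_supp_y[OF this] obtain d where d: "in_supp F d n" "\<And>i. in_supp F i n \<Longrightarrow> d \<le> i" by blast
  have min: "n \<le> j" if "in_supp F i j" for i j unfolding n_def by (rule Least_le) (use that in blast)
  have e: "ord_z F = n" "deg_y F = d" using ord_z_eqI[OF d(1) min] deg_y_eqI[OF d(1) min d(2)] by auto
  show "\<And>i j. in_supp F i j \<Longrightarrow> ord_z F \<le> j" "in_supp F (deg_y F) (ord_z F)"
    "\<And>i. in_supp F i (ord_z F) \<Longrightarrow> deg_y F \<le> i" unfolding e using d min by auto
qed

lemma ord_y_le_deg_y: "F \<noteq> 0 \<Longrightarrow> ord_y F \<le> deg_y F"
  using ord_y_spec(2) ord_z_spec(2) by blast

lemma ord_ge: "F \<noteq> 0 \<Longrightarrow> ord_y F + ord_z F \<le> ord F"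
  using ord_spec(1)[of F] ord_y_spec(2)[of F] ord_z_spec(1)[of F] by (metis add_mono)

lemma ord_le_deg: "F \<noteq> 0 \<Longrightarrow> ord F \<le> deg_y F + ord_z F"
  using ord_spec(2) ord_z_spec(2) by blast

lemma shade_corner:
  assumes "F \<noteq> 0" "in_supp F (ord_y F) (ord_z F)" shows "shade F = 0"
  using ord_ge[OF assms(1)] ord_spec(2)[OF assms] by (simp add: shade_def)

lemma quadrant_shade:
  assumes F: "F \<noteq> 0" and q: "is_quadrant F"
  shows "shade F = 0"
proof -
  obtain \<alpha> \<beta> where N: "newton_polygon F = {(s, t). \<alpha> \<le> s \<and> \<beta> \<le> t}"
    using q by (auto simp: is_quadrant_def)
  have v: "real a = \<alpha>" if "(a, b) \<in> vertices F" for a b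
  proof (rule ccontr)
    assume ne: "real a \<noteq> \<alpha>"
    have ex: "(real a, real b) extreme_point_of newton_polygon F" using that by (simp add: vertices_def)
    then have ge: "\<alpha> \<le> real a" "\<beta> \<le> real b" using N by (auto simp: extreme_point_of_def)
    have "\<not> (real a, real b) extreme_point_of newton_polygon F"
    proof (rule not_extreme_between[OF convex_newton_polygon])
      show "(\<alpha>, real b) \<in> newton_polygon F" "(2 * real a - \<alpha>, real b) \<in> newton_polygon F"
        using ge by (auto simp: N)
      show "(real a, real b) = (1 - 1/2) *\<^sub>R (\<alpha>, real b) + (1/2) *\<^sub>R (2 * real a - \<alpha>, real b)"
        by (simp add: field_simps)
    qed (use ne in auto)
    then show False using ex by blast
  qed
  obtain j where "in_supp F (ord_y F) j" using ord_y_spec(1)[OF F] by blast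
  from least_in_supp_z[OF this] obtain j' where "in_supp F (ord_y F) j'" "\<And>j. in_supp F (ord_y F) j \<Longrightarrow> j' \<le> j" by blast
  then have 1: "(ord_y F, j') \<in> vertices F" by (intro ord_y_vertex ord_y_spec[OF F]) auto
  have 2: "(deg_y F, ord_z F) \<in> vertices F" by (intro ord_z_vertex ord_z_spec[OF F])
  have "deg_y F = ord_y F" using v[OF 1] v[OF 2] by simp
  then show ?thesis using shade_corner[OF F] ord_z_spec(2)[OF F] by simp
qed

lemma measures_cong:
  assumes "newton_polygon F = newton_polygon G"
  shows "ord F = ord G" "ord_y F = ord_y G" "ord_z F = ord_z G" "deg_y F = deg_y G" "deg_z F = deg_z G"
    "shade F = shade G" "updent F = updent G" "indent F = indent G" "defect \<epsilon> \<delta> F = defect \<epsilon> \<delta> G"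
    "is_quadrant F = is_quadrant G"
proof -
  have v: "vertices F = vertices G" using assms by (simp add: vertices_def)
  show m: "ord F = ord G" "ord_y F = ord_y G" "ord_z F = ord_z G" "deg_y F = deg_y G" "deg_z F = deg_z G"
    by (simp_all add: ord_def ord_y_def ord_z_def deg_y_def deg_z_def v)
  show s: "shade F = shade G" by (simp add: shade_def m)
  have a: "alpha1 F = alpha1 G" "alpha2 F = alpha2 G" by (simp_all add: alpha1_def alpha2_def v)
  show "updent F = updent G" "indent F = indent G" by (simp_all add: updent_def indent_def a v)
  show "defect \<epsilon> \<delta> F = defect \<epsilon> \<delta> G" by (simp add: defect_def adjacent_def close_def m s)
  show "is_quadrant F = is_quadrant G" by (simp add: is_quadrant_def assms)
qed

text \<open>
  The vertex $(a,b)$ that follows $(d,s)$ is the leftmost point of the support on the line of smallest slope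
  through $(d,s)$. The slope condition is multiplied out to stay within the natural numbers.
\<close>

lemma second_vertex_eqI:
  assumes ds: "in_supp F d s" "\<And>i j. in_supp F i j \<Longrightarrow> s \<le> j" "\<And>i. in_supp F i s \<Longrightarrow> d \<le> i"
    and ab: "in_supp F a b" "a < d" "s < b"
    and line: "\<And>i j. in_supp F i j \<Longrightarrow> (b - s) * d + (d - a) * s \<le> (b - s) * i + (d - a) * j"
    and strict: "\<And>i j. in_supp F i j \<Longrightarrow> i < a \<Longrightarrow> (b - s) * d + (d - a) * s < (b - s) * i + (d - a) * j"
  shows "updent F = d - a" "indent F = b - s"
proof -
  define P where "P = b - s"
  define Q where "Q = d - a"
  have PQ: "P > 0" "Q > 0" "b = s + P" "d = a + Q" using ab by (auto simp: P_def Q_def)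
  have L: "P * a + Q * b = P * d + Q * s" by (simp add: PQ algebra_simps)
  note line = line[folded P_def Q_def] and strict = strict[folded P_def Q_def]
  have vds: "(d, s) \<in> vertices F" by (rule ord_z_vertex[OF ds])
  have vab: "(a, b) \<in> vertices F"
  proof (rule vertexI[OF ab(1), of "(a + 1) * P + 1" "(a + 1) * Q"])
    fix i j assume ij: "in_supp F i j" "(i, j) \<noteq> (a, b)"
    have e: "((a + 1) * P + 1) * x + ((a + 1) * Q) * y = (a + 1) * (P * x + Q * y) + x" for x y :: nat
      by (simp add: algebra_simps)
    show "((a + 1) * P + 1) * a + ((a + 1) * Q) * b < ((a + 1) * P + 1) * i + ((a + 1) * Q) * j"
    proof (cases "P * i + Q * j = P * a + Q * b")
      case True
      then have "a \<le> i" using strict[OF ij(1)] L by (metis not_le less_irrefl)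
      moreover have "i \<noteq> a" using True ij PQ by auto
      ultimately show ?thesis unfolding e True by simp
    next
      case False
      then have "P * a + Q * b + 1 \<le> P * i + Q * j" using line[OF ij(1)] L by simp
      then have "(a + 1) * (P * a + Q * b + 1) \<le> (a + 1) * (P * i + Q * j)" by (rule mult_le_mono2)
      then show ?thesis unfolding e by (simp add: algebra_simps)
    qed
  qed (use PQ in auto)
  \<comment> \<open>A vertex strictly between lies at vertical distance \<open>\<tau>\<close> above the edge, hence inside a translated edge.\<close>
  have between: False if v: "(x, y) \<in> vertices F" and x: "a < x" "x < d" for x y
  proof -
    have "P * d + Q * s \<le> P * x + Q * y" by (rule line[OF vertex_in_supp[OF v]])
    then have l: "real P * real d + real Q * real s \<le> real P * real x + real Q * real y" by (metis of_nat_add of_nat_le_iff of_nat_mult)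
    define \<theta> where "\<theta> = (real x - real a) / real Q"
    define \<tau> where "\<tau> = real y - ((1 - \<theta>) * real b + \<theta> * real s)"
    have Qr: "real Q > 0" "real d = real a + real Q" "real b = real s + real P" using PQ by auto
    have \<theta>: "0 < \<theta>" "\<theta> < 1" using x Qr by (auto simp: \<theta>_def)
    have x': "real x = real a + \<theta> * Q" using Qr by (simp add: \<theta>_def)
    have "real Q * \<tau> = real P * real x + real Q * real y - (real P * real d + real Q * real s)"
      unfolding \<tau>_def x' Qr(2,3) by (simp add: algebra_simps)
    then have "real Q * \<tau> \<ge> 0" using l by linarith
    then have \<tau>: "\<tau> \<ge> 0" using Qr(1) by (simp add: zero_le_mult_iff)
    have "\<not> (real x, real y) extreme_point_of newton_polygon F"
    proof (rule not_extreme_between[OF convex_newton_polygon])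
      show "(real a + 0, real b + \<tau>) \<in> newton_polygon F" "(real d + 0, real s + \<tau>) \<in> newton_polygon F"
        by (rule in_newton_polygon; use ab ds \<tau> in simp)+
      show "(real x, real y) = (1 - \<theta>) *\<^sub>R (real a + 0, real b + \<tau>) + \<theta> *\<^sub>R (real d + 0, real s + \<tau>)"
        by (simp add: x' Qr(2) \<tau>_def algebra_simps)
    qed (use ab \<theta> in auto)
    then show False using v by (simp add: vertices_def)
  qed
  have a1: "alpha1 F = d" unfolding alpha1_def
  proof (rule Max_eqI)
    show "d \<in> fst ` vertices F" using vds by force
  qed (auto simp: finite_vertices intro: fst_vertex_le[OF ds(1,2)])
  have a2: "alpha2 F = a" unfolding alpha2_def a1
  proof (rule Max_eqI)
    show "a \<in> fst ` vertices F - {d}" using vab ab(2) by force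
    fix x assume "x \<in> fst ` vertices F - {d}"
    then obtain y where "(x, y) \<in> vertices F" "x \<noteq> d" by auto
    moreover have "x \<le> d" by (rule fst_vertex_le[OF ds(1) ds(2)]) (use calculation in auto)
    ultimately show "x \<le> a" using between by (metis le_neq_implies_less not_le)
  qed (simp add: finite_vertices)
  show "updent F = d - a" by (simp add: updent_def a1 a2)
  have "(THE \<beta>. (d, \<beta>) \<in> vertices F) = s" "(THE \<beta>. (a, \<beta>) \<in> vertices F) = b"
    using vds vab by (auto intro: vertex_inj)
  then show "indent F = b - s" by (simp add: indent_def a1 a2)
qed

lemma second_vertex:
  assumes F: "F \<noteq> 0" and lt: "ord_y F < deg_y F"
  shows "0 < updent F" "updent F \<le> deg_y F" "0 < indent F"
    "in_supp F (deg_y F - updent F) (ord_z F + indent F)"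
    "\<And>i j. in_supp F i j \<Longrightarrow> indent F * deg_y F + updent F * ord_z F \<le> indent F * i + updent F * j"
    "\<And>i j. in_supp F i j \<Longrightarrow> i < deg_y F - updent F \<Longrightarrow>
      indent F * deg_y F + updent F * ord_z F < indent F * i + updent F * j"
proof -
  define d where "d = deg_y F"
  define s where "s = ord_z F"
  have ds: "in_supp F d s" "\<And>i j. in_supp F i j \<Longrightarrow> s \<le> j" "\<And>i. in_supp F i s \<Longrightarrow> d \<le> i"
    using ord_z_spec[OF F] by (auto simp: d_def s_def)
  define f where "f i = (LEAST j. in_supp F i j)" for i
  define I where "I = {i. i < d \<and> (\<exists>j. in_supp F i j)}"
  have f: "in_supp F i (f i)" "f i \<le> j" if "in_supp F i j" for i j
    unfolding f_def using that by (auto intro: LeastI Least_le)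
  define \<sigma> where "\<sigma> i = (real (f i) - real s) / (real d - real i)" for i
  have I: "finite I" "I \<noteq> {}" using lt ord_y_spec(1)[OF F] by (auto simp: I_def d_def)
  define \<sigma>0 where "\<sigma>0 = Min (\<sigma> ` I)"
  have "\<sigma>0 \<in> \<sigma> ` I" unfolding \<sigma>0_def using I by (intro Min_in) auto
  then have ex: "\<exists>i. i \<in> I \<and> \<sigma> i = \<sigma>0" by auto
  define a where "a = (LEAST i. i \<in> I \<and> \<sigma> i = \<sigma>0)"
  have a: "a \<in> I" "\<sigma> a = \<sigma>0" using LeastI_ex[OF ex] by (auto simp: a_def)
  have al: "a \<le> i" if "i \<in> I" "\<sigma> i = \<sigma>0" for i unfolding a_def using that by (auto intro: Least_le)
  have \<sigma>ge: "\<sigma>0 \<le> \<sigma> i" if "i \<in> I" for i unfolding \<sigma>0_def using that I by auto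
  define b where "b = f a"
  have ab: "in_supp F a b" "a < d" using a(1) f(1) by (auto simp: I_def b_def)
  have sb: "s < b" using ds(2)[OF ab(1)] ds(3)[of a] ab by (cases "b = s") auto
  have key: "(b - s) * d + (d - a) * s \<le> (b - s) * i + (d - a) * j \<and>
     (i < a \<longrightarrow> (b - s) * d + (d - a) * s < (b - s) * i + (d - a) * j)" if ij: "in_supp F i j" for i j
  proof (cases "i < d")
    case False
    then have "(b - s) * d \<le> (b - s) * i" "(d - a) * s \<le> (d - a) * j" using ds(2)[OF ij] by auto
    then have "(b - s) * d + (d - a) * s \<le> (b - s) * i + (d - a) * j" by (rule add_mono)
    then show ?thesis using False ab by auto
  next
    case True
    then have iI: "i \<in> I" using ij by (auto simp: I_def)
    have pos: "real d - real i > 0" "real d - real a > 0" using True ab by auto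
    have s1: "\<sigma> i \<le> (real j - real s) / (real d - real i)"
      unfolding \<sigma>_def using f(2)[OF ij] pos by (intro divide_right_mono) auto
    have \<sigma>a: "\<sigma>0 = (real b - real s) / (real d - real a)" using a by (simp add: \<sigma>_def b_def)
    have "\<sigma>0 \<le> (real j - real s) / (real d - real i)" using \<sigma>ge[OF iI] s1 by linarith
    then have 1: "(real b - real s) * (real d - real i) \<le> (real j - real s) * (real d - real a)"
      unfolding \<sigma>a using pos by (simp add: field_simps)
    have 2: "(real b - real s) * (real d - real i) < (real j - real s) * (real d - real a)" if "i < a"
    proof -
      have "\<sigma> i \<noteq> \<sigma>0" using al[OF iI] that by auto
      then have "\<sigma>0 < (real j - real s) / (real d - real i)" using \<sigma>ge[OF iI] s1 by linarith
      then show ?thesis unfolding \<sigma>a using pos by (simp add: field_simps)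
    qed
    have bs: "real (b - s) = real b - real s" "real (d - a) = real d - real a" using sb ab by auto
    have "real ((b - s) * d + (d - a) * s) \<le> real ((b - s) * i + (d - a) * j)"
      unfolding of_nat_add of_nat_mult bs using 1 by (simp add: algebra_simps)
    moreover have "real ((b - s) * d + (d - a) * s) < real ((b - s) * i + (d - a) * j)" if "i < a"
      unfolding of_nat_add of_nat_mult bs using 2[OF that] by (simp add: algebra_simps)
    ultimately show ?thesis unfolding of_nat_le_iff of_nat_less_iff by blast
  qed
  have "updent F = d - a"
    by (rule second_vertex_eqI(1)[where s = s and b = b]) (use ds ab sb key in blast)+
  moreover have "indent F = b - s"
    by (rule second_vertex_eqI(2)[where d = d and a = a]) (use ds ab sb key in blast)+
  ultimately have ui: "updent F = d - a" "indent F = b - s" by simp_all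
  show "0 < updent F" "updent F \<le> deg_y F" "0 < indent F" using ui ab sb by (auto simp: d_def)
  show "in_supp F (deg_y F - updent F) (ord_z F + indent F)"
    using ab sb by (simp add: ui flip: d_def s_def)
  show "\<And>i j. in_supp F i j \<Longrightarrow> indent F * deg_y F + updent F * ord_z F \<le> indent F * i + updent F * j"
    using key by (simp add: ui flip: d_def s_def)
  show "\<And>i j. in_supp F i j \<Longrightarrow> i < deg_y F - updent F \<Longrightarrow>
      indent F * deg_y F + updent F * ord_z F < indent F * i + updent F * j"
    using key ab by (simp add: ui flip: d_def s_def)
qed

section \<open>Changing the first coordinate by a series in the second\<close>

lemma coeff2_y_plus_const_power:
  fixes g :: "'k::comm_ring_1 fps"
  shows "coeff2 ((fps_y + fps_const g) ^ a) i j = of_nat (a choose i) * fps_nth (g ^ (a - i)) j"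
proof -
  have "(fps_y + fps_const g) ^ a = (\<Sum>k\<le>a. of_nat (a choose k) * fps_X ^ k * fps_const g ^ (a - k))"
    unfolding fps_y_def by (rule binomial_ring)
  also have "\<dots> = (\<Sum>k\<le>a. fps_const (of_nat (a choose k) * g ^ (a - k)) * fps_X ^ k)"
    by (intro sum.cong refl) (simp add: fps_of_nat[symmetric] fps_const_power algebra_simps)
  finally have "fps_nth ((fps_y + fps_const g) ^ a) i =
    (\<Sum>k\<le>a. if i = k then of_nat (a choose k) * g ^ (a - k) else 0)"
    by (simp add: fps_sum_nth if_distrib cong: if_cong)
  also have "\<dots> = (if i \<le> a then of_nat (a choose i) * g ^ (a - i) else 0)" by simp
  finally show ?thesis by (simp add: coeff2_def fps_mult_of_nat_nth binomial_eq_0)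
qed

lemma coeff2_shift_monom:
  fixes g :: "'k::comm_ring_1 fps"
  shows "coeff2 ((fps_y + fps_const g) ^ a * fps_z ^ b) i j =
    (if b \<le> j then of_nat (a choose i) * fps_nth (g ^ (a - i)) (j - b) else 0)"
  using coeff2_monom_mult[of 0 b "(fps_y + fps_const g) ^ a" i j]
  by (simp add: mult.commute coeff2_y_plus_const_power)

lemma coeff2_shift:
  fixes F :: "'k::comm_ring_1 fps fps"
  assumes "fps_nth g 0 = 0"
  shows "coeff2 (shift g F) i j = (\<Sum>a\<le>i+j. \<Sum>b\<le>i+j. coeff2 F a b *
    (if b \<le> j then of_nat (a choose i) * fps_nth (g ^ (a - i)) (j - b) else 0))"
  unfolding shift_def
  by (subst coeff2_subst2[OF _ _ order_refl])
    (simp_all add: max_ideal_ops fps_const_max assms coeff2_shift_monom)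

lemma fps_nth_power_initial:
  fixes g :: "'k::comm_ring_1 fps"
  assumes "\<And>i. i < k \<Longrightarrow> fps_nth g i = 0"
  shows "l < k * n \<Longrightarrow> fps_nth (g ^ n) l = 0" "fps_nth (g ^ n) (k * n) = fps_nth g k ^ n"
proof -
  define h where "h = fps_shift k g"
  have "g = fps_X ^ k * h"
    by (rule fps_ext) (simp add: h_def fps_X_power_mult_nth assms)
  then have "g ^ n = fps_X ^ (k * n) * h ^ n" by (simp add: power_mult_distrib power_mult)
  then show "l < k * n \<Longrightarrow> fps_nth (g ^ n) l = 0" "fps_nth (g ^ n) (k * n) = fps_nth g k ^ n"
    by (simp_all add: fps_X_power_mult_nth h_def fps_nth_power_0)
qed

text \<open>
  If $g$ has order at least $k$, then the shift respects the weights $(k,1)$ of $(y,z)$, and the form of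
  lowest weight is transformed by $y \mapsto y+cz^k$, where $c$ is the coefficient of $z^k$ in $g$.
\<close>

lemma shift_initial_form:
  fixes F :: "'k::comm_ring_1 fps fps"
  assumes k: "k > 0" and g: "\<And>i. i < k \<Longrightarrow> fps_nth g i = 0"
    and F: "\<And>a b. in_supp F a b \<Longrightarrow> w \<le> k * a + b"
  shows "k * i + j < w \<Longrightarrow> coeff2 (shift g F) i j = 0"
    and "k * i + j = w \<Longrightarrow> coeff2 (shift g F) i j =
      (\<Sum>a\<le>i+j. if k * a \<le> w then coeff2 F a (w - k * a) * (of_nat (a choose i) * fps_nth g k ^ (a - i)) else 0)"
proof -
  have g0: "fps_nth g 0 = 0" using g k by simp
  define T where "T i j a b = coeff2 F a b *
    (if b \<le> j then of_nat (a choose i) * fps_nth (g ^ (a - i)) (j - b) else 0)" for i j a b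
  have T0: "T i j a b = 0 \<or> (i \<le> a \<and> b \<le> j \<and> k * a + b \<le> k * i + j \<and> w \<le> k * a + b)" for i j a b
  proof (rule ccontr)
    assume neg: "\<not> ?thesis"
    then have T: "T i j a b \<noteq> 0" by blast
    have "in_supp F a b" "b \<le> j" using T by (auto simp: T_def in_supp_def split: if_splits)
    have "of_nat (a choose i) \<noteq> (0::'k)" "fps_nth (g ^ (a - i)) (j - b) \<noteq> 0"
      using T by (auto simp: T_def split: if_splits)
    then have "i \<le> a" "k * (a - i) \<le> j - b"
      using fps_nth_power_initial(1)[of k g "j - b" "a - i"] g
      by (metis binomial_eq_0 not_le of_nat_0, meson not_le)
    then have 1: "w \<le> k * a + b" "i \<le> a" "k * (a - i) \<le> j - b" using F[OF \<open>in_supp F a b\<close>] by auto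
    then have "k * a + b \<le> k * i + j" using \<open>b \<le> j\<close> by (simp add: diff_mult_distrib2)
    then show False using neg 1 \<open>b \<le> j\<close> by blast
  qed
  show "coeff2 (shift g F) i j = 0" if "k * i + j < w"
    unfolding coeff2_shift[OF g0] T_def[symmetric]
    using T0[of i j] that by (intro sum.neutral ballI) (meson leD le_trans)
  show "coeff2 (shift g F) i j =
      (\<Sum>a\<le>i+j. if k * a \<le> w then coeff2 F a (w - k * a) * (of_nat (a choose i) * fps_nth g k ^ (a - i)) else 0)"
    if w: "k * i + j = w"
    unfolding coeff2_shift[OF g0] T_def[symmetric]
  proof (intro sum.cong refl)
    fix a
    show "(\<Sum>b\<le>i+j. T i j a b) =
      (if k * a \<le> w then coeff2 F a (w - k * a) * (of_nat (a choose i) * fps_nth g k ^ (a - i)) else 0)"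
    proof (cases "k * a \<le> w \<and> i \<le> a")
      case False
      have "T i j a b = 0" for b using T0[of i j a b] False w by auto
      then show ?thesis using False by (auto simp: binomial_eq_0)
    next
      case True
      define b0 where "b0 = w - k * a"
      have ka: "k * i \<le> k * a" using True by simp
      then have b0: "b0 \<le> j" "j - b0 = k * (a - i)"
        unfolding b0_def diff_mult_distrib2 using True w by linarith+
      have "T i j a b = 0" if "b \<noteq> b0" for b using T0[of i j a b] that w True by (auto simp: b0_def)
      then have "(\<Sum>b\<le>i+j. T i j a b) = (\<Sum>b\<le>i+j. if b = b0 then T i j a b0 else 0)"
        by (intro sum.cong refl) auto
      also have "\<dots> = T i j a b0" using b0 by simp
      also have "\<dots> = coeff2 F a b0 * (of_nat (a choose i) * fps_nth g k ^ (a - i))"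
        using b0 fps_nth_power_initial(2)[of k g "a - i"] g by (simp add: T_def)
      finally show ?thesis using True by (simp add: b0_def)
    qed
  qed
qed

lemma shift_initial_monomial:
  fixes F :: "'k::comm_ring_1 fps fps"
  assumes k: "k > 0" and g: "\<And>i. i < k \<Longrightarrow> fps_nth g i = 0"
    and F: "\<And>a b. in_supp F a b \<Longrightarrow> (a, b) \<noteq> (d, s) \<Longrightarrow> k * d + s < k * a + b"
  shows "k * i + j < k * d + s \<Longrightarrow> coeff2 (shift g F) i j = 0"
    and "k * i + j = k * d + s \<Longrightarrow> coeff2 (shift g F) i j =
      coeff2 F d s * (of_nat (d choose i) * fps_nth g k ^ (d - i))"
proof -
  have F': "k * d + s \<le> k * a + b" if "in_supp F a b" for a b
    using F[OF that] by (cases "(a, b) = (d, s)") auto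
  show "coeff2 (shift g F) i j = 0" if "k * i + j < k * d + s"
    by (rule shift_initial_form(1)[OF k g F']) (use that in auto)
  show "coeff2 (shift g F) i j = coeff2 F d s * (of_nat (d choose i) * fps_nth g k ^ (d - i))"
    if w: "k * i + j = k * d + s"
  proof -
    have "coeff2 (shift g F) i j = (\<Sum>a\<le>i+j. if k * a \<le> k * d + s then
        coeff2 F a (k * d + s - k * a) * (of_nat (a choose i) * fps_nth g k ^ (a - i)) else 0)"
      by (rule shift_initial_form(2)[OF k g F' w])
    also have "\<dots> = (\<Sum>a\<le>i+j. if a = d then coeff2 F d s * (of_nat (d choose i) * fps_nth g k ^ (d - i)) else 0)"
    proof (intro sum.cong refl)
      fix a
      have "coeff2 F a (k * d + s - k * a) = 0" if "a \<noteq> d" "k * a \<le> k * d + s"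
        using F[of a "k * d + s - k * a"] that by (auto simp: in_supp_def)
      then show "(if k * a \<le> k * d + s then coeff2 F a (k * d + s - k * a) *
          (of_nat (a choose i) * fps_nth g k ^ (a - i)) else 0) =
        (if a = d then coeff2 F d s * (of_nat (d choose i) * fps_nth g k ^ (d - i)) else 0)" by auto
    qed
    also have "\<dots> = coeff2 F d s * (of_nat (d choose i) * fps_nth g k ^ (d - i))"
    proof -
      have "k * d \<le> k * (i + j)"
      proof -
        have "j \<le> k * j" using k by simp
        then show ?thesis unfolding distrib_left using w by linarith
      qed
      then have "d \<le> i + j" using k by simp
      then show ?thesis by simp
    qed
    finally show ?thesis .
  qed
qed

lemma shift_shift:
  fixes F :: "'k::comm_ring_1 fps fps"
  assumes "fps_nth g 0 = 0" "fps_nth g' 0 = 0"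
  shows "shift g (shift g' F) = shift (g + g') F"
proof -
  have m: "fps_y + fps_const g \<in> max_ideal" "fps_y + fps_const g' \<in> max_ideal"
    using assms by (auto intro: max_ideal_ops fps_const_max)
  have "shift g (shift g' F) = subst2 F (fps_y + fps_const g + fps_const g') fps_z"
    unfolding shift_def by (simp add: subst2_comp m subst2_add subst2_simps subst2_const_z)
  then show ?thesis by (simp add: shift_def add.assoc)
qed

lemma shift_0: "shift 0 F = F"
  by (simp add: shift_def subst2_id)

lemma recoord_recoord:
  fixes F :: "'k::alg_closed_field fps fps"
  assumes "prime CHAR('k)" "fps_nth g 0 = 0" "fps_nth g' 0 = 0"
  shows "recoord g (recoord g' F) = recoord (g + g') F"
proof -
  have "mod_powers (shift g (mod_powers (shift g' F))) = mod_powers (shift g (shift g' F))"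
    unfolding shift_def[of g] using assms by (intro mod_powers_subst2_mod_powers) (auto intro: max_ideal_ops fps_const_max)
  then show ?thesis by (simp add: recoord_def shift_shift assms)
qed

lemma recoord_0: "off_powers F \<Longrightarrow> recoord 0 F = F"
  by (simp add: recoord_def shift_0 mod_powers_off_powers)

lemma off_powers_recoord [simp]: "off_powers (recoord g F)"
  by (simp add: recoord_def)

lemma in_supp_recoord: "in_supp (recoord g F) i j \<longleftrightarrow> \<not> (CHAR('k) dvd i \<and> CHAR('k) dvd j) \<and> in_supp (shift g F) i j"
  for F :: "'k::field fps fps"
  by (simp add: in_supp_def recoord_def coeff2_mod_powers)

lemma off_powers_in_supp: "off_powers F \<Longrightarrow> in_supp F i j \<Longrightarrow> \<not> (CHAR('k) dvd i \<and> CHAR('k) dvd j)"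
  for F :: "'k::field fps fps"
  by (auto simp: off_powers_def in_supp_def)

lemma recoord_bottom_row:
  fixes F :: "'k::field fps fps"
  assumes g: "fps_nth g 0 = 0" and F: "\<And>a b. in_supp F a b \<Longrightarrow> s \<le> b" and off: "off_powers F"
  shows "j < s \<Longrightarrow> \<not> in_supp (recoord g F) i j" "in_supp (recoord g F) i s \<longleftrightarrow> in_supp F i s"
proof -
  have z: "coeff2 F a b * (if b \<le> j then of_nat (a choose i) * fps_nth (g ^ (a - i)) (j - b) else 0) = 0"
    if "b < s \<or> j < b" for a b j using F[of a b] that by (auto simp: in_supp_def)
  show "\<not> in_supp (recoord g F) i j" if "j < s"
  proof -
    have "coeff2 (shift g F) i j = 0"
      unfolding coeff2_shift[OF g] by (intro sum.neutral ballI z) (use that in auto)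
    then show ?thesis unfolding in_supp_recoord by (simp add: in_supp_def)
  qed
  have "coeff2 (shift g F) i s = (\<Sum>a\<le>i+s. if a = i then coeff2 F i s else 0)"
    unfolding coeff2_shift[OF g]
  proof (intro sum.cong refl)
    fix a
    have "(\<Sum>b\<le>i+s. coeff2 F a b * (if b \<le> s then of_nat (a choose i) * fps_nth (g ^ (a - i)) (s - b) else 0)) =
       (\<Sum>b\<le>i+s. if b = s then coeff2 F a s * (of_nat (a choose i) * fps_nth g 0 ^ (a - i)) else 0)"
    proof (intro sum.cong refl)
      fix b
      show "coeff2 F a b * (if b \<le> s then of_nat (a choose i) * fps_nth (g ^ (a - i)) (s - b) else 0) =
        (if b = s then coeff2 F a s * (of_nat (a choose i) * fps_nth g 0 ^ (a - i)) else 0)"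
        using z[of b s a] by (cases b s rule: linorder_cases) (simp_all add: fps_nth_power_0)
    qed
    also have "\<dots> = coeff2 F a s * (of_nat (a choose i) * fps_nth g 0 ^ (a - i))" by simp
    also have "\<dots> = (if a = i then coeff2 F i s else 0)"
      using g by (cases "a \<le> i") (auto simp: binomial_eq_0 power_0_left)
    finally show "(\<Sum>b\<le>i+s. coeff2 F a b * (if b \<le> s then of_nat (a choose i) * fps_nth (g ^ (a - i)) (s - b) else 0)) =
      (if a = i then coeff2 F i s else 0)" .
  qed
  then have e: "coeff2 (shift g F) i s = coeff2 F i s" by simp
  have "in_supp (recoord g F) i s \<longleftrightarrow> \<not> (CHAR('k) dvd i \<and> CHAR('k) dvd s) \<and> in_supp F i s"
    unfolding in_supp_recoord by (simp add: in_supp_def e)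
  then show "in_supp (recoord g F) i s \<longleftrightarrow> in_supp F i s" using off_powers_in_supp[OF off] by blast
qed

lemma recoord_ord_ge:
  fixes F :: "'k::field fps fps"
  assumes g: "fps_nth g 0 = 0" and F: "\<And>a b. in_supp F a b \<Longrightarrow> m \<le> a + b" and "in_supp (recoord g F) i j"
  shows "m \<le> i + j"
proof (rule ccontr)
  assume "\<not> m \<le> i + j"
  then have "coeff2 (shift g F) i j = 0"
    by (intro shift_initial_form(1)[of 1 g F m]) (use g F in auto)
  then show False using assms(3) unfolding in_supp_recoord by (simp add: in_supp_def)
qed

text \<open>
  The lowest row of $F$ in $z$ is unchanged by the shift, which gives \<open>ord_z\<close> and \<open>deg_y\<close>. The order cannot
  decrease, and the inverse shift shows that it cannot increase either.
\<close>

lemma recoord_invariants: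
  fixes F :: "'k::alg_closed_field fps fps"
  assumes p: "prime CHAR('k)" and off: "off_powers F" and F: "F \<noteq> 0" and g: "fps_nth g 0 = 0"
  shows "recoord g F \<noteq> 0" "ord_z (recoord g F) = ord_z F" "deg_y (recoord g F) = deg_y F" "ord (recoord g F) = ord F"
proof -
  have b: "\<And>i j. j < ord_z F \<Longrightarrow> \<not> in_supp (recoord g F) i j" "\<And>i. in_supp (recoord g F) i (ord_z F) \<longleftrightarrow> in_supp F i (ord_z F)"
    by (rule recoord_bottom_row[OF g _ off]; use ord_z_spec(1)[OF F] in blast)+
  have 1: "in_supp (recoord g F) (deg_y F) (ord_z F)" using b(2) ord_z_spec(2)[OF F] by blast
  then show ne: "recoord g F \<noteq> 0" by (auto simp: in_supp_def)
  have 2: "ord_z F \<le> j" if "in_supp (recoord g F) i j" for i j using b(1)[of j i] that by (meson not_le)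
  show "ord_z (recoord g F) = ord_z F" by (rule ord_z_eqI[OF 1 2])
  show "deg_y (recoord g F) = deg_y F" by (rule deg_y_eqI[OF 1 2]) (use b(2) ord_z_spec(3)[OF F] in auto)
  have ge: "ord G \<le> ord (recoord g G)" if "G \<noteq> 0" "recoord g G \<noteq> 0" "fps_nth g 0 = 0" for G :: "'k fps fps" and g
    using recoord_ord_ge[OF that(3) ord_spec(2)[OF that(1)]] ord_spec(1)[OF that(2)] by metis
  have inverse: "recoord (- g) (recoord g F) = F" using recoord_recoord[OF p, of "- g" g F] g off by (simp add: recoord_0)
  show "ord (recoord g F) = ord F"
    using ge[OF F ne g] ge[of "recoord g F" "- g"] ne F g inverse by simp
qed

text \<open>
  The following measures of \<open>F\<close> are those of the family \<open>recoord g F\<close>. As order and \<open>ord_z\<close> are constant in this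
  family, the smallest shade belongs to the largest \<open>ord_y\<close>.
\<close>

definition max_ord_y :: "'k::field fps fps \<Rightarrow> nat" where
  "max_ord_y F = Max {ord_y (recoord g F) | g. fps_nth g 0 = 0}"

definition min_shade :: "'k::field fps fps \<Rightarrow> nat" where
  "min_shade F = ord F - max_ord_y F - ord_z F"

text \<open>
  The defect as a function of shade \<open>S\<close>, height \<open>h = deg_y - ord_y\<close> and \<open>r = ord_y\<close>.
\<close>

definition defect_value :: "real \<Rightarrow> real \<Rightarrow> nat \<Rightarrow> nat \<Rightarrow> nat \<Rightarrow> real" where
  "defect_value \<epsilon> \<delta> S h r = (if S = h then (if r = 0 then 1 + \<delta> else if r = 1 then \<epsilon> else 0)
     else if S + 1 = h then (if r = 0 then \<delta> else 0) else 0)"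

definition complicacy_of :: "real \<Rightarrow> real \<Rightarrow> 'k::field fps fps \<Rightarrow> real" where
  "complicacy_of \<epsilon> \<delta> F = real (min_shade F) - defect_value \<epsilon> \<delta> (min_shade F) (deg_y F - max_ord_y F) (max_ord_y F)"

definition optimal_shifts :: "'k::field fps fps \<Rightarrow> 'k fps set" where
  "optimal_shifts F = {g. fps_nth g 0 = 0 \<and> ord_y (recoord g F) = max_ord_y F}"

definition min_updent :: "'k::field fps fps \<Rightarrow> nat" where
  "min_updent F = (LEAST n. \<exists>g\<in>optimal_shifts F. updent (recoord g F) = n)"

definition max_indent :: "'k::field fps fps \<Rightarrow> nat" where
  "max_indent F = (GREATEST n. \<exists>g\<in>optimal_shifts F. updent (recoord g F) = min_updent F \<and> indent (recoord g F) = n)"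

lemma max_ord_y_props:
  fixes F :: "'k::alg_closed_field fps fps"
  assumes p: "prime CHAR('k)" and off: "off_powers F" and F: "F \<noteq> 0"
  shows "\<exists>g. g \<in> optimal_shifts F" "\<And>g. fps_nth g 0 = 0 \<Longrightarrow> ord_y (recoord g F) \<le> max_ord_y F"
    "max_ord_y F \<le> deg_y F" "max_ord_y F + ord_z F \<le> ord F"
proof -
  define A where "A = {ord_y (recoord g F) | g. fps_nth g 0 = 0}"
  have "A \<subseteq> {..deg_y F}"
    using ord_y_le_deg_y recoord_invariants[OF p off F] by (force simp: A_def)
  then have fin: "finite A" by (rule finite_subset) simp
  have "ord_y (recoord 0 F) \<in> A" unfolding A_def by (intro CollectI exI[of _ 0]) simp
  then have ne: "A \<noteq> {}" by blast
  have r: "max_ord_y F = Max A" by (simp add: max_ord_y_def A_def)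
  then have "max_ord_y F \<in> A" using Max_in[OF fin ne] by simp
  then obtain g where g: "fps_nth g 0 = 0" "ord_y (recoord g F) = max_ord_y F" by (auto simp: A_def)
  then show "\<exists>g. g \<in> optimal_shifts F" by (auto simp: optimal_shifts_def)
  show "ord_y (recoord g F) \<le> max_ord_y F" if "fps_nth g 0 = 0" for g
    unfolding r using fin that by (intro Max_ge) (auto simp: A_def)
  show "max_ord_y F \<le> deg_y F" using g ord_y_le_deg_y recoord_invariants[OF p off F g(1)] by metis
  show "max_ord_y F + ord_z F \<le> ord F" using g ord_ge recoord_invariants[OF p off F g(1)] by metis
qed

text \<open>
  Up to Newton polygons, the expansions at a point with respect to a flag are the members of the family of
  \<open>F\<close>; this reduces statements about points to statements about one series.
\<close>

definition represents :: "'k::alg_closed_field \<times> 'k \<Rightarrow> 'k fps fps \<Rightarrow> 'k poly poly \<Rightarrow> 'k fps fps \<Rightarrow> bool" where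
  "represents a h f F \<longleftrightarrow> off_powers F \<and> F \<noteq> 0 \<and>
    (\<forall>c\<in>subordinate h. \<exists>g. fps_nth g 0 = 0 \<and> newton_polygon (expansion a c f) = newton_polygon (recoord g F)) \<and>
    (\<forall>g. fps_nth g 0 = 0 \<longrightarrow> (\<exists>c\<in>subordinate h. expansion a c f = recoord g F))"

lemma representsI:
  fixes f :: "'k::alg_closed_field poly poly"
  assumes p: "prime CHAR('k)" and c: "c \<in> subordinate h" and ne: "expansion a c f \<noteq> 0"
  shows "represents a h f (expansion a c f)"
proof -
  obtain Y Z where c': "c = (Y, Z)" by (cases c)
  obtain v where lc: "(Y, Z) \<in> local_coordinates" and v: "v dvd 1" "Z = v * h"
    using c c' subordinate_iff by blast
  have "\<exists>c1\<in>subordinate h. expansion a c1 f = recoord g (expansion a c f)" if "fps_nth g 0 = 0" for g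
    using base_change(1)[OF p lc that] base_change(2)[OF p lc that, of a f] v c' subordinate_iff by blast
  moreover have "\<exists>g. fps_nth g 0 = 0 \<and> newton_polygon (expansion a c1 f) = newton_polygon (recoord g (expansion a c f))"
    if "c1 \<in> subordinate h" for c1
    using subordinate_param[OF p c[unfolded c'], where Y = "fst c1" and Z = "snd c1" and a = a and f = f] that c' by simp
  ultimately show ?thesis
    using ne expansion_props(1)[OF p lc] c' by (simp add: represents_def)
qed

lemma represents_measures:
  fixes F :: "'k::alg_closed_field fps fps"
  assumes p: "prime CHAR('k)" and rep: "represents a h f F"
  shows "shade_at a h f = min_shade F"
    "complicacy_at \<epsilon> \<delta> a h f = complicacy_of \<epsilon> \<delta> F"
    "dent_at a h f = (min_updent F, max_indent F)"
    "quadrant_at a h f \<Longrightarrow> min_shade F = 0"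
    "c \<in> realizing a h f \<longleftrightarrow> c \<in> subordinate h \<and> ord_y (expansion a c f) = max_ord_y F"
proof -
  have off: "off_powers F" and F: "F \<noteq> 0"
    and A: "\<And>c. c \<in> subordinate h \<Longrightarrow> \<exists>g. fps_nth g 0 = 0 \<and> newton_polygon (expansion a c f) = newton_polygon (recoord g F)"
    and B: "\<And>g. fps_nth g 0 = 0 \<Longrightarrow> \<exists>c\<in>subordinate h. expansion a c f = recoord g F"
    using rep by (auto simp: represents_def)
  note inv = recoord_invariants[OF p off F]
  note rm = max_ord_y_props[OF p off F]
  have sh: "shade (recoord g F) = ord F - ord_y (recoord g F) - ord_z F" if "fps_nth g 0 = 0" for g
    by (simp add: shade_def inv[OF that])
  obtain g0 where g0: "fps_nth g0 0 = 0" "ord_y (recoord g0 F) = max_ord_y F" using rm(1) by (auto simp: optimal_shifts_def)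
  show S: "shade_at a h f = min_shade F"
    unfolding shade_at_def
  proof (rule Least_equality)
    obtain c where "c \<in> subordinate h" "expansion a c f = recoord g0 F" using B[OF g0(1)] by blast
    then show "\<exists>c\<in>subordinate h. shade (expansion a c f) = min_shade F"
      using sh[OF g0(1)] g0(2) by (auto simp: min_shade_def intro!: bexI[of _ c])
  next
    fix n assume "\<exists>c\<in>subordinate h. shade (expansion a c f) = n"
    then obtain c where c: "c \<in> subordinate h" "shade (expansion a c f) = n" by blast
    obtain g where g: "fps_nth g 0 = 0" "newton_polygon (expansion a c f) = newton_polygon (recoord g F)"
      using A[OF c(1)] by blast
    show "min_shade F \<le> n"
      using measures_cong(6)[OF g(2)] sh[OF g(1)] c(2) rm(2)[OF g(1)] by (simp add: min_shade_def)
  qed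
  have R: "c \<in> realizing a h f \<longleftrightarrow> c \<in> subordinate h \<and> ord_y (expansion a c f) = max_ord_y F" for c
  proof (cases "c \<in> subordinate h")
    case True
    then obtain g where g: "fps_nth g 0 = 0" "newton_polygon (expansion a c f) = newton_polygon (recoord g F)"
      using A by blast
    have "shade (expansion a c f) = ord F - ord_y (recoord g F) - ord_z F"
      using measures_cong(6)[OF g(2)] sh[OF g(1)] by simp
    moreover have "ord_y (recoord g F) \<le> max_ord_y F" using rm(2)[OF g(1)] .
    ultimately have "shade (expansion a c f) = min_shade F \<longleftrightarrow> ord_y (recoord g F) = max_ord_y F"
      using rm(4) by (auto simp: min_shade_def)
    then show ?thesis using True measures_cong(2)[OF g(2)] by (simp add: realizing_def S)
  qed (simp add: realizing_def)
  then show "c \<in> realizing a h f \<longleftrightarrow> c \<in> subordinate h \<and> ord_y (expansion a c f) = max_ord_y F" .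
  have realA: "\<exists>g\<in>optimal_shifts F. newton_polygon (expansion a c f) = newton_polygon (recoord g F)"
    if "c \<in> realizing a h f" for c
  proof -
    have c: "c \<in> subordinate h" "ord_y (expansion a c f) = max_ord_y F" using that R by auto
    obtain g where g: "fps_nth g 0 = 0" "newton_polygon (expansion a c f) = newton_polygon (recoord g F)"
      using A[OF c(1)] by blast
    then show ?thesis using c(2) measures_cong(2)[OF g(2)]
      by (intro bexI[of _ g]) (simp_all add: optimal_shifts_def)
  qed
  have realB: "\<exists>c\<in>realizing a h f. expansion a c f = recoord g F" if "g \<in> optimal_shifts F" for g
    using that B[of g] R unfolding optimal_shifts_def by auto
  have dg: "defect \<epsilon> \<delta> (recoord g F) = defect_value \<epsilon> \<delta> (min_shade F) (deg_y F - max_ord_y F) (max_ord_y F)" if "g \<in> optimal_shifts F" for g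
    using that sh[of g] inv[of g]
    by (simp add: defect_def defect_value_def optimal_shifts_def adjacent_def close_def min_shade_def)
  obtain c0 where c0: "c0 \<in> realizing a h f" using realB rm(1) by blast
  have "defect_at \<epsilon> \<delta> a h f = defect_value \<epsilon> \<delta> (min_shade F) (deg_y F - max_ord_y F) (max_ord_y F)"
    unfolding defect_at_def
  proof (rule the_equality)
    have d: "defect \<epsilon> \<delta> (expansion a c f) = defect_value \<epsilon> \<delta> (min_shade F) (deg_y F - max_ord_y F) (max_ord_y F)"
      if "c \<in> realizing a h f" for c
      using realA[OF that] measures_cong(9) dg by metis
    then show "\<exists>c\<in>realizing a h f. defect \<epsilon> \<delta> (expansion a c f) = defect_value \<epsilon> \<delta> (min_shade F) (deg_y F - max_ord_y F) (max_ord_y F)"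
      using c0 by blast
    show "x = defect_value \<epsilon> \<delta> (min_shade F) (deg_y F - max_ord_y F) (max_ord_y F)"
      if "\<exists>c\<in>realizing a h f. defect \<epsilon> \<delta> (expansion a c f) = x" for x using that d by blast
  qed
  then show "complicacy_at \<epsilon> \<delta> a h f = complicacy_of \<epsilon> \<delta> F"
    by (simp add: complicacy_at_def complicacy_of_def S)
  have realA': "\<exists>g\<in>optimal_shifts F. updent (expansion a c f) = updent (recoord g F) \<and>
      indent (expansion a c f) = indent (recoord g F)" if "c \<in> realizing a h f" for c
    using realA[OF that] measures_cong(7,8) by blast
  have "(\<exists>c\<in>realizing a h f. updent (expansion a c f) = n) \<longleftrightarrow> (\<exists>g\<in>optimal_shifts F. updent (recoord g F) = n)" for n
    using realA' realB by metis
  then have u: "updent_at a h f = min_updent F" by (simp add: updent_at_def min_updent_def)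
  have "(\<exists>c\<in>realizing a h f. updent (expansion a c f) = k \<and> indent (expansion a c f) = n) \<longleftrightarrow>
    (\<exists>g\<in>optimal_shifts F. updent (recoord g F) = k \<and> indent (recoord g F) = n)" for k n
    using realA' realB by metis
  then have "indent_at a h f = max_indent F" by (simp add: indent_at_def max_indent_def u)
  then show "dent_at a h f = (min_updent F, max_indent F)" by (simp add: dent_at_def u)
  show "min_shade F = 0" if q: "quadrant_at a h f"
  proof -
    obtain c where c: "c \<in> realizing a h f" "is_quadrant (expansion a c f)" using q unfolding quadrant_at_def by blast
    obtain g where g: "g \<in> optimal_shifts F" "newton_polygon (expansion a c f) = newton_polygon (recoord g F)"
      using realA[OF c(1)] by blast
    have "is_quadrant (recoord g F)" using c(2) measures_cong(10)[OF g(2)] by simp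
    moreover have "recoord g F \<noteq> 0" using g inv by (simp add: optimal_shifts_def)
    ultimately have "shade (recoord g F) = 0" by (intro quadrant_shade)
    then show ?thesis using sh[of g] g(1) by (simp add: optimal_shifts_def min_shade_def)
  qed
qed

section \<open>The two monomial blowups\<close>

definition blow_y :: "'k::comm_ring_1 fps fps \<Rightarrow> 'k fps fps" where
  "blow_y F = subst2 F fps_y (fps_y * fps_z)"

definition blow_z :: "'k::comm_ring_1 fps fps \<Rightarrow> 'k fps fps" where
  "blow_z F = subst2 F (fps_y * fps_z) fps_z"

lemma coeff2_blow_y: "coeff2 (blow_y F) i j = (if j \<le> i then coeff2 F (i - j) j else 0)"
  for F :: "'k::comm_ring_1 fps fps"
proof -
  have e: "fps_y ^ a * (fps_y * fps_z) ^ b = (fps_y ^ (a + b) * fps_z ^ b :: 'k fps fps)" for a b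
    by (simp add: power_mult_distrib power_add mult.assoc)
  have "coeff2 (blow_y F) i j =
    (\<Sum>a\<le>i+j. \<Sum>b\<le>i+j. coeff2 F a b * coeff2 (fps_y ^ a * (fps_y * fps_z) ^ b) i j)"
    unfolding blow_y_def by (rule coeff2_subst2) (simp_all add: max_ideal_ops)
  also have "\<dots> = (\<Sum>a\<le>i+j. \<Sum>b\<le>i+j. if b = j then (if i = a + j then coeff2 F a j else 0) else 0)"
    unfolding e coeff2_monom by (intro sum.cong refl) auto
  also have "\<dots> = (\<Sum>a\<le>i+j. if a = i - j then (if j \<le> i then coeff2 F (i - j) j else 0) else 0)"
    by (intro sum.cong refl) auto
  also have "\<dots> = (if j \<le> i then coeff2 F (i - j) j else 0)" by auto
  finally show ?thesis .
qed

lemma coeff2_blow_z: "coeff2 (blow_z F) i j = (if i \<le> j then coeff2 F i (j - i) else 0)"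
  for F :: "'k::comm_ring_1 fps fps"
proof -
  have e: "(fps_y * fps_z) ^ a * fps_z ^ b = (fps_y ^ a * fps_z ^ (a + b) :: 'k fps fps)" for a b
    by (simp add: power_mult_distrib power_add mult.assoc)
  have "coeff2 (blow_z F) i j =
    (\<Sum>a\<le>i+j. \<Sum>b\<le>i+j. coeff2 F a b * coeff2 ((fps_y * fps_z) ^ a * fps_z ^ b) i j)"
    unfolding blow_z_def by (rule coeff2_subst2) (simp_all add: max_ideal_ops)
  also have "\<dots> = (\<Sum>a\<le>i+j. if a = i then (\<Sum>b\<le>i+j. if b = j - i then (if i \<le> j then coeff2 F i (j - i) else 0) else 0) else 0)"
    unfolding e coeff2_monom
  proof (intro sum.cong refl)
    fix a
    show "(\<Sum>b\<le>i+j. coeff2 F a b * (if i = a \<and> j = a + b then 1 else 0)) =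
      (if a = i then (\<Sum>b\<le>i+j. if b = j - i then (if i \<le> j then coeff2 F i (j - i) else 0) else 0) else 0)"
    proof (cases "a = i")
      case True
      show ?thesis unfolding True if_P[OF refl] by (intro sum.cong refl) auto
    qed auto
  qed
  also have "\<dots> = (if i \<le> j then coeff2 F i (j - i) else 0)" by auto
  finally show ?thesis .
qed

lemma in_supp_blow_y: "in_supp (blow_y F) i j \<longleftrightarrow> (\<exists>a. i = a + j \<and> in_supp F a j)"
  unfolding in_supp_def coeff2_blow_y by (auto simp: le_iff_add add.commute)

lemma in_supp_blow_z: "in_supp (blow_z F) i j \<longleftrightarrow> (\<exists>b. j = i + b \<and> in_supp F i b)"
  unfolding in_supp_def coeff2_blow_z by (auto simp: le_iff_add)

lemma off_powers_in_supp_iff: "off_powers F \<longleftrightarrow> (\<forall>i j. in_supp F i j \<longrightarrow> \<not> (CHAR('k) dvd i \<and> CHAR('k) dvd j))"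
  for F :: "'k::field fps fps"
  unfolding off_powers_def in_supp_def by blast

lemma off_powers_blow_y: "off_powers F \<Longrightarrow> off_powers (blow_y F)" for F :: "'k::field fps fps"
  unfolding off_powers_in_supp_iff in_supp_blow_y by (metis dvd_add_left_iff)

lemma off_powers_blow_z: "off_powers F \<Longrightarrow> off_powers (blow_z F)" for F :: "'k::field fps fps"
  unfolding off_powers_in_supp_iff in_supp_blow_z by (metis dvd_add_right_iff)

lemma in_supp_ne_0: "in_supp F i j \<Longrightarrow> F \<noteq> 0"
  by (auto simp: in_supp_def coeff2_def)

lemma blow_y_ne_0: "F \<noteq> 0 \<Longrightarrow> blow_y F \<noteq> 0" for F :: "'k::field fps fps"
  using in_supp_ex[of F] in_supp_blow_y in_supp_ne_0 by metis

lemma blow_z_ne_0: "F \<noteq> 0 \<Longrightarrow> blow_z F \<noteq> 0" for F :: "'k::field fps fps"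
  using in_supp_ex[of F] in_supp_blow_z in_supp_ne_0 by metis

lemma defect_value_nonneg: "0 < \<epsilon> \<Longrightarrow> \<epsilon> < \<delta> \<Longrightarrow> 0 \<le> defect_value \<epsilon> \<delta> S h r"
  by (simp add: defect_value_def)

lemma complicacy_of_le_min_shade:
  "0 < \<epsilon> \<Longrightarrow> \<epsilon> < \<delta> \<Longrightarrow> complicacy_of \<epsilon> \<delta> F \<le> real (min_shade F)"
  using defect_value_nonneg by (simp add: complicacy_of_def)

text \<open>
  What non-monomiality of $f$ means for its expansions: no polygon of the family has its corner in the
  support, and the series is not $z^s$ times a regular parameter.
\<close>

definition nondegenerate :: "'k::field fps fps \<Rightarrow> bool" where
  "nondegenerate F \<longleftrightarrow> off_powers F \<and> F \<noteq> 0 \<and> 2 \<le> deg_y F \<and>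
    (\<forall>g. fps_nth g 0 = 0 \<longrightarrow> \<not> in_supp (recoord g F) (ord_y (recoord g F)) (ord_z (recoord g F)))"

lemma nondegenerate_recoord:
  fixes F :: "'k::alg_closed_field fps fps"
  assumes p: "prime CHAR('k)" and nd: "nondegenerate F" and g: "fps_nth g 0 = 0"
  shows "nondegenerate (recoord g F)" "max_ord_y (recoord g F) = max_ord_y F" "min_shade (recoord g F) = min_shade F"
    "complicacy_of \<epsilon> \<delta> (recoord g F) = complicacy_of \<epsilon> \<delta> F"
proof -
  have F: "off_powers F" "F \<noteq> 0" using nd by (auto simp: nondegenerate_def)
  note inv = recoord_invariants[OF p F g]
  show "nondegenerate (recoord g F)"
    unfolding nondegenerate_def using inv nd by (auto simp: recoord_recoord p g nondegenerate_def)
  have "{ord_y (recoord g' (recoord g F)) | g'. fps_nth g' 0 = 0} = {ord_y (recoord g' F) | g'. fps_nth g' 0 = 0}"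
  proof (intro equalityI subsetI)
    fix x assume "x \<in> {ord_y (recoord g' (recoord g F)) | g'. fps_nth g' 0 = 0}"
    then obtain g' where "x = ord_y (recoord g' (recoord g F))" "fps_nth g' 0 = 0" by blast
    then show "x \<in> {ord_y (recoord g' F) | g'. fps_nth g' 0 = 0}"
      using g by (intro CollectI exI[of _ "g' + g"]) (simp add: recoord_recoord p)
  next
    fix x assume "x \<in> {ord_y (recoord g' F) | g'. fps_nth g' 0 = 0}"
    then obtain g' where "x = ord_y (recoord g' F)" "fps_nth g' 0 = 0" by blast
    then show "x \<in> {ord_y (recoord g' (recoord g F)) | g'. fps_nth g' 0 = 0}"
      using g by (intro CollectI exI[of _ "g' - g"]) (simp add: recoord_recoord p)
  qed
  then show r: "max_ord_y (recoord g F) = max_ord_y F" by (simp add: max_ord_y_def)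
  show s: "min_shade (recoord g F) = min_shade F" by (simp add: min_shade_def r inv)
  show "complicacy_of \<epsilon> \<delta> (recoord g F) = complicacy_of \<epsilon> \<delta> F" by (simp add: complicacy_of_def r s inv)
qed

lemma optimal_facts:
  fixes F :: "'k::alg_closed_field fps fps"
  assumes p: "prime CHAR('k)" and nd: "nondegenerate F" and opt: "ord_y F = max_ord_y F"
  shows "max_ord_y F < deg_y F" "ord F \<le> deg_y F + ord_z F" "max_ord_y F + ord_z F < ord F"
    "min_shade F + max_ord_y F + ord_z F = ord F" "min_shade F \<le> deg_y F - max_ord_y F" "0 < min_shade F"
proof -
  have F: "off_powers F" "F \<noteq> 0" using nd by (auto simp: nondegenerate_def)
  have nc: "\<not> in_supp F (ord_y F) (ord_z F)"
    using nd recoord_0[OF F(1)] by (auto simp: nondegenerate_def dest!: spec[of _ 0])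
  show a: "max_ord_y F < deg_y F"
    using nc ord_z_spec(2)[OF F(2)] ord_y_le_deg_y[OF F(2)] opt by (cases "ord_y F = deg_y F") auto
  show b: "ord F \<le> deg_y F + ord_z F" by (rule ord_le_deg[OF F(2)])
  obtain i j where ij: "in_supp F i j" "i + j = ord F" using ord_spec(1)[OF F(2)] by blast
  have "ord_y F \<le> i" "ord_z F \<le> j" using ord_y_spec(2)[OF F(2) ij(1)] ord_z_spec(1)[OF F(2) ij(1)] by auto
  then show c: "max_ord_y F + ord_z F < ord F"
    using nc ij opt by (cases "i = ord_y F \<and> j = ord_z F") auto
  then show "min_shade F + max_ord_y F + ord_z F = ord F" "min_shade F \<le> deg_y F - max_ord_y F" "0 < min_shade F"
    using b by (auto simp: min_shade_def)
qed

lemma complicacy_pos: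
  fixes F :: "'k::alg_closed_field fps fps"
  assumes p: "prime CHAR('k)" and nd: "nondegenerate F" and opt: "ord_y F = max_ord_y F"
    and e: "0 < \<epsilon>" "\<epsilon> < \<delta>" "\<delta> < 1"
  shows "0 < complicacy_of \<epsilon> \<delta> F"
  using optimal_facts[OF p nd opt] e nd
  by (auto simp: complicacy_of_def defect_value_def nondegenerate_def)

text \<open>
  After the blowup $F(y,yz)$ the exceptional divisor contributes the whole order $m$ of $F$ to \<open>ord_y\<close>.
  So any lowest exponent $(a,b)$ of $F$ bounds the new shade by $b-s$, where $s$ is \<open>ord_z F\<close>.
  For the three sources of a defect the right choice of an exponent gives shade $0$, shade at most $1$,
  or shade at most that of $F$.
\<close>

theorem decrease_y:
  fixes F :: "'k::alg_closed_field fps fps"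
  assumes p: "prime CHAR('k)" and nd: "nondegenerate F" and opt: "ord_y F = max_ord_y F"
    and upd: "updent F = min_updent F" and nq: "\<not> quasi_monomial F"
    and e: "0 < \<epsilon>" "\<epsilon> < \<delta>" "\<delta> < 1"
  shows "complicacy_of \<epsilon> \<delta> (blow_y F) < complicacy_of \<epsilon> \<delta> F \<or>
    (complicacy_of \<epsilon> \<delta> (blow_y F) = complicacy_of \<epsilon> \<delta> F \<and> min_shade (blow_y F) \<noteq> 0 \<and>
     min_updent (blow_y F) < min_updent F)"
proof -
  define G where "G = blow_y F"
  define r where "r = max_ord_y F"
  define m where "m = ord F"
  define s where "s = ord_z F"
  define d where "d = deg_y F"
  define S where "S = min_shade F"
  have F: "off_powers F" "F \<noteq> 0" and d2: "2 \<le> d" using nd by (auto simp: nondegenerate_def d_def)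
  note opt_facts = optimal_facts[OF p nd opt, folded r_def m_def s_def d_def S_def]
  have G: "off_powers G" "G \<noteq> 0" unfolding G_def by (rule off_powers_blow_y[OF F(1)], rule blow_y_ne_0[OF F(2)])
  have nzG: "in_supp G i j \<longleftrightarrow> (\<exists>a. i = a + j \<and> in_supp F a j)" for i j unfolding G_def by (rule in_supp_blow_y)
  have ds: "in_supp F d s" "\<And>i. in_supp F i s \<Longrightarrow> d \<le> i" "\<And>i j. in_supp F i j \<Longrightarrow> s \<le> j"
    using ord_z_spec[OF F(2)] by (auto simp: d_def s_def)
  have mm: "\<And>i j. in_supp F i j \<Longrightarrow> m \<le> i + j" "\<And>i j. in_supp F i j \<Longrightarrow> r \<le> i"
    using ord_spec(2)[OF F(2)] ord_y_spec(2)[OF F(2)] by (auto simp: m_def r_def opt[symmetric])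
  obtain a0 b0 where ab0: "in_supp F a0 b0" "a0 + b0 = m" using ord_spec(1)[OF F(2)] by (auto simp: m_def)
  have Gds: "in_supp G (d + s) s" using ds(1) nzG by blast
  have Gs: "s \<le> j" if "in_supp G i j" for i j using that nzG ds(3) by blast
  have Gd: "d + s \<le> i" if "in_supp G i s" for i using that nzG ds(2) by auto
  have oz: "ord_z G = s" by (rule ord_z_eqI[OF Gds Gs])
  have dy: "deg_y G = d + s" by (rule deg_y_eqI[OF Gds Gs Gd])
  have oy: "ord_y G = m"
  proof (rule ord_y_eqI)
    show "in_supp G m b0" using nzG ab0 by auto
  qed (use nzG mm(1) in auto)
  have M: "ord G \<le> i + 2 * j" if "in_supp F i j" for i j
    using ord_spec(2)[OF G(2), of "i + j" j] nzG that by auto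
  have rG: "m \<le> max_ord_y G" using max_ord_y_props(2)[OF p G, of 0] recoord_0[OF G(1)] oy by simp
  have sG: "min_shade G = ord G - max_ord_y G - s" by (simp add: min_shade_def oz)
  have cG: "complicacy_of \<epsilon> \<delta> G \<le> real (min_shade G)" by (rule complicacy_of_le_min_shade[OF e(1,2)])
  have cF: "complicacy_of \<epsilon> \<delta> F = real S - defect_value \<epsilon> \<delta> S (d - r) r"
    by (simp add: complicacy_of_def S_def d_def r_def)
  have cpos: "0 < complicacy_of \<epsilon> \<delta> F" by (rule complicacy_pos[OF p nd opt e])
  consider (corner) "S = d - r" | (near) "S \<noteq> d - r" "r = 0" "S + 1 = d - r"
    | (far) "S \<noteq> d - r" "defect_value \<epsilon> \<delta> S (d - r) r = 0"
    unfolding defect_value_def by argo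
  then have "complicacy_of \<epsilon> \<delta> G < complicacy_of \<epsilon> \<delta> F \<or>
    (complicacy_of \<epsilon> \<delta> G = complicacy_of \<epsilon> \<delta> F \<and> min_shade G \<noteq> 0 \<and> min_updent G < min_updent F)"
  proof cases
    case corner
    have "ord G \<le> d + 2 * s" by (rule M[OF ds(1)])
    then have "min_shade G = 0" using opt_facts corner rG unfolding sG by linarith
    then show ?thesis using cG cpos by simp
  next
    case near
    have "ord G \<le> d + 2 * s" by (rule M[OF ds(1)])
    then have s1: "min_shade G \<le> 1" using opt_facts near rG unfolding sG by linarith
    \<comment> \<open>The case excluded by the hypothesis on quasi-monomials.\<close>
    have "S \<noteq> 1"
    proof
      assume S1: "S = 1"
      then have d: "d = 2" "m = s + 1" using near opt_facts by auto
      have "b0 \<noteq> s" using ds(2)[of a0] ab0 d by auto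
      then have b0: "b0 = s + 1" "a0 = 0" using ds(3)[OF ab0(1)] ab0 d by auto
      have "ord_y F = 0" using opt near by (simp add: r_def)
      moreover have "deg_z F = s + 1"
      proof (rule deg_z_eqI)
        show "in_supp F 0 (s + 1)" using ab0 b0 by simp
        fix j assume "in_supp F 0 j"
        then show "s + 1 \<le> j" using ds(3)[of 0 j] ds(2)[of 0] d by (cases "j = s") auto
      qed simp
      ultimately have "quasi_monomial F" by (simp add: quasi_monomial_def width_def s_def)
      then show False using nq by blast
    qed
    then have "S \<ge> 2" using opt_facts by simp
    then have "real (min_shade G) < real S - \<delta>" using s1 e by linarith
    moreover have "defect_value \<epsilon> \<delta> S (d - r) r = \<delta>" using near by (simp add: defect_value_def)
    ultimately show ?thesis using cG cF by simp
  next
    case far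
    have cF': "complicacy_of \<epsilon> \<delta> F = real S" using cF far by simp
    have up: "min_shade G \<le> b0 - s" using M[OF ab0(1)] ab0(2) rG unfolding sG by linarith
    have a0: "r \<le> a0" "s \<le> b0" using mm(2)[OF ab0(1)] ds(3)[OF ab0(1)] by auto
    have le: "min_shade G \<le> S" using up a0 ab0(2) opt_facts by linarith
    show ?thesis
    proof (cases "min_shade G < S \<or> complicacy_of \<epsilon> \<delta> G < complicacy_of \<epsilon> \<delta> F")
      case True
      then show ?thesis using cG cF' by auto
    next
      case False
      then have eq: "min_shade G = S" using le by simp
      have ce: "complicacy_of \<epsilon> \<delta> G = complicacy_of \<epsilon> \<delta> F" using False cG cF' eq by auto
      have ab: "a0 = r" "b0 = m - r" using up eq a0 ab0(2) opt_facts by linarith+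
      have "max_ord_y G = m"
        using M[OF ab0(1)] ab ab0(2) rG eq opt_facts unfolding sG by linarith
      then have opt0: "0 \<in> optimal_shifts G" using oy recoord_0[OF G(1)] by (simp add: optimal_shifts_def)
      define P where "P = indent F"
      define Q where "Q = updent F"
      have rd: "ord_y F < deg_y F" using opt_facts opt by (simp add: r_def d_def)
      note sv = second_vertex[OF F(2) rd, folded P_def Q_def d_def s_def]
      have PQ: "P < Q"
      proof (rule ccontr)
        assume "\<not> P < Q"
        then have QP: "Q \<le> P" by simp
        have "P * d + Q * s \<le> P * r + Q * (m - r)" using sv(5)[OF ab0(1)] ab by simp
        moreover have "P * d = P * r + P * (d - r)" using opt_facts by (simp flip: distrib_left)
        moreover have "m - r = s + S" using opt_facts by linarith
        then have "Q * (m - r) = Q * s + Q * S" by (simp add: distrib_left)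
        ultimately have 1: "P * (d - r) \<le> Q * S" by linarith
        have "Q * (d - r) \<le> P * (d - r)" using QP by simp
        then have "Q * (d - r) \<le> Q * S" using 1 by linarith
        then have "d - r \<le> S" using sv(1) by simp
        then show False using opt_facts far by simp
      qed
      define R where "R = Q - P"
      have Q: "Q = P + R" "0 < R" using PQ by (auto simp: R_def)
      define D where "D = d - Q"
      have D: "d = D + P + R" using sv(2) Q by (simp add: D_def)
      have "updent G = (d + s) - (D + (s + P))"
      proof (rule second_vertex_eqI(1)[where s = s and b = "s + P"])
        show "in_supp G (d + s) s" "\<And>i j. in_supp G i j \<Longrightarrow> s \<le> j" "\<And>i. in_supp G i s \<Longrightarrow> d + s \<le> i"
          using Gds Gs Gd by blast+
        show "in_supp G (D + (s + P)) (s + P)" using nzG sv(4) by (auto simp: D_def)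
        show "D + (s + P) < d + s" "s < s + P" using D Q sv by auto
        have e1: "s + P - s = P" "d + s - (D + (s + P)) = R" using D by auto
        fix i j assume "in_supp G i j"
        then obtain a where a: "i = a + j" "in_supp F a j" using nzG by blast
        have l: "P * d + (P + R) * s \<le> P * a + (P + R) * j" using sv(5)[OF a(2)] Q by simp
        then show "(s + P - s) * (d + s) + (d + s - (D + (s + P))) * s \<le>
            (s + P - s) * i + (d + s - (D + (s + P))) * j"
          unfolding e1 a(1) by (simp add: algebra_simps)
        assume lt: "i < D + (s + P)"
        have "P * d + (P + R) * s < P * a + (P + R) * j"
        proof (cases "a < D")
          case True
          then show ?thesis using sv(6)[OF a(2)] Q by (simp add: D_def)
        next
          case False
          then obtain x where x: "a = D + x" by (metis le_iff_add not_less)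
          show ?thesis
          proof (rule ccontr)
            assume "\<not> ?thesis"
            then have "P * (x + j) + R * j = P * (P + s) + R * (P + s)"
              using l unfolding x D by (simp add: algebra_simps)
            moreover have xj: "x + j < P + s" using lt a(1) x by simp
            then have "P * (x + j) < P * (P + s)" using sv(3) by simp
            ultimately have "R * (P + s) < R * j" by linarith
            then have "P + s < j" by simp
            then show False using xj by simp
          qed
        qed
        then show "(s + P - s) * (d + s) + (d + s - (D + (s + P))) * s <
            (s + P - s) * i + (d + s - (D + (s + P))) * j"
          unfolding e1 a(1) by (simp add: algebra_simps)
      qed
      also have "\<dots> = R" using D by simp
      finally have "updent G < updent F" using Q sv by (simp add: Q_def P_def)
      moreover have "min_updent G \<le> updent G"
        unfolding min_updent_def using opt0 recoord_0[OF G(1)] by (intro Least_le bexI[of _ 0]) auto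
      ultimately show ?thesis using ce eq opt_facts upd by auto
    qed
  qed
  then show ?thesis unfolding G_def .
qed

section \<open>Steepness of the bottom edge\<close>

lemma mod_powers_blow_z: "mod_powers (blow_z F) = blow_z (mod_powers F)" for F :: "'k::field fps fps"
proof (rule fps2_eqI)
  fix i j
  show "coeff2 (mod_powers (blow_z F)) i j = coeff2 (blow_z (mod_powers F)) i j"
  proof (cases "i \<le> j")
    case True
    then obtain b where "j = i + b" by (metis le_iff_add)
    then show ?thesis unfolding coeff2_mod_powers coeff2_blow_z by (simp add: dvd_add_right_iff cong: conj_cong)
  qed (simp add: coeff2_mod_powers coeff2_blow_z)
qed

text \<open>
  A shift by $g$ after the blowup is a shift by $zg$ before it.
\<close>

lemma recoord_blow_z:
  fixes F :: "'k::field fps fps"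
  assumes g: "fps_nth g 0 = 0"
  shows "recoord g (blow_z F) = blow_z (recoord (fps_X * g) F)"
proof -
  have m: "fps_y + fps_const g \<in> max_ideal" "fps_y + fps_const (fps_X * g) \<in> max_ideal" "fps_y * fps_z \<in> max_ideal"
    using g by (simp_all add: max_ideal_iff coeff2_fps_y coeff2_fps_const coeff2_mult_00)
  have "shift g (blow_z F) = subst2 F ((fps_y + fps_const g) * fps_z) fps_z"
    unfolding shift_def blow_z_def by (simp add: subst2_comp m subst2_mult subst2_simps)
  also have "(fps_y + fps_const g) * fps_z = fps_y * fps_z + fps_const (fps_X * g)"
    by (simp add: fps_z_def algebra_simps)
  also have "subst2 F \<dots> fps_z = blow_z (shift (fps_X * g) F)"
    unfolding shift_def blow_z_def by (simp add: subst2_comp m subst2_add subst2_simps subst2_const_z)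
  finally show ?thesis by (simp add: recoord_def mod_powers_blow_z)
qed

lemma ord_y_blow_z: "F \<noteq> 0 \<Longrightarrow> ord_y (blow_z F) = ord_y F" for F :: "'k::field fps fps"
proof -
  assume F: "F \<noteq> 0"
  obtain b where "in_supp F (ord_y F) b" using ord_y_spec(1)[OF F] by blast
  then have "in_supp (blow_z F) (ord_y F) (ord_y F + b)" unfolding in_supp_blow_z by blast
  then show ?thesis by (rule ord_y_eqI) (use ord_y_spec(2)[OF F] in_supp_blow_z in blast)
qed

text \<open>
  If $(d,s)$ is the only exponent of lowest weight, a shift by $cz^k+\dots$ creates the form $(y+cz^k)^d z^s$.
  Its coefficient at $y^0$ may be lost as part of a $p$-th power, but then $p$ does not divide $d$ and the coefficient
  at $y^1$ survives. So the new edge of slope $k$ ends at abscissa $0$ or $1$.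
\<close>

lemma recoord_edge:
  fixes F :: "'k::field fps fps"
  assumes off: "off_powers F" and k: "k > 0" and g: "\<And>i. i < k \<Longrightarrow> fps_nth g i = 0" "fps_nth g k \<noteq> 0"
    and ds: "in_supp F d s" and F: "\<And>a b. in_supp F a b \<Longrightarrow> (a, b) \<noteq> (d, s) \<Longrightarrow> k * d + s < k * a + b"
  shows "\<And>a b. in_supp (recoord g F) a b \<Longrightarrow> k * d + s \<le> k * a + b"
    and "in_supp (recoord g F) 0 (k * d + s) \<or>
      (CHAR('k) dvd k * d + s \<and> 0 < d \<and> in_supp (recoord g F) 1 (k * d + s - k))"
proof -
  have im: "\<And>i j. k * i + j < k * d + s \<Longrightarrow> \<not> in_supp (shift g F) i j"
    "\<And>i j. k * i + j = k * d + s \<Longrightarrow> coeff2 (shift g F) i j =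
      coeff2 F d s * (of_nat (d choose i) * fps_nth g k ^ (d - i))"
    using shift_initial_monomial[OF k g(1) F] by (auto simp: in_supp_def)
  show "\<And>a b. in_supp (recoord g F) a b \<Longrightarrow> k * d + s \<le> k * a + b"
    using im(1) unfolding in_supp_recoord by (meson not_le)
  have F0: "coeff2 F d s \<noteq> 0" using ds by (simp add: in_supp_def)
  have c0: "in_supp (shift g F) 0 (k * d + s)"
    using im(2)[of 0 "k * d + s"] F0 g(2) by (simp add: in_supp_def)
  show "in_supp (recoord g F) 0 (k * d + s) \<or> (CHAR('k) dvd k * d + s \<and> 0 < d \<and> in_supp (recoord g F) 1 (k * d + s - k))"
  proof (cases "CHAR('k) dvd k * d + s")
    case False
    then show ?thesis using c0 by (simp add: in_supp_recoord)
  next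
    case True
    have nd: "\<not> CHAR('k) dvd d"
    proof
      assume "CHAR('k) dvd d"
      moreover from this have "CHAR('k) dvd s" using True by (metis dvd_add_right_iff dvd_mult)
      ultimately show False using off_powers_in_supp[OF off ds] by blast
    qed
    then have d0: "0 < d" by (cases d) auto
    have e: "k * 1 + (k * d + s - k) = k * d + s" using d0 by (cases d) auto
    have "of_nat d \<noteq> (0::'k)" using nd by (simp add: of_nat_eq_0_iff_char_dvd)
    then have "in_supp (shift g F) 1 (k * d + s - k)"
      using im(2)[OF e] F0 g(2) by (simp add: in_supp_def)
    moreover have "\<not> CHAR('k) dvd 1" using CHAR_not_1[where 'a='k] by simp
    ultimately show ?thesis using True d0 unfolding in_supp_recoord by blast
  qed
qed

text \<open>
  All exponents lie on or above the line of slope \<open>k\<close> through \<open>(d, s)\<close>.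
\<close>

definition steep :: "nat \<Rightarrow> nat \<Rightarrow> nat \<Rightarrow> 'k::zero fps fps \<Rightarrow> bool" where
  "steep d s k F \<longleftrightarrow> (\<forall>a b. in_supp F a b \<longrightarrow> k * d + s \<le> k * a + b)"

lemma steep_mono:
  assumes "steep d s k F" "j \<le> k" and s: "\<And>a b. in_supp F a b \<Longrightarrow> s \<le> b"
  shows "steep d s j F"
  unfolding steep_def
proof (intro allI impI)
  fix a b assume ab: "in_supp F a b"
  have k: "k * d + s \<le> k * a + b" using assms(1) ab by (simp add: steep_def)
  show "j * d + s \<le> j * a + b"
  proof (cases "d \<le> a")
    case True
    then show ?thesis using s[OF ab] by (simp add: add_mono)
  next
    case False
    then obtain x where x: "d = a + x" by (metis le_iff_add nat_le_linear)
    have "k * x + s \<le> b" using k unfolding x by (simp add: algebra_simps)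
    moreover have "j * x \<le> k * x" using assms(2) by simp
    ultimately have "j * x + s \<le> b" by linarith
    then show ?thesis unfolding x by (simp add: algebra_simps)
  qed
qed

text \<open>
  Two members of the family with steep bottom edges have almost the same shift: a low order term
  would create an edge of small slope by \<open>recoord_edge\<close>. Here $d\ge 2$ ensures that this edge is not
  reduced to a point.
\<close>

lemma steep_unique:
  fixes F :: "'k::field fps fps"
  assumes off: "off_powers F" and ds: "in_supp F d s" "\<And>a b. in_supp F a b \<Longrightarrow> s \<le> b" and d: "2 \<le> d"
    and st: "steep d s (Suc k) F" "steep d s (Suc k) (recoord g F)" and g0: "fps_nth g 0 = 0"
  shows "i \<le> k \<Longrightarrow> fps_nth g i = 0"
proof (rule ccontr)
  assume "i \<le> k" "fps_nth g i \<noteq> 0"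
  define j where "j = (LEAST j. fps_nth g j \<noteq> 0)"
  have "fps_nth g j \<noteq> 0" unfolding j_def by (rule LeastI[of _ i]) fact
  moreover have "j \<le> i" unfolding j_def by (rule Least_le) fact
  moreover have "fps_nth g i' = 0" if "i' < j" for i'
    using not_less_Least[OF that[unfolded j_def]] by blast
  ultimately have j: "fps_nth g j \<noteq> 0" "j \<le> k" "\<And>i. i < j \<Longrightarrow> fps_nth g i = 0"
    using \<open>i \<le> k\<close> by auto
  have j0: "j > 0" using j(1) g0 by (cases j) auto
  have Fj: "j * d + s < j * a + b" if ab: "in_supp F a b" "(a, b) \<noteq> (d, s)" for a b
  proof (cases "d \<le> a")
    case True
    have s: "s \<le> b" by (rule ds(2)[OF ab(1)])
    show ?thesis
    proof (cases "a = d")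
      case True
      then show ?thesis using ab(2) s by auto
    next
      case False
      then have "j * d < j * a" using True j0 by simp
      then show ?thesis using s by linarith
    qed
  next
    case False
    then obtain x where x: "d = a + x" by (metis le_iff_add nat_le_linear)
    have "Suc k * (a + x) + s \<le> Suc k * a + b" using st(1) ab(1) x by (simp add: steep_def)
    then have "Suc k * x + s \<le> b" by (simp add: algebra_simps)
    moreover have "j * x < Suc k * x" by (rule mult_less_mono1) (use j(2) False x in auto)
    ultimately have "j * x + s < b" by linarith
    then show ?thesis unfolding x by (simp add: algebra_simps)
  qed
  obtain y where y: "Suc k = j + y" "0 < y" using j(2) by (metis le_imp_less_Suc less_imp_add_positive)
  have "in_supp (recoord g F) 0 (j * d + s) \<or> in_supp (recoord g F) 1 (j * d + s - j)"
    using recoord_edge(2)[OF off j0 j(3) j(1) ds(1) Fj] by blast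
  then have "Suc k * d + s \<le> Suc k * 0 + (j * d + s) \<or> Suc k * d + s \<le> Suc k * 1 + (j * d + s - j)"
    using st(2) unfolding steep_def by blast
  moreover obtain e where "d = Suc (Suc e)" using d by (metis add_2_eq_Suc le_iff_add)
  ultimately show False using y by (auto simp: algebra_simps)
qed

lemma steep_recoord:
  fixes F :: "'k::field fps fps"
  assumes "steep d s k F" "0 < k" "\<And>i. i < k \<Longrightarrow> fps_nth g i = 0"
  shows "steep d s k (recoord g F)"
  unfolding steep_def
proof (intro allI impI)
  fix a b assume "in_supp (recoord g F) a b"
  then have "in_supp (shift g F) a b" unfolding in_supp_recoord by blast
  then have "coeff2 (shift g F) a b \<noteq> 0" by (simp add: in_supp_def)
  then show "k * d + s \<le> k * a + b"
    using shift_initial_form(1)[of k g F "k * d + s" a b] assms by (force simp: steep_def)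
qed

text \<open>
  By \<open>steep_unique\<close> the shifts yielding ever steeper edges converge coefficientwise. In the limit no
  exponent lies to the left of $(d,s)$, so that the polygon is a quadrant.
\<close>

lemma not_arbitrarily_steep:
  fixes F :: "'k::alg_closed_field fps fps"
  assumes p: "prime CHAR('k)" and nd: "nondegenerate F"
  shows "\<exists>k>0. \<forall>g. fps_nth g 0 = 0 \<longrightarrow> \<not> steep (deg_y F) (ord_z F) k (recoord g F)"
proof (rule ccontr)
  assume neg: "\<not> ?thesis"
  define d where "d = deg_y F"
  define s where "s = ord_z F"
  have F: "off_powers F" "F \<noteq> 0" and d2: "2 \<le> d" using nd by (auto simp: nondegenerate_def d_def)
  note inv = recoord_invariants[OF p F]
  have low: "s \<le> b" if "fps_nth g 0 = 0" "in_supp (recoord g F) a b" for g a b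
    using ord_z_spec(1)[OF inv(1)[OF that(1)] that(2)] inv(2)[OF that(1)] by (simp add: s_def)
  have ds: "in_supp (recoord g F) d s" if "fps_nth g 0 = 0" for g
    using ord_z_spec(2)[OF inv(1)[OF that]] inv(2,3)[OF that] by (simp add: s_def d_def)
  from neg have "\<forall>k. \<exists>g. 0 < k \<longrightarrow> fps_nth g 0 = 0 \<and> steep d s k (recoord g F)"
    unfolding d_def s_def by blast
  then obtain G where G: "\<And>k. 0 < k \<Longrightarrow> fps_nth (G k) 0 = 0" "\<And>k. 0 < k \<Longrightarrow> steep d s k (recoord (G k) F)"
    by metis
  \<comment> \<open>The coefficients of \<open>G k\<close> below \<open>k\<close> do not depend on \<open>k\<close>; \<open>g\<close> is the limit.\<close>
  define g where "g = Abs_fps (\<lambda>j. fps_nth (G (Suc j)) j)"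
  have g0: "fps_nth g 0 = 0" using G(1)[of 1] by (simp add: g_def)
  have agree: "fps_nth (G k) i = fps_nth g i" if "i < k" for i k
  proof -
    have k: "0 < k" "Suc i \<le> k" using that by auto
    have e: "recoord (G k - G (Suc i)) (recoord (G (Suc i)) F) = recoord (G k) F"
      using G(1)[of k] G(1)[of "Suc i"] k by (simp add: recoord_recoord p)
    have low': "\<And>a b. in_supp (recoord (G (Suc i)) F) a b \<Longrightarrow> s \<le> b" using low G(1) by blast
    have stk: "steep d s (Suc i) (recoord (G k) F)"
      by (rule steep_mono[OF G(2)[OF k(1)] k(2)]) (use low G(1)[OF k(1)] in blast)
    have "fps_nth (G k - G (Suc i)) i = 0"
      by (rule steep_unique[where F = "recoord (G (Suc i)) F" and g = "G k - G (Suc i)" and k = i and d = d and s = s])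
        (use G(1)[of k] G(1)[of "Suc i"] G(2)[of "Suc i"] ds[of "G (Suc i)"] low' d2 e k stk in simp_all)
    then show ?thesis by (simp add: g_def)
  qed
  have st: "steep d s k (recoord g F)" if k: "0 < k" for k
  proof -
    have "recoord (g - G k) (recoord (G k) F) = recoord g F" using G(1)[OF k] g0 by (simp add: recoord_recoord p)
    then show ?thesis using steep_recoord[OF G(2)[OF k] k, of "g - G k"] agree by simp
  qed
  have ge: "d \<le> a" if ab: "in_supp (recoord g F) a b" for a b
  proof (rule ccontr)
    assume "\<not> d \<le> a"
    then obtain x where x: "d = a + Suc x" by (metis less_iff_Suc_add add_Suc_right not_le)
    have "Suc b * d + s \<le> Suc b * a + b" using st[of "Suc b"] ab unfolding steep_def by blast
    then show False unfolding x by (simp add: algebra_simps)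
  qed
  have "ord_y (recoord g F) = d" by (rule ord_y_eqI[OF ds[OF g0] ge])
  then have "in_supp (recoord g F) (ord_y (recoord g F)) (ord_z (recoord g F))"
    using ds[OF g0] inv(2)[OF g0] by (simp add: s_def)
  then show False using nd g0 by (simp add: nondegenerate_def)
qed

lemma nondegenerate_lt:
  fixes F :: "'k::field fps fps"
  assumes nd: "nondegenerate F" and g: "fps_nth g 0 = 0" and ne: "recoord g F \<noteq> 0"
  shows "ord_y (recoord g F) < deg_y (recoord g F)"
proof -
  have "\<not> in_supp (recoord g F) (ord_y (recoord g F)) (ord_z (recoord g F))" using nd g by (simp add: nondegenerate_def)
  then show ?thesis using ord_z_spec(2)[OF ne] ord_y_le_deg_y[OF ne] by (metis le_neq_implies_less)
qed

lemma indent_bounded: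
  fixes F :: "'k::alg_closed_field fps fps"
  assumes p: "prime CHAR('k)" and nd: "nondegenerate F"
  shows "\<exists>N. \<forall>g. fps_nth g 0 = 0 \<longrightarrow> indent (recoord g F) \<le> N"
proof -
  obtain k where k: "k > 0" "\<And>g. fps_nth g 0 = 0 \<Longrightarrow> \<not> steep (deg_y F) (ord_z F) k (recoord g F)"
    using not_arbitrarily_steep[OF assms] by blast
  have F: "off_powers F" "F \<noteq> 0" using nd by (auto simp: nondegenerate_def)
  have "indent (recoord g F) \<le> k * deg_y F" if g: "fps_nth g 0 = 0" for g
  proof (rule ccontr)
    assume neg: "\<not> ?thesis"
    note inv = recoord_invariants[OF p F g]
    note sv = second_vertex[OF inv(1) nondegenerate_lt[OF nd g inv(1)], unfolded inv(2,3)]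
    define P where "P = indent (recoord g F)"
    define Q where "Q = updent (recoord g F)"
    have "k * Q \<le> k * deg_y F" using sv(2) by (simp add: Q_def)
    then have PQ: "k * Q \<le> P" using neg unfolding P_def by linarith
    have "steep (deg_y F) (ord_z F) k (recoord g F)"
      unfolding steep_def
    proof (intro allI impI)
      fix a b assume ab: "in_supp (recoord g F) a b"
      have s: "ord_z F \<le> b" using ord_z_spec(1)[OF inv(1) ab] inv(2) by simp
      show "k * deg_y F + ord_z F \<le> k * a + b"
      proof (cases "deg_y F \<le> a")
        case True
        then show ?thesis using s by (simp add: add_mono)
      next
        case False
        then obtain x where x: "deg_y F = a + x" by (metis le_iff_add nat_le_linear)
        obtain y where y: "b = ord_z F + y" using s by (metis le_iff_add)
        have "P * x \<le> Q * y" using sv(5)[OF ab] unfolding x y P_def[symmetric] Q_def[symmetric]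
          by (simp add: algebra_simps)
        moreover have "k * Q * x \<le> P * x" using PQ by simp
        moreover have "Q * (k * x) = k * Q * x" by simp
        ultimately have "Q * (k * x) \<le> Q * y" by linarith
        then have "k * x \<le> y" using sv(1) by (simp add: Q_def)
        then show ?thesis unfolding x y by (simp add: algebra_simps)
      qed
    qed
    then show False using k(2)[OF g] by blast
  qed
  then show ?thesis by blast
qed

lemma min_updent_props:
  fixes F :: "'k::alg_closed_field fps fps"
  assumes p: "prime CHAR('k)" and F: "off_powers F" "F \<noteq> 0"
  shows "\<exists>g\<in>optimal_shifts F. updent (recoord g F) = min_updent F"
    "\<And>g. g \<in> optimal_shifts F \<Longrightarrow> min_updent F \<le> updent (recoord g F)"
proof -
  have "\<exists>n. \<exists>g\<in>optimal_shifts F. updent (recoord g F) = n" using max_ord_y_props(1)[OF p F] by blast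
  then show "\<exists>g\<in>optimal_shifts F. updent (recoord g F) = min_updent F"
    unfolding min_updent_def by (rule LeastI_ex)
  show "\<And>g. g \<in> optimal_shifts F \<Longrightarrow> min_updent F \<le> updent (recoord g F)"
    unfolding min_updent_def by (rule Least_le) blast
qed

lemma max_indent_props:
  fixes F :: "'k::alg_closed_field fps fps"
  assumes p: "prime CHAR('k)" and F: "off_powers F" "F \<noteq> 0"
    and bd: "\<And>g. g \<in> optimal_shifts F \<Longrightarrow> indent (recoord g F) \<le> N"
  shows "\<exists>g\<in>optimal_shifts F. updent (recoord g F) = min_updent F \<and> indent (recoord g F) = max_indent F"
    "\<And>g. g \<in> optimal_shifts F \<Longrightarrow> updent (recoord g F) = min_updent F \<Longrightarrow> indent (recoord g F) \<le> max_indent F"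
proof -
  let ?P = "\<lambda>n. \<exists>g\<in>optimal_shifts F. updent (recoord g F) = min_updent F \<and> indent (recoord g F) = n"
  have b: "\<forall>n. ?P n \<longrightarrow> n \<le> N" using bd by blast
  obtain n where "?P n" using min_updent_props(1)[OF p F] by blast
  then show "?P (max_indent F)" unfolding max_indent_def by (rule GreatestI_nat[where b = N]) (use b in blast)
  show "indent (recoord g F) \<le> max_indent F" if "g \<in> optimal_shifts F" "updent (recoord g F) = min_updent F" for g
    unfolding max_indent_def by (rule Greatest_le_nat[where b = N]) (use b that in blast)+
qed

lemma blow_z_dent:
  fixes F :: "'k::field fps fps"
  assumes F: "F \<noteq> 0" and lt: "ord_y F < deg_y F"
    and init: "\<And>a b. in_supp F a b \<Longrightarrow> (a, b) \<noteq> (deg_y F, ord_z F) \<Longrightarrow> deg_y F + ord_z F < a + b"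
  shows "updent F < indent F" "updent (blow_z F) = updent F" "indent (blow_z F) = indent F - updent F"
proof -
  define d where "d = deg_y F"
  define s where "s = ord_z F"
  define P where "P = indent F"
  define Q where "Q = updent F"
  note sv = second_vertex[OF F lt, folded d_def s_def P_def Q_def]
  have ds: "in_supp F d s" using ord_z_spec(2)[OF F] by (simp add: d_def s_def)
  have "d + s < (d - Q) + (s + P)" using init[OF sv(4)[unfolded d_def s_def]] sv by (simp add: d_def s_def)
  then have PQ: "Q < P" using sv(2) by simp
  then show "updent F < indent F" by (simp add: P_def Q_def)
  obtain R where R: "P = Q + R" "0 < R" using PQ less_imp_add_positive by metis
  define D where "D = d - Q"
  have D: "d = D + Q" using sv(2) by (simp add: D_def)
  have init': "d + s \<le> a + b" if "in_supp F a b" for a b using init[OF that] by (cases "(a, b) = (d, s)") (auto simp: d_def s_def)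
  have e: "D + (s + P) - (d + s) = R" "d - D = Q" using D R by auto
  have 1: "in_supp (blow_z F) d (d + s)" using ds in_supp_blow_z by blast
  have 2: "d + s \<le> j" if "in_supp (blow_z F) i j" for i j using that init' unfolding in_supp_blow_z by auto
  have 3: "d \<le> i" if "in_supp (blow_z F) i (d + s)" for i
  proof -
    obtain b where b: "d + s = i + b" "in_supp F i b" using \<open>in_supp (blow_z F) i (d + s)\<close> in_supp_blow_z by blast
    then show ?thesis using init[OF b(2)] by (cases "(i, b) = (d, s)") (auto simp: d_def s_def)
  qed
  have 4: "in_supp (blow_z F) D (D + (s + P))" using sv(4) unfolding in_supp_blow_z D_def by blast
  have 5: "D < d" "d + s < D + (s + P)" using D sv(1) PQ by auto
  have 6: "(D + (s + P) - (d + s)) * d + (d - D) * (d + s) \<le> (D + (s + P) - (d + s)) * i + (d - D) * j"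
    if ij: "in_supp (blow_z F) i j" for i j
  proof -
    obtain b where b: "j = i + b" "in_supp F i b" using ij in_supp_blow_z by blast
    show ?thesis unfolding e b(1) using sv(5)[OF b(2)] unfolding R(1) by (simp add: algebra_simps)
  qed
  have 7: "(D + (s + P) - (d + s)) * d + (d - D) * (d + s) < (D + (s + P) - (d + s)) * i + (d - D) * j"
    if ij: "in_supp (blow_z F) i j" "i < D" for i j
  proof -
    obtain b where b: "j = i + b" "in_supp F i b" using ij in_supp_blow_z by blast
    show ?thesis unfolding e b(1) using sv(6)[OF b(2)] ij(2) unfolding R(1) D_def[symmetric] by (simp add: algebra_simps)
  qed
  have "updent (blow_z F) = d - D"
    by (rule second_vertex_eqI(1)[where s = "d + s" and b = "D + (s + P)"]) (fact 1 2 3 4 5 6 7)+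
  then show "updent (blow_z F) = updent F" unfolding e Q_def .
  have "indent (blow_z F) = D + (s + P) - (d + s)"
    by (rule second_vertex_eqI(2)[where d = d and a = D]) (fact 1 2 3 4 5 6 7)+
  then show "indent (blow_z F) = indent F - updent F" unfolding e using R by (simp add: P_def Q_def)
qed

section \<open>The order at a translated point\<close>

lemma pcompose_pow: "pcompose (p ^ n) q = pcompose p q ^ n" for p q :: "'a::comm_semiring_1 poly"
  by (induction n) (simp_all add: pcompose_1 pcompose_mult)

text \<open>
  Zeros are counted with multiplicity at $0$ and $t$. Both multiplicities are stated as vanishing of low
  coefficients, of $A(y)$ and of $A(y+t)$, the form in which the support of a series provides them.
\<close>

lemma poly_two_roots:
  fixes A :: "'k::field poly"
  assumes t: "t \<noteq> 0" and n: "\<And>i. i < n \<Longrightarrow> coeff (pcompose A [:t, 1:]) i = 0"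
    and r: "\<And>i. i < r \<Longrightarrow> coeff A i = 0" and deg: "degree A < n + r"
  shows "A = 0"
proof (rule ccontr)
  assume A0: "A \<noteq> 0"
  define q where "q = [:t, 1:]"
  have "monom 1 r dvd A" using r by (simp add: monom_1_dvd_iff')
  then obtain B where B: "A = monom 1 r * B" by (elim dvdE)
  have B0: "B \<noteq> 0" using A0 B by auto
  have comp: "pcompose A q = q ^ r * pcompose B q"
    unfolding B by (simp add: pcompose_mult monom_altdef pcompose_pow pcompose_pCons)
  have dq: "degree q = 1" by (simp add: q_def)
  have Bq0: "pcompose B q \<noteq> 0" using B0 dq by (simp add: pcompose_eq_0_iff)
  have q0: "q \<noteq> 0" by (simp add: q_def)
  have "monom 1 n dvd pcompose A q" using n by (simp add: monom_1_dvd_iff' q_def)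
  moreover have in_supp: "q ^ r * pcompose B q \<noteq> 0" using Bq0 q0 by simp
  ultimately have "n \<le> order 0 (q ^ r * pcompose B q)" using comp by (simp add: monom_1_dvd_iff)
  also have "\<dots> = order 0 (q ^ r) + order 0 (pcompose B q)" by (rule order_mult[OF in_supp])
  also have "order 0 (q ^ r) = 0" by (rule order_0I) (simp add: q_def t)
  finally have "n \<le> degree (pcompose B q)" using order_degree[OF Bq0, of 0] by simp
  then have "n \<le> degree B" by (simp add: degree_pcompose dq)
  moreover have "degree A = r + degree B"
    unfolding B using B0 by (subst degree_mult_eq) (auto simp: degree_monom_eq)
  ultimately show False using deg by simp
qed

text \<open>
  Moh's bound for a translation $y \mapsto y+tz$. Let $A(y)=P(y,1)$ with $P$ the lowest form, of order $m$.
  If the claim fails, then all low coefficients of $A(y+t)$ are zero or belong to $p$-th powers. If $p$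
  divides $m$, passing to the derivative kills the latter, and $A'$ has too many zeros at $0$ and $t$, so
  $A'=0$ and $P$ is a $p$-th power. Otherwise no $p$-th powers occur and already $A$ has too many zeros.
\<close>

lemma moh_bound:
  fixes F :: "'k::field fps fps"
  assumes off: "off_powers F" and F: "\<And>a b. in_supp F a b \<Longrightarrow> m \<le> a + b" "\<And>a b. in_supp F a b \<Longrightarrow> r \<le> a"
      "\<And>a b. in_supp F a b \<Longrightarrow> s \<le> b"
    and m: "in_supp F a0 b0" "a0 + b0 = m" and r: "1 \<le> r" and g: "fps_nth g 0 = 0" "fps_nth g 1 \<noteq> 0"
  shows "\<exists>\<alpha>. \<alpha> + s + r \<le> m + 1 \<and> in_supp (recoord g F) \<alpha> (m - \<alpha>)"
proof (rule ccontr)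
  assume neg: "\<not> ?thesis"
  define t where "t = fps_nth g 1"
  define A where "A = (\<Sum>a\<le>m. monom (coeff2 F a (m - a)) a)"
  have cA: "coeff A a = (if a \<le> m then coeff2 F a (m - a) else 0)" for a
  proof -
    have "coeff A a = (\<Sum>a'\<le>m. if a' = a then coeff2 F a' (m - a') else 0)"
      unfolding A_def by (simp add: coeff_sum)
    then show ?thesis by simp
  qed
  have rs: "r \<le> a0" "s \<le> b0" using F m by auto
  have cq: "coeff ([:t, 1:] ^ a) i = of_nat (a choose i) * t ^ (a - i)" for a i
  proof (cases "i \<le> a")
    case False
    then have "degree ([:t, 1:] ^ a) < i" by (simp add: degree_power_eq)
    then show ?thesis using False by (simp add: coeff_eq_0 binomial_eq_0)
  qed (simp add: coeff_linear_poly_power)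
  have cB: "coeff (pcompose A [:t, 1:]) i = coeff2 (shift g F) i (m - i)" if i: "i \<le> m" for i
  proof -
    have "pcompose A [:t, 1:] = (\<Sum>a\<le>m. smult (coeff2 F a (m - a)) ([:t, 1:] ^ a))"
      unfolding A_def by (simp add: pcompose_sum monom_altdef pcompose_smult pcompose_pow pcompose_pCons)
    then have "coeff (pcompose A [:t, 1:]) i = (\<Sum>a\<le>m. coeff2 F a (m - a) * (of_nat (a choose i) * t ^ (a - i)))"
      by (simp add: coeff_sum cq)
    also have "\<dots> = (\<Sum>a\<le>i + (m - i). if 1 * a \<le> m then
        coeff2 F a (m - 1 * a) * (of_nat (a choose i) * fps_nth g 1 ^ (a - i)) else 0)"
      using i by (intro sum.cong) (auto simp: t_def)
    also have "\<dots> = coeff2 (shift g F) i (m - i)"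
      by (rule shift_initial_form(2)[symmetric]) (use g F(1) i in auto)
    finally show ?thesis .
  qed
  have low: "coeff A i = 0" if "i < r" for i
    using F(2)[of i "m - i"] that by (auto simp: cA in_supp_def)
  have high: "coeff A i = 0" if "m - s < i" for i
  proof (rule ccontr)
    assume "coeff A i \<noteq> 0"
    then have "i \<le> m" "in_supp F i (m - i)" by (auto simp: cA in_supp_def split: if_splits)
    then have "s \<le> m - i" "i \<le> m" using F(3) by auto
    then show False using that by linarith
  qed
  then have degA: "degree A \<le> m - s" by (meson degree_le)
  have A0: "A \<noteq> 0"
  proof -
    have "coeff A a0 \<noteq> 0" using m by (auto simp: cA in_supp_def)
    then show ?thesis by auto
  qed
  define n where "n = m + 1 - s - r"
  have n: "n + s + r = m + 1" "n \<le> m" using rs m r by (auto simp: n_def)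
  have vanish: "(CHAR('k) dvd i \<and> CHAR('k) dvd (m - i)) \<or> coeff (pcompose A [:t, 1:]) i = 0" if i: "i \<le> n" for i
  proof -
    have "\<not> in_supp (recoord g F) i (m - i)" using neg i n by auto
    then show ?thesis using cB[of i] i n unfolding in_supp_recoord by (auto simp: in_supp_def)
  qed
  show False
  proof (cases "CHAR('k) dvd m")
    case True
    have "pderiv A = 0"
    proof (rule poly_two_roots)
      show "t \<noteq> 0" using g by (simp add: t_def)
      fix i assume "i < n"
      then have v: "(CHAR('k) dvd Suc i) \<or> coeff (pcompose A [:t, 1:]) (Suc i) = 0" using vanish[of "Suc i"] by auto
      have "pcompose (pderiv A) [:t, 1:] = pderiv (pcompose A [:t, 1:])"
        by (simp add: pderiv_pcompose pderiv_pCons)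
      then have "coeff (pcompose (pderiv A) [:t, 1:]) i = of_nat (Suc i) * coeff (pcompose A [:t, 1:]) (Suc i)"
        by (simp only: coeff_pderiv)
      also have "\<dots> = 0" using v of_nat_eq_0_iff_char_dvd[where 'a='k, of "Suc i"] by fastforce
      finally show "coeff (pcompose (pderiv A) [:t, 1:]) i = 0" .
    next
      fix i assume "i < r - 1"
      then show "coeff (pderiv A) i = 0" using low[of "Suc i"] by (simp add: coeff_pderiv)
    next
      have "degree (pderiv A) \<le> degree A - 1" by (intro degree_le) (auto simp: coeff_pderiv coeff_eq_0)
      then show "degree (pderiv A) < n + (r - 1)" using degA n r rs m by linarith
    qed
    then have "of_nat (Suc i) * coeff A (Suc i) = 0" for i by (metis coeff_pderiv coeff_0)
    then have d: "CHAR('k) dvd i" if "coeff A i \<noteq> 0" for i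
      using that of_nat_eq_0_iff_char_dvd[where 'a='k, of i] by (cases i) auto
    have nzA: "coeff A a0 \<noteq> 0" using m by (auto simp: cA in_supp_def)
    have "CHAR('k) dvd b0" using d[OF nzA] True m(2) by (metis dvd_add_right_iff)
    then show False using off_powers_in_supp[OF off m(1)] d[OF nzA] by blast
  next
    case False
    have "A = 0"
    proof (rule poly_two_roots)
      show "t \<noteq> 0" using g by (simp add: t_def)
      fix i assume i: "i < Suc n"
      have "\<not> (CHAR('k) dvd i \<and> CHAR('k) dvd (m - i))"
        using False i n by (metis dvd_add le_add_diff_inverse less_Suc_eq_le order_trans)
      then show "coeff (pcompose A [:t, 1:]) i = 0" using vanish[of i] i by auto
    next
      show "degree A < Suc n + r" using degA n by linarith
    qed (rule low)
    then show False using A0 by simp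
  qed
qed

text \<open>
  If $p$ divides $d+s$, then the coefficient of $(y+z)^d z^s$ at $y^0$ is a $p$-th power, and its coefficient at
  $y^1$ is not zero. So the equation $F(z+z g(z), z) = c z^{d+s}$, where $c$ is the coefficient of $F$ at $(d,s)$, has a solution
  with $g(0)=0$, and the shift by $z+zg(z)$ removes all terms at $y^0$ modulo $p$-th powers.
\<close>

lemma hensel_ord_y:
  fixes F :: "'k::alg_closed_field fps fps"
  assumes p: "prime CHAR('k)" and off: "off_powers F" and ds: "in_supp F d s"
    and init: "\<And>a b. in_supp F a b \<Longrightarrow> (a, b) \<noteq> (d, s) \<Longrightarrow> d + s < a + b"
    and dvd: "CHAR('k) dvd d + s" and d0: "0 < d"
  shows "1 \<le> max_ord_y F"
proof -
  define m where "m = d + s"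
  define H where "H = shift fps_X F"
  have F0: "coeff2 F d s \<noteq> 0" using ds by (simp add: in_supp_def)
  have F_ne: "F \<noteq> 0" using ds by (rule in_supp_ne_0)
  have im: "i + j < m \<Longrightarrow> coeff2 H i j = 0"
    "i + j = m \<Longrightarrow> coeff2 H i j = coeff2 F d s * of_nat (d choose i)" for i j
    using shift_initial_monomial[of 1 "fps_X :: 'k fps" F d s i j] init by (auto simp: H_def m_def)
  define L where "L = Abs_fps (\<lambda>i. Abs_fps (\<lambda>j. coeff2 (blow_z H) i (j + m)))"
  have cL: "coeff2 L i j = coeff2 (blow_z H) i (j + m)" for i j by (simp add: L_def coeff2_def)
  have HL: "blow_z H = fps_z ^ m * L"
  proof (rule fps2_eqI)
    fix i j
    have "coeff2 (blow_z H) i j = 0" if "j < m" using that im(1) by (simp add: coeff2_blow_z)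
    then show "coeff2 (blow_z H) i j = coeff2 (fps_z ^ m * L) i j"
      using coeff2_monom_mult[of 0 m L i j] by (auto simp: cL)
  qed
  define e where "e = coeff2 F d s"
  \<comment> \<open>\<open>z ^ m * L\<close> is the total transform near the point \<open>t = 1\<close> of the exceptional divisor, and \<open>e\<close> the value of \<open>L\<close> there.\<close>
  define E where "E = L - const2 e"
  have ndvd: "\<not> CHAR('k) dvd d"
  proof
    assume "CHAR('k) dvd d"
    moreover from this have "CHAR('k) dvd s" using dvd by (metis dvd_add_right_iff)
    ultimately show False using off_powers_in_supp[OF off ds] by blast
  qed
  have "E \<in> max_ideal"
    using im(2)[of 0 m] by (simp add: max_ideal_iff E_def cL coeff2_blow_z coeff2_const2 e_def)
  moreover have "coeff2 E 1 0 \<noteq> 0"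
  proof -
    have m1: "1 \<le> m" "1 + (m - 1) = m" using d0 by (auto simp: m_def)
    have "coeff2 E 1 0 = coeff2 H 1 (m - 1)" using m1 by (simp add: E_def cL coeff2_blow_z coeff2_const2)
    also have "\<dots> = e * of_nat d" using im(2)[OF m1(2)] by (simp add: e_def)
    finally show ?thesis using F0 ndvd of_nat_eq_0_iff_char_dvd[where 'a='k, of d] by (simp add: e_def)
  qed
  ultimately obtain g U where g: "fps_nth g 0 = 0" and EU: "E = U * (fps_y - fps_const g)"
    using implicit_function by metis
  have mg: "fps_y + fps_const g \<in> max_ideal" using g by (simp add: max_ideal_iff coeff2_fps_y coeff2_fps_const)
  have "shift g (blow_z H) = fps_z ^ m * (const2 e + subst2 U (fps_y + fps_const g) fps_z * fps_y)"
  proof -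
    have "L = const2 e + U * (fps_y - fps_const g)" using EU by (simp add: E_def algebra_simps)
    then show ?thesis unfolding HL shift_def
      by (simp add: subst2_mult mg subst2_add subst2_simps subst2_const_z)
  qed
  moreover have "shift g (blow_z H) = blow_z (shift (fps_X + fps_X * g) F)"
  proof -
    have mm: "fps_y * fps_z \<in> (max_ideal :: 'k fps fps set)" "fps_y + fps_const (fps_X * g) \<in> max_ideal"
      by (simp_all add: max_ideal_iff coeff2_fps_y coeff2_fps_const coeff2_mult_00)
    have "shift g (blow_z H) = subst2 H ((fps_y + fps_const g) * fps_z) fps_z"
      unfolding shift_def blow_z_def by (simp add: subst2_comp mm mg subst2_mult subst2_simps)
    also have "(fps_y + fps_const g) * fps_z = fps_y * fps_z + fps_const (fps_X * g)"
      by (simp add: fps_z_def algebra_simps)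
    also have "subst2 H \<dots> fps_z = blow_z (shift (fps_X * g) H)"
      unfolding shift_def blow_z_def by (simp add: subst2_comp mm subst2_add subst2_simps subst2_const_z)
    also have "shift (fps_X * g) H = shift (fps_X + fps_X * g) F"
      unfolding H_def by (simp add: shift_shift add.commute)
    finally show ?thesis .
  qed
  ultimately have eq: "blow_z (shift (fps_X + fps_X * g) F) =
      fps_z ^ m * (const2 e + subst2 U (fps_y + fps_const g) fps_z * fps_y)" by simp
  have z: "coeff2 (shift (fps_X + fps_X * g) F) 0 j = 0" if "j \<noteq> m" for j
  proof -
    have "coeff2 (shift (fps_X + fps_X * g) F) 0 j = coeff2 (blow_z (shift (fps_X + fps_X * g) F)) 0 j"
      by (simp add: coeff2_blow_z)
    also have "\<dots> = (if m \<le> j then coeff2 (const2 e + subst2 U (fps_y + fps_const g) fps_z * fps_y) 0 (j - m) else 0)"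
      unfolding eq using coeff2_monom_mult[of 0 m "const2 e + subst2 U (fps_y + fps_const g) fps_z * fps_y" 0 j] by simp
    also have "\<dots> = 0"
      using that coeff2_monom_mult[of 1 0 "subst2 U (fps_y + fps_const g) fps_z" 0 "j - m"]
      by (simp add: coeff2_const2 mult.commute)
    finally show ?thesis .
  qed
  have no: "\<not> in_supp (recoord (fps_X + fps_X * g) F) 0 j" for j
    using z[of j] dvd unfolding in_supp_recoord by (cases "j = m") (auto simp: m_def in_supp_def)
  have X0: "fps_nth (fps_X + fps_X * g) 0 = 0" by simp
  note inv = recoord_invariants[OF p off F_ne X0]
  have "ord_y (recoord (fps_X + fps_X * g) F) \<noteq> 0" using ord_y_spec(1)[OF inv(1)] no by metis
  then show ?thesis using max_ord_y_props(2)[OF p off F_ne X0] by simp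
qed

text \<open>
  Subtracting the defect from the shade gives at most the height minus the value of the defect at
  shade equal to height: when the shade lies one below the height, the defect is smaller by at most one,
  and when it lies further below, by less than two. This is where $\delta<1$ enters.
\<close>

lemma defect_value_bounds:
  fixes \<epsilon> \<delta> :: real
  assumes e: "0 < \<epsilon>" "\<epsilon> < \<delta>" "\<delta> < 1"
  defines "v r \<equiv> if r = 0 then 1 + \<delta> else if r = 1 then \<epsilon> else (0::real)"
  shows "S \<le> h \<Longrightarrow> real S - defect_value \<epsilon> \<delta> S h r \<le> real h - v r"
    "real S - v r \<le> real S - defect_value \<epsilon> \<delta> S h r" "1 \<le> r \<Longrightarrow> real S - \<epsilon> \<le> real S - defect_value \<epsilon> \<delta> S h r"
    "2 \<le> r \<Longrightarrow> defect_value \<epsilon> \<delta> S h r = 0"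
  using e by (auto simp: defect_value_def v_def)

lemma blow_z_measures:
  fixes F :: "'k::field fps fps"
  assumes F: "F \<noteq> 0"
  shows "ord_z (blow_z F) = ord F" "in_supp F (deg_y (blow_z F)) (ord F - deg_y (blow_z F))"
    "deg_y (blow_z F) \<le> ord F"
    "\<And>a b. in_supp F a b \<Longrightarrow> a + b = ord F \<Longrightarrow> deg_y (blow_z F) \<le> a"
    "ord (blow_z F) \<le> deg_y (blow_z F) + ord F"
proof -
  note G = blow_z_ne_0[OF F]
  obtain a b where ab: "in_supp F a b" "a + b = ord F" using ord_spec(1)[OF F] by blast
  show oz: "ord_z (blow_z F) = ord F"
  proof (rule ord_z_eqI)
    show "in_supp (blow_z F) a (ord F)" unfolding in_supp_blow_z using ab by (intro exI[of _ b]) simp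
    show "ord F \<le> j" if "in_supp (blow_z F) i j" for i j using that ord_spec(2)[OF F] unfolding in_supp_blow_z by auto
  qed
  have "in_supp (blow_z F) (deg_y (blow_z F)) (ord F)" using ord_z_spec(2)[OF G] oz by simp
  then show "in_supp F (deg_y (blow_z F)) (ord F - deg_y (blow_z F))" "deg_y (blow_z F) \<le> ord F"
    unfolding in_supp_blow_z by auto
  show "deg_y (blow_z F) \<le> a" if "in_supp F a b" "a + b = ord F" for a b
  proof -
    have "in_supp (blow_z F) a (ord F)" unfolding in_supp_blow_z using that by (intro exI[of _ b]) simp
    then show ?thesis using ord_z_spec(3)[OF G] oz by simp
  qed
  show "ord (blow_z F) \<le> deg_y (blow_z F) + ord F" using ord_le_deg[OF G] oz by simp
qed

lemma optimal_shifts_blow_z: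
  fixes F :: "'k::field fps fps"
  shows "g \<in> optimal_shifts (blow_z F) \<Longrightarrow> fps_nth g 0 = 0"
    "g \<in> optimal_shifts (blow_z F) \<Longrightarrow> recoord (fps_X * g) F \<noteq> 0 \<Longrightarrow> ord_y (recoord (fps_X * g) F) = max_ord_y (blow_z F)"
  by (auto simp: optimal_shifts_def recoord_blow_z ord_y_blow_z)

text \<open>
  The optimal coordinates leave the class compatible with $a'$: the point $a'$ lies on the strict transform of
  neither coordinate axis in these coordinates, and \<open>ord_y\<close> drops strictly. Moh's bound gives
  height at most \<open>S + 1 - r1\<close> after the blowup, where \<open>r1\<close> is the new value of \<open>ord_y\<close>.
\<close>

theorem decrease_z_dropping:
  fixes F :: "'k::alg_closed_field fps fps"
  assumes p: "prime CHAR('k)" and nd: "nondegenerate F"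
    and drop: "\<And>g. fps_nth g 0 = 0 \<Longrightarrow> ord_y (recoord (fps_X * g) F) < max_ord_y F"
    and e: "0 < \<epsilon>" "\<epsilon> < \<delta>" "\<delta> < 1"
  shows "complicacy_of \<epsilon> \<delta> (blow_z F) < complicacy_of \<epsilon> \<delta> F"
proof -
  have F: "off_powers F" "F \<noteq> 0" using nd by (auto simp: nondegenerate_def)
  define G where "G = blow_z F"
  have G: "off_powers G" "G \<noteq> 0" unfolding G_def by (rule off_powers_blow_z[OF F(1)], rule blow_z_ne_0[OF F(2)])
  define m where "m = ord F"
  define s where "s = ord_z F"
  define r where "r = max_ord_y F"
  obtain g where "g \<in> optimal_shifts F" using max_ord_y_props(1)[OF p F] by blast
  then have g: "fps_nth g 0 = 0" "ord_y (recoord g F) = r" by (auto simp: optimal_shifts_def r_def)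
  define H where "H = recoord g F"
  note inv = recoord_invariants[OF p F g(1), folded H_def]
  have ndH: "nondegenerate H" and rH: "max_ord_y H = r" and sH: "min_shade H = min_shade F"
    unfolding H_def r_def by (rule nondegenerate_recoord[OF p nd g(1)])+
  have optH: "ord_y H = max_ord_y H" using g(2) rH by (simp add: H_def)
  note opt_facts = optimal_facts[OF p ndH optH, unfolded inv rH sH, folded m_def s_def]
  have g1: "fps_nth (- g) 1 \<noteq> 0"
  proof
    assume "fps_nth (- g) 1 = 0"
    then have "g = fps_X * fps_shift 1 g"
      using g(1) by (intro fps_ext) (auto simp: not_less Suc_le_eq le_Suc_eq gr0_conv_Suc)
    moreover have "fps_nth (fps_shift 1 g) 0 = 0" using \<open>fps_nth (- g) 1 = 0\<close> by simp
    ultimately have "ord_y (recoord g F) < max_ord_y F" using drop by metis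
    then show False using g(2) by (simp add: r_def)
  qed
  have FH: "F = recoord (- g) H" unfolding H_def using g(1) F(1) by (simp add: recoord_recoord p recoord_0)
  obtain r1 where r1: "max_ord_y G = r1" "r1 < r"
  proof -
    obtain g' where g': "g' \<in> optimal_shifts G" using max_ord_y_props(1)[OF p G] by blast
    have g0: "fps_nth g' 0 = 0" using g' optimal_shifts_blow_z(1) unfolding G_def by blast
    then have "recoord (fps_X * g') F \<noteq> 0" by (intro recoord_invariants(1)[OF p F]) simp
    then have "ord_y (recoord (fps_X * g') F) = max_ord_y G" using g' optimal_shifts_blow_z(2) unfolding G_def by blast
    then show ?thesis using that drop[OF g0] by (simp add: r_def)
  qed
  obtain a0 b0 where ab: "in_supp H a0 b0" "a0 + b0 = m" using ord_spec(1)[OF inv(1)] inv(4) by (auto simp: m_def)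
  have "\<exists>\<alpha>. \<alpha> + s + r \<le> m + 1 \<and> in_supp (recoord (- g) H) \<alpha> (m - \<alpha>)"
  proof (rule moh_bound[OF _ _ _ _ ab])
    show "off_powers H" by (simp add: H_def)
    show "\<And>a b. in_supp H a b \<Longrightarrow> m \<le> a + b" using ord_spec(2)[OF inv(1)] inv(4) by (simp add: m_def)
    show "\<And>a b. in_supp H a b \<Longrightarrow> r \<le> a" using ord_y_spec(2)[OF inv(1)] optH rH by simp
    show "\<And>a b. in_supp H a b \<Longrightarrow> s \<le> b" using ord_z_spec(1)[OF inv(1)] inv(2) by (simp add: s_def)
    show "1 \<le> r" "fps_nth (- g) 0 = 0" using r1 g by auto
    show "fps_nth (- g) 1 \<noteq> 0" by (rule g1)
  qed
  then obtain \<alpha> where \<alpha>: "\<alpha> + s + r \<le> m + 1" "in_supp F \<alpha> (m - \<alpha>)" using FH by metis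
  define d where "d = deg_y G"
  note bm = blow_z_measures[OF F(2), folded G_def m_def d_def]
  have d\<alpha>: "d \<le> \<alpha>" using bm(4)[OF \<alpha>(2)] \<alpha>(1) r1 by simp
  have r1d: "r1 \<le> d" using max_ord_y_props(3)[OF p G] r1 by (simp add: d_def)
  define S where "S = min_shade F"
  have S: "S + r + s = m" using opt_facts by (simp add: S_def)
  have h: "d \<le> S + 1" using d\<alpha> \<alpha>(1) S by linarith
  have sG: "min_shade G \<le> d - r1" using bm(1,5) r1 unfolding min_shade_def by linarith
  note db = defect_value_bounds[OF e]
  have cG: "complicacy_of \<epsilon> \<delta> G \<le> real (d - r1) - (if r1 = 0 then 1 + \<delta> else if r1 = 1 then \<epsilon> else 0)"
    using db(1)[OF sG, of r1] by (simp add: complicacy_of_def r1 d_def)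
  have cF1: "real S - \<epsilon> \<le> complicacy_of \<epsilon> \<delta> F"
    using db(3)[of r S] r1 by (simp add: complicacy_of_def S_def r_def)
  have cF2: "complicacy_of \<epsilon> \<delta> F = real S" if "2 \<le> r"
    using db(4)[OF that] by (simp add: complicacy_of_def S_def r_def)
  consider "r1 = 0" | "r1 = 1" "2 \<le> r" | "2 \<le> r1" "2 \<le> r" using r1 by linarith
  then show ?thesis unfolding G_def[symmetric]
  proof cases
    case 1
    then have "complicacy_of \<epsilon> \<delta> G \<le> real d - (1 + \<delta>)" using cG by simp
    then show "complicacy_of \<epsilon> \<delta> G < complicacy_of \<epsilon> \<delta> F" using cF1 h e by linarith
  next
    case 2
    then have "complicacy_of \<epsilon> \<delta> G \<le> real (d - 1) - \<epsilon>" using cG by simp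
    then show "complicacy_of \<epsilon> \<delta> G < complicacy_of \<epsilon> \<delta> F" using cF2 2 h e by linarith
  next
    case 3
    then have "complicacy_of \<epsilon> \<delta> G \<le> real (d - r1)" using cG by simp
    moreover have "d - r1 < S" using 3 h opt_facts(6) S_def by linarith
    ultimately show "complicacy_of \<epsilon> \<delta> G < complicacy_of \<epsilon> \<delta> F" using cF2 3 by linarith
  qed
qed

section \<open>Blowups along optimal coordinates\<close>

lemma recoord_keeps_initial_monomial:
  fixes F :: "'k::field fps fps"
  assumes g: "fps_nth g 0 = 0" "fps_nth g 1 = 0"
    and F: "\<And>a b. in_supp F a b \<Longrightarrow> (a, b) \<noteq> (d, s) \<Longrightarrow> d + s < a + b"
    and ab: "in_supp (recoord g F) a b" "(a, b) \<noteq> (d, s)"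
  shows "d + s < a + b"
proof (rule ccontr)
  assume neg: "\<not> d + s < a + b"
  have im: "i + j < d + s \<Longrightarrow> coeff2 (shift g F) i j = 0"
    "i + j = d + s \<Longrightarrow> coeff2 (shift g F) i j = coeff2 F d s * (of_nat (d choose i) * 0 ^ (d - i))" for i j
    using shift_initial_monomial[of 1 g F d s i j] g F by auto
  have in_supp: "coeff2 (shift g F) a b \<noteq> 0" using ab(1) unfolding in_supp_recoord by (simp add: in_supp_def)
  then have eq: "a + b = d + s" using im(1)[of a b] neg by linarith
  then have "coeff2 F d s * (of_nat (d choose a) * 0 ^ (d - a)) \<noteq> 0" using in_supp im(2) by simp
  then have "a \<le> d" "d - a = 0" by (auto simp: binomial_eq_0 not_less intro!: leI)
  then show False using eq ab(2) by auto
qed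

text \<open>
  A shift with linear term creates an edge of slope one that ends at abscissa $0$ or $1$. If the shift is optimal,
  then this abscissa is the maximal \<open>ord_y\<close>; the only possible exception, end at $1$ while the maximal
  \<open>ord_y\<close> is $0$, is excluded by \<open>hensel_ord_y\<close>.
\<close>

lemma recoord_slope_one:
  fixes F :: "'k::alg_closed_field fps fps"
  assumes p: "prime CHAR('k)" and nd: "nondegenerate F" and g: "g \<in> optimal_shifts F" "fps_nth g 1 \<noteq> 0"
    and init: "\<And>a b. in_supp F a b \<Longrightarrow> (a, b) \<noteq> (deg_y F, ord_z F) \<Longrightarrow> deg_y F + ord_z F < a + b"
  shows "updent (recoord g F) = deg_y F - max_ord_y F"
proof -
  define d where "d = deg_y F"
  define s where "s = ord_z F"
  define r where "r = max_ord_y F"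
  define H where "H = recoord g F"
  have F: "off_powers F" "F \<noteq> 0" and d2: "2 \<le> d" using nd by (auto simp: nondegenerate_def d_def)
  have g0: "fps_nth g 0 = 0" and oH: "ord_y H = r" using g(1) by (auto simp: optimal_shifts_def H_def r_def)
  have ds: "in_supp F d s" using ord_z_spec(2)[OF F(2)] by (simp add: d_def s_def)
  have init': "in_supp F a b \<Longrightarrow> (a, b) \<noteq> (d, s) \<Longrightarrow> 1 * d + s < 1 * a + b" for a b
    using init by (simp add: d_def s_def)
  have gi: "i < 1 \<Longrightarrow> fps_nth g i = 0" for i using g0 by simp
  note edge = recoord_edge[OF F(1) zero_less_one gi g(2) ds init', folded H_def, simplified]
  note inv = recoord_invariants[OF p F g0, folded H_def d_def s_def]
  have dsH: "in_supp H d s" "\<And>i. in_supp H i s \<Longrightarrow> d \<le> i" "\<And>i j. in_supp H i j \<Longrightarrow> s \<le> j"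
    using ord_z_spec[OF inv(1)] inv(2,3) by auto
  have rle: "r \<le> i" if "in_supp H i j" for i j using ord_y_spec(2)[OF inv(1) that] oH by simp
  obtain a where a: "a = r" "a \<le> 1" "in_supp H a (d + s - a)"
  proof (cases "in_supp H 0 (d + s)")
    case True
    then show ?thesis using that[of 0] rle by force
  next
    case False
    then have 1: "CHAR('k) dvd d + s" "in_supp H 1 (d + s - 1)" using edge(2) by auto
    have "1 \<le> r" unfolding r_def
      by (rule hensel_ord_y[OF p F(1) ds _ 1(1)]) (use init' d2 in auto)
    then show ?thesis using that[of 1] rle[OF 1(2)] 1(2) by force
  qed
  have ad: "a < d" using a d2 by simp
  have e: "(d + s - a) - s = d - a" using ad by simp
  have l: "d + s \<le> i + j" if "in_supp H i j" for i j using edge(1)[OF that] by simp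
  have "updent H = d - a"
  proof (rule second_vertex_eqI(1)[where s = s and b = "d + s - a"])
    show "in_supp H d s" "\<And>i j. in_supp H i j \<Longrightarrow> s \<le> j" "\<And>i. in_supp H i s \<Longrightarrow> d \<le> i" using dsH by blast+
    show "in_supp H a (d + s - a)" "a < d" "s < d + s - a" using a ad by auto
    fix i j assume ij: "in_supp H i j"
    have "(d - a) * (d + s) \<le> (d - a) * (i + j)" using l[OF ij] by simp
    then show "(d + s - a - s) * d + (d - a) * s \<le> (d + s - a - s) * i + (d - a) * j"
      unfolding e by (simp add: distrib_left)
    assume "i < a"
    then show "(d + s - a - s) * d + (d - a) * s < (d + s - a - s) * i + (d - a) * j"
      using rle[OF ij] a by simp
  qed
  then show ?thesis using a by (simp add: H_def d_def r_def)
qed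

text \<open>
  The height after the blowup is at most the shade before it, and complicacy is monotone in this
  comparison by \<open>defect_value_bounds\<close>. Equality forces the lowest form to be the monomial at $(d,s)$.
\<close>

theorem decrease_z_keeping:
  fixes F :: "'k::alg_closed_field fps fps"
  assumes p: "prime CHAR('k)" and nd: "nondegenerate F" and opt: "ord_y F = max_ord_y F"
    and e: "0 < \<epsilon>" "\<epsilon> < \<delta>" "\<delta> < 1"
  shows "complicacy_of \<epsilon> \<delta> (blow_z F) < complicacy_of \<epsilon> \<delta> F \<or>
    (complicacy_of \<epsilon> \<delta> (blow_z F) = complicacy_of \<epsilon> \<delta> F \<and> min_shade (blow_z F) \<noteq> 0 \<and>
     min_updent (blow_z F) = min_updent F \<and> max_indent (blow_z F) < max_indent F)"
proof -
  have F: "off_powers F" "F \<noteq> 0" using nd by (auto simp: nondegenerate_def)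
  define G where "G = blow_z F"
  have G: "off_powers G" "G \<noteq> 0" unfolding G_def by (rule off_powers_blow_z[OF F(1)], rule blow_z_ne_0[OF F(2)])
  define m where "m = ord F"
  define s where "s = ord_z F"
  define d where "d = deg_y F"
  define r where "r = max_ord_y F"
  define S where "S = min_shade F"
  define d' where "d' = deg_y G"
  note opt_facts = optimal_facts[OF p nd opt, folded m_def s_def d_def r_def S_def]
  note bm = blow_z_measures[OF F(2), folded G_def m_def d'_def]
  have trX: "recoord (fps_X * g) F \<noteq> 0" for g by (rule recoord_invariants(1)[OF p F]) simp
  have rG: "max_ord_y G = r"
  proof (rule antisym)
    obtain g where g: "g \<in> optimal_shifts G" using max_ord_y_props(1)[OF p G] by blast
    then have "ord_y (recoord (fps_X * g) F) = max_ord_y G" using optimal_shifts_blow_z(2)[OF _ trX] unfolding G_def by blast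
    then show "max_ord_y G \<le> r" using max_ord_y_props(2)[OF p F, of "fps_X * g"] by (simp add: r_def)
    have "ord_y (recoord 0 G) = r" using opt by (simp add: recoord_0 G r_def) (simp add: G_def ord_y_blow_z F)
    then show "r \<le> max_ord_y G" using max_ord_y_props(2)[OF p G, of 0] by simp
  qed
  have sd': "s \<le> m - d'" "r \<le> d'" using ord_z_spec(1)[OF F(2) bm(2)] ord_y_spec(2)[OF F(2) bm(2)] opt
    by (auto simp: s_def r_def)
  have sG: "min_shade G \<le> d' - r" using bm(1,5) rG unfolding min_shade_def by linarith
  define v where "v = (if r = 0 then 1 + \<delta> else if r = 1 then \<epsilon> else (0::real))"
  have cG: "complicacy_of \<epsilon> \<delta> G \<le> real (d' - r) - v"
    using defect_value_bounds(1)[OF e sG, of r] by (simp add: complicacy_of_def rG d'_def v_def)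
  have cF: "real S - v \<le> complicacy_of \<epsilon> \<delta> F"
    using defect_value_bounds(2)[OF e, of S r] by (simp add: complicacy_of_def S_def r_def v_def)
  have dS: "d' - r \<le> S" using opt_facts sd' bm(3) by linarith
  have "complicacy_of \<epsilon> \<delta> G < complicacy_of \<epsilon> \<delta> F \<or>
    (complicacy_of \<epsilon> \<delta> G = complicacy_of \<epsilon> \<delta> F \<and> min_shade G \<noteq> 0 \<and>
     min_updent G = min_updent F \<and> max_indent G < max_indent F)"
  proof (cases "complicacy_of \<epsilon> \<delta> G < complicacy_of \<epsilon> \<delta> F")
    case False
    then have "real S \<le> real (d' - r)" using cG cF by linarith
    then have dS': "d' - r = S" using dS by simp
    have ceq: "complicacy_of \<epsilon> \<delta> G = complicacy_of \<epsilon> \<delta> F" using False cG cF dS' by linarith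
    have sne: "min_shade G \<noteq> 0"
      using complicacy_of_le_min_shade[OF e(1,2), of G] complicacy_pos[OF p nd opt e] ceq by auto
    have d's: "d' + s = m" using dS' opt_facts sd' by linarith
    have dd: "d' = d"
    proof -
      have "in_supp F d' s" using bm(2) d's by (metis add_diff_cancel_left')
      then have "d \<le> d'" using ord_z_spec(3)[OF F(2)] by (simp add: d_def s_def)
      then show ?thesis using opt_facts(2) d's by linarith
    qed
    have init: "d + s < a + b" if ab: "in_supp F a b" "(a, b) \<noteq> (d, s)" for a b
    proof (rule ccontr)
      assume "\<not> d + s < a + b"
      then have abm: "a + b = m" using ord_spec(2)[OF F(2) ab(1)] d's dd by (simp add: m_def)
      then have "d \<le> a" "s \<le> b" using bm(4)[OF ab(1)] dd ord_z_spec(1)[OF F(2) ab(1)] by (auto simp: m_def s_def)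
      then show False using abm ab(2) d's dd by auto
    qed
    have init': "in_supp F a b \<Longrightarrow> (a, b) \<noteq> (deg_y F, ord_z F) \<Longrightarrow> deg_y F + ord_z F < a + b" for a b
      using init by (simp add: d_def s_def)
    have dent: "updent (recoord g F) < indent (recoord g F)" "updent (blow_z (recoord g F)) = updent (recoord g F)"
      "indent (blow_z (recoord g F)) = indent (recoord g F) - updent (recoord g F)" "0 < updent (recoord g F)"
      if g: "fps_nth g 0 = 0" "fps_nth g 1 = 0" for g
    proof -
      note inv = recoord_invariants[OF p F g(1)]
      note lt = nondegenerate_lt[OF nd g(1) inv(1)]
      have i: "deg_y (recoord g F) + ord_z (recoord g F) < a + b"
        if "in_supp (recoord g F) a b" "(a, b) \<noteq> (deg_y (recoord g F), ord_z (recoord g F))" for a b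
        using recoord_keeps_initial_monomial[OF g init'] that unfolding inv by blast
      show "updent (recoord g F) < indent (recoord g F)" "updent (blow_z (recoord g F)) = updent (recoord g F)"
        "indent (blow_z (recoord g F)) = indent (recoord g F) - updent (recoord g F)"
        using blow_z_dent[OF inv(1) lt i] by blast+
      show "0 < updent (recoord g F)" by (rule second_vertex(1)[OF inv(1) lt])
    qed
    have optG: "fps_X * g \<in> optimal_shifts F" "recoord g G = blow_z (recoord (fps_X * g) F)"
        "fps_nth (fps_X * g) 0 = 0" "fps_nth (fps_X * g) 1 = 0"
      if g: "g \<in> optimal_shifts G" for g
    proof -
      have g0: "fps_nth g 0 = 0" using g optimal_shifts_blow_z(1) unfolding G_def by blast
      show "recoord g G = blow_z (recoord (fps_X * g) F)" unfolding G_def by (rule recoord_blow_z[OF g0])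
      have "ord_y (recoord (fps_X * g) F) = max_ord_y G" using g optimal_shifts_blow_z(2)[OF _ trX] unfolding G_def by blast
      then show "fps_X * g \<in> optimal_shifts F" using rG by (simp add: optimal_shifts_def r_def)
      show "fps_nth (fps_X * g) 0 = 0" "fps_nth (fps_X * g) 1 = 0" using g0 by simp_all
    qed
    have opt0: "0 \<in> optimal_shifts F" "0 \<in> optimal_shifts G"
      using opt rG ord_y_blow_z[OF F(2)] by (simp_all add: optimal_shifts_def recoord_0 F G r_def) (simp add: G_def)
    have u_le: "min_updent G \<le> min_updent F"
    proof -
      obtain g where g: "g \<in> optimal_shifts F" "updent (recoord g F) = min_updent F"
        using min_updent_props(1)[OF p F] by blast
      have g0: "fps_nth g 0 = 0" using g(1) by (simp add: optimal_shifts_def)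
      show ?thesis
      proof (cases "fps_nth g 1 = 0")
        case True
        define g' where "g' = fps_shift 1 g"
        have gX: "g = fps_X * g'" using g0 True
          by (intro fps_ext) (auto simp: g'_def not_less Suc_le_eq le_Suc_eq gr0_conv_Suc)
        have g'0: "fps_nth g' 0 = 0" using True by (simp add: g'_def)
        have trg: "recoord g' G = blow_z (recoord g F)" unfolding G_def gX by (rule recoord_blow_z[OF g'0])
        have "ord_y (recoord g' G) = r"
          using g(1) trX[of g'] unfolding trg by (simp add: ord_y_blow_z gX optimal_shifts_def r_def)
        then have "g' \<in> optimal_shifts G" using g'0 rG by (simp add: optimal_shifts_def)
        then have "min_updent G \<le> updent (recoord g' G)" by (rule min_updent_props(2)[OF p G])
        then show ?thesis using dent(2)[OF g0 True] g(2) trg by simp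
      next
        case False
        \<comment> \<open>Then \<open>g\<close> is no better than the zero shift.\<close>
        have "min_updent F = d - r" using recoord_slope_one[OF p nd g(1) False init'] g(2) by (simp add: d_def r_def)
        moreover have "updent F \<le> d - r"
        proof -
          have lt: "ord_y F < deg_y F" using opt_facts opt by (simp add: r_def d_def)
          note sv = second_vertex[OF F(2) lt]
          have "r \<le> d - updent F" using ord_y_spec(2)[OF F(2) sv(4)] opt by (simp add: r_def d_def)
          then show ?thesis using sv(2) by (simp add: d_def)
        qed
        moreover have "min_updent G \<le> updent G" using min_updent_props(2)[OF p G opt0(2)] by (simp add: recoord_0 G)
        moreover have "updent G = updent F" using dent(2)[of 0] by (simp add: recoord_0 F G_def)
        ultimately show ?thesis by simp
      qed
    qed
    have u_ge: "min_updent F \<le> min_updent G"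
    proof -
      obtain g where g: "g \<in> optimal_shifts G" "updent (recoord g G) = min_updent G"
        using min_updent_props(1)[OF p G] by blast
      have "min_updent F \<le> updent (recoord (fps_X * g) F)" by (rule min_updent_props(2)[OF p F optG(1)[OF g(1)]])
      then show ?thesis using g(2) dent(2)[OF optG(3,4)[OF g(1)]] optG(2)[OF g(1)] by simp
    qed
    have u: "min_updent G = min_updent F" using u_le u_ge by simp
    obtain N where N: "\<And>g. fps_nth g 0 = 0 \<Longrightarrow> indent (recoord g F) \<le> N" using indent_bounded[OF p nd] by blast
    have NF: "indent (recoord g F) \<le> N" if "g \<in> optimal_shifts F" for g using N that by (simp add: optimal_shifts_def)
    have NG: "indent (recoord g G) \<le> N" if "g \<in> optimal_shifts G" for g
      using dent(3)[OF optG(3,4)[OF that]] optG(2)[OF that] NF[OF optG(1)[OF that]] by simp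
    obtain g where g: "g \<in> optimal_shifts G" "updent (recoord g G) = min_updent G" "indent (recoord g G) = max_indent G"
      using max_indent_props(1)[OF p G NG] by blast
    note gd = dent[OF optG(3,4)[OF g(1)]]
    have upd: "updent (recoord (fps_X * g) F) = min_updent F" using g(2) u gd(2) optG(2)[OF g(1)] by simp
    have "indent (recoord (fps_X * g) F) \<le> max_indent F"
      by (rule max_indent_props(2)[where N = N, OF p F]) (use NF optG(1)[OF g(1)] upd in auto)
    moreover have "max_indent G = indent (recoord (fps_X * g) F) - updent (recoord (fps_X * g) F)"
      using g(3) gd(3) optG(2)[OF g(1)] by simp
    ultimately have "max_indent G < max_indent F" using gd(1,4) by linarith
    then show ?thesis using ceq sne u by blast
  qed blast
  then show ?thesis unfolding G_def .
qed

lemma represents_recoord: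
  fixes F :: "'k::alg_closed_field fps fps"
  assumes p: "prime CHAR('k)" and rep: "represents a h f F" and g: "fps_nth g 0 = 0"
  shows "represents a h f (recoord g F)"
proof -
  have F: "off_powers F" "F \<noteq> 0" using rep by (auto simp: represents_def)
  have 1: "recoord g' F = recoord (g' - g) (recoord g F)" "recoord g' (recoord g F) = recoord (g' + g) F" if "fps_nth g' 0 = 0" for g'
    using that g by (simp_all add: recoord_recoord p)
  have "\<exists>g'. fps_nth g' 0 = 0 \<and> newton_polygon (expansion a c f) = newton_polygon (recoord g' (recoord g F))"
    if "c \<in> subordinate h" for c
  proof -
    obtain g' where g': "fps_nth g' 0 = 0" "newton_polygon (expansion a c f) = newton_polygon (recoord g' F)"
      using rep \<open>c \<in> subordinate h\<close> unfolding represents_def by blast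
    show ?thesis by (rule exI[of _ "g' - g"]) (use g' g 1(1)[OF g'(1)] in simp)
  qed
  moreover have "\<exists>c\<in>subordinate h. expansion a c f = recoord g' (recoord g F)" if "fps_nth g' 0 = 0" for g'
    using rep that g unfolding represents_def 1(2)[OF that] by simp
  ultimately show ?thesis unfolding represents_def using recoord_invariants(1)[OF p F g] by simp
qed

section \<open>Germs of polynomials\<close>

definition ring_morphism :: "('a::comm_ring_1 \<Rightarrow> 'b::comm_ring_1) \<Rightarrow> bool" where
  "ring_morphism L \<longleftrightarrow> L 1 = 1 \<and> (\<forall>x y. L (x + y) = L x + L y) \<and> (\<forall>x y. L (x * y) = L x * L y)"

lemma ring_morphismD:
  assumes "ring_morphism L"
  shows "L 0 = 0" "L 1 = 1" "L (x + y) = L x + L y" "L (x * y) = L x * L y" "L (x ^ n) = L x ^ n"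
proof -
  show add: "L (x + y) = L x + L y" for x y using assms by (simp add: ring_morphism_def)
  show mult: "L (x * y) = L x * L y" for x y using assms by (simp add: ring_morphism_def)
  show 1: "L 1 = 1" using assms by (simp add: ring_morphism_def)
  show "L 0 = 0" using add[of 0 0] by simp
  show "L (x ^ n) = L x ^ n" by (induction n) (simp_all add: 1 mult)
qed

definition eval1 :: "('k::zero \<Rightarrow> 'r::comm_ring_1) \<Rightarrow> 'k poly \<Rightarrow> 'r \<Rightarrow> 'r" where
  "eval1 \<iota> q t = poly (map_poly \<iota> q) t"

lemma eval2_eval1: "eval2 \<iota> g s t = eval1 (\<lambda>q. eval1 \<iota> q t) g s"
  by (simp add: eval2_def eval1_def)

lemma eval1_0 [simp]: "eval1 \<iota> 0 t = 0"
  by (simp add: eval1_def)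

lemma eval1_pCons: "\<iota> 0 = 0 \<Longrightarrow> eval1 \<iota> (pCons c q) t = \<iota> c + t * eval1 \<iota> q t"
  by (simp add: eval1_def map_poly_pCons)

lemma ring_morphism_eval1:
  fixes \<iota> :: "'k::comm_ring_1 \<Rightarrow> 'r::comm_ring_1"
  assumes "ring_morphism \<iota>"
  shows "ring_morphism (\<lambda>q. eval1 \<iota> q t)"
proof -
  note h = ring_morphismD[OF assms]
  have add: "eval1 \<iota> (x + y) t = eval1 \<iota> x t + eval1 \<iota> y t" for x y
  proof -
    have "map_poly \<iota> (x + y) = map_poly \<iota> x + map_poly \<iota> y"
      by (intro poly_eqI) (simp add: coeff_map_poly h)
    then show ?thesis by (simp add: eval1_def)
  qed
  have smult: "eval1 \<iota> (smult c y) t = \<iota> c * eval1 \<iota> y t" for c y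
    by (simp add: eval1_def map_poly_smult h)
  have "eval1 \<iota> (x * y) t = eval1 \<iota> x t * eval1 \<iota> y t" for x y
    by (induction x) (simp_all add: add smult eval1_pCons h algebra_simps)
  moreover have "eval1 \<iota> 1 t = 1" by (simp add: eval1_pCons h one_pCons)
  ultimately show ?thesis using add by (simp add: ring_morphism_def)
qed

lemma eval1_hom:
  fixes \<iota> :: "'k::comm_ring_1 \<Rightarrow> 'r::comm_ring_1" and L :: "'r \<Rightarrow> 's::comm_ring_1"
  assumes "ring_morphism \<iota>" "ring_morphism L"
  shows "L (eval1 \<iota> q t) = eval1 (\<lambda>c. L (\<iota> c)) q (L t)"
  using ring_morphismD[OF assms(1)] ring_morphismD[OF assms(2)] by (induction q) (simp_all add: eval1_pCons)

lemma ring_morphism_eval2: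
  fixes \<iota> :: "'k::comm_ring_1 \<Rightarrow> 'r::comm_ring_1"
  shows "ring_morphism \<iota> \<Longrightarrow> ring_morphism (\<lambda>g. eval2 \<iota> g s t)"
  unfolding eval2_eval1 by (intro ring_morphism_eval1)

lemma eval2_hom:
  fixes \<iota> :: "'k::comm_ring_1 \<Rightarrow> 'r::comm_ring_1" and L :: "'r \<Rightarrow> 's::comm_ring_1"
  assumes "ring_morphism \<iota>" "ring_morphism L"
  shows "L (eval2 \<iota> g s t) = eval2 (\<lambda>c. L (\<iota> c)) g (L s) (L t)"
  unfolding eval2_eval1
  by (simp add: eval1_hom[OF ring_morphism_eval1[OF assms(1)] assms(2)] eval1_hom[OF assms])

lemma ring_morphism_const2: "ring_morphism (const2 :: 'k::comm_ring_1 \<Rightarrow> _)"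
  by (simp add: ring_morphism_def const2_hom)

lemma ring_morphism_const_poly: "ring_morphism (\<lambda>x::'k::comm_ring_1. [:[:x:]:])"
  by (simp add: ring_morphism_def one_pCons)

lemma ring_morphism_germ: "ring_morphism (germ a)"
  unfolding germ_def by (rule ring_morphism_eval2[OF ring_morphism_const2])

lemma ring_morphism_subst2: "Y \<in> max_ideal \<Longrightarrow> Z \<in> max_ideal \<Longrightarrow> ring_morphism (\<lambda>F. subst2 F Y Z)"
  by (simp add: ring_morphism_def subst2_simps subst2_add subst2_mult)

lemma eval2_const [simp]: "\<iota> 0 = 0 \<Longrightarrow> eval2 \<iota> [:[:c:]:] s t = \<iota> c"
  by (simp add: eval2_eval1 eval1_pCons)

lemma eval2_y: "ring_morphism \<iota> \<Longrightarrow> eval2 \<iota> poly_y s t = s"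
  by (simp add: eval2_eval1 eval1_pCons poly_y_def ring_morphismD one_pCons)

lemma eval2_z: "ring_morphism \<iota> \<Longrightarrow> eval2 \<iota> poly_z s t = t"
  by (simp add: eval2_eval1 eval1_pCons poly_z_def ring_morphismD one_pCons)

lemma germ_simps:
  "germ a [:[:c:]:] = const2 c" "germ a poly_y = const2 (fst a) + fps_y"
  "germ a poly_z = const2 (snd a) + fps_z"
  by (simp_all add: germ_def eval2_y eval2_z ring_morphism_const2 const2_hom)

lemma germ_total_transform:
  fixes f :: "'k::comm_ring_1 poly poly"
  assumes m: "germ b (fst (chart_map \<kappa>)) \<in> max_ideal" "germ b (snd (chart_map \<kappa>)) \<in> max_ideal"
  shows "germ b (total_transform \<kappa> a f) =
    subst2 (germ a f) (germ b (fst (chart_map \<kappa>))) (germ b (snd (chart_map \<kappa>)))"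
proof -
  have "germ b (total_transform \<kappa> a f) = eval2 const2 f
      (const2 (fst a) + germ b (fst (chart_map \<kappa>))) (const2 (snd a) + germ b (snd (chart_map \<kappa>)))"
    unfolding total_transform_def
    by (simp add: eval2_hom[OF ring_morphism_const_poly ring_morphism_germ] germ_simps ring_morphismD[OF ring_morphism_germ])
  moreover have "subst2 (germ a f) (germ b (fst (chart_map \<kappa>))) (germ b (snd (chart_map \<kappa>))) = \<dots>"
    unfolding germ_def[of a]
    by (simp add: eval2_hom[OF ring_morphism_const2 ring_morphism_subst2[OF m]] subst2_add subst2_simps[OF m])
  ultimately show ?thesis by simp
qed

lemma coeff2_germ_origin: "coeff2 (germ (0, 0) g) i j = coeff (coeff g i) j"
  for g :: "'k::comm_ring_1 poly poly"
proof -
  have 1: "coeff2 (eval1 const2 q fps_z) i j = (if i = 0 then coeff q j else 0)" for q :: "'k poly" and i j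
  proof (induction q arbitrary: j)
    case (pCons c q)
    show ?case using coeff2_monom_mult[of 0 1 "eval1 const2 q fps_z" i j]
      by (cases j) (auto simp: eval1_pCons const2_hom coeff2_const2 pCons.IH)
  qed simp
  have "eval1 const2 (0 :: 'k poly) fps_z = 0" by simp
  then have "coeff2 (eval1 (\<lambda>q. eval1 const2 q fps_z) g fps_y) i j = coeff (coeff g i) j"
  proof (induction g arbitrary: i)
    case (pCons q g)
    show ?case using coeff2_monom_mult[of 1 0 "eval1 (\<lambda>q. eval1 const2 q fps_z) g fps_y" i j]
      by (cases i) (auto simp: eval1_pCons 1 pCons)
  qed simp
  then show ?thesis by (simp add: germ_def eval2_eval1 const2_hom)
qed

definition translate :: "'k \<times> 'k \<Rightarrow> 'k::comm_ring_1 poly poly \<Rightarrow> 'k poly poly" where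
  "translate a f = eval2 (\<lambda>x. [:[:x:]:]) f ([:[:fst a:]:] + poly_y) ([:[:snd a:]:] + poly_z)"

lemma ring_morphism_translate: "ring_morphism (translate a)"
  unfolding translate_def by (rule ring_morphism_eval2[OF ring_morphism_const_poly])

lemma translate_simps:
  "translate a [:[:c:]:] = [:[:c:]:]" "translate a poly_y = [:[:fst a:]:] + poly_y"
  "translate a poly_z = [:[:snd a:]:] + poly_z"
  by (simp_all add: translate_def eval2_y eval2_z ring_morphism_const_poly)

lemma germ_translate: "germ (0, 0) (translate a f) = germ a f"
proof -
  have "germ (0, 0) (translate a f) = eval2 (\<lambda>c. germ (0, 0) [:[:c:]:]) f
      (germ (0, 0) ([:[:fst a:]:] + poly_y)) (germ (0, 0) ([:[:snd a:]:] + poly_z))"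
    unfolding translate_def by (rule eval2_hom[OF ring_morphism_const_poly ring_morphism_germ])
  then show ?thesis
    by (simp add: germ_simps ring_morphismD[OF ring_morphism_germ] const2_hom) (simp add: germ_def)
qed

lemma eval2_id: "eval2 (\<lambda>x. [:[:x:]:]) f poly_y poly_z = f"
  for f :: "'k::comm_ring_1 poly poly"
proof -
  have 1: "eval1 (\<lambda>x. [:[:x:]:]) q poly_z = [:q:]" for q :: "'k poly"
    by (induction q) (simp_all add: eval1_pCons poly_z_def)
  show ?thesis unfolding eval2_eval1 1
    by (induction f) (simp_all add: eval1_pCons poly_y_def)
qed

lemma translate_inverse:
  fixes f :: "'k::comm_ring_1 poly poly"
  shows "translate (- fst a, - snd a) (translate a f) = f"
proof -
  have "translate (- fst a, - snd a) (translate a f) =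
    eval2 (\<lambda>c. translate (- fst a, - snd a) [:[:c:]:]) f
      (translate (- fst a, - snd a) ([:[:fst a:]:] + poly_y)) (translate (- fst a, - snd a) ([:[:snd a:]:] + poly_z))"
    unfolding translate_def[of a] by (rule eval2_hom[OF ring_morphism_const_poly ring_morphism_translate])
  also have "\<dots> = eval2 (\<lambda>c. [:[:c:]:]) f poly_y poly_z"
  proof -
    have cancel: "[:[:c:]:] + ([:[:- c:]:] + P) = P" for c :: 'k and P :: "'k poly poly"
      by (simp flip: add.assoc)
    show ?thesis by (simp add: translate_simps ring_morphismD[OF ring_morphism_translate] cancel)
  qed
  also have "\<dots> = f" by (rule eval2_id)
  finally show ?thesis .
qed

text \<open>
  The germ at $a$ is the translated polynomial; if its exponents lie in $p\mathbb{N}^2$, then it is a sum of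
  $p$-th powers of monomials. Translating back is a ring morphism.
\<close>

lemma germ_power_imp_power:
  fixes f :: "'k::alg_closed_field poly poly"
  assumes p: "prime CHAR('k)" and red0: "mod_powers (germ a f) = 0"
  shows "f \<in> range (\<lambda>q. q ^ CHAR('k))"
proof -
  define p where "p = CHAR('k)"
  have p0: "p > 0" using p by (simp add: p_def prime_gt_0_nat)
  have char: "prime CHAR('k poly poly)" "p = CHAR('k poly poly)" using p by (simp_all add: p_def)
  define PW where "PW = range (\<lambda>q :: 'k poly poly. q ^ p)"
  have sumPW: "sum F A \<in> PW" if F: "\<And>x. x \<in> A \<Longrightarrow> F x \<in> PW" for F :: "nat \<Rightarrow> 'k poly poly" and A
  proof -
    have "\<forall>x\<in>A. \<exists>q. F x = q ^ p" using F by (auto simp: PW_def)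
    then obtain q where "\<And>x. x \<in> A \<Longrightarrow> F x = q x ^ p" by metis
    then have "sum F A = sum q A ^ p" by (simp add: freshmans_dream_sum[OF char])
    then show ?thesis by (simp add: PW_def)
  qed
  define g where "g = translate a f"
  have z: "coeff (coeff g i) j = 0" if "\<not> (p dvd i \<and> p dvd j)" for i j
  proof -
    have "coeff2 (mod_powers (germ a f)) i j = 0" by (simp add: red0)
    then have "coeff2 (germ a f) i j = 0" using that unfolding coeff2_mod_powers p_def by presburger
    then show ?thesis using coeff2_germ_origin[of g i j] unfolding g_def germ_translate by simp
  qed
  have mon: "monom (monom (coeff (coeff g i) j) j) i \<in> PW" for i j
  proof (cases "p dvd i \<and> p dvd j")
    case False
    then have "monom (monom (coeff (coeff g i) j) j) i = 0 ^ p" using z p0 by (simp add: power_0_left)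
    then show ?thesis unfolding PW_def by blast
  next
    case True
    obtain c where c: "c ^ p = coeff (coeff g i) j" using nth_root_exists[OF p0] by blast
    have "monom (monom (coeff (coeff g i) j) j) i = monom (monom c (j div p)) (i div p) ^ p"
      using True by (simp add: monom_power c)
    then show ?thesis unfolding PW_def by blast
  qed
  have "monom (coeff g i) i \<in> PW" for i
  proof -
    have "monom (coeff g i) i = monom (\<Sum>j\<le>degree (coeff g i). monom (coeff (coeff g i) j) j) i"
      by (simp add: poly_as_sum_of_monoms)
    also have "\<dots> = (\<Sum>j\<le>degree (coeff g i). monom (monom (coeff (coeff g i) j) j) i)"
      by (simp add: monom_sum)
    also have "\<dots> \<in> PW" by (rule sumPW) (rule mon)
    finally show ?thesis .
  qed
  then have "(\<Sum>i\<le>degree g. monom (coeff g i) i) \<in> PW" by (intro sumPW)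
  then have "g \<in> PW" by (simp add: poly_as_sum_of_monoms)
  then obtain q where "g = q ^ p" by (auto simp: PW_def)
  then have "f = translate (- fst a, - snd a) q ^ p"
    using translate_inverse[of a f] by (simp add: g_def ring_morphismD[OF ring_morphism_translate])
  then show ?thesis by (auto simp: p_def)
qed

lemma corner_monomial:
  fixes F :: "'k::field fps fps"
  assumes F: "F \<noteq> 0" and in_supp: "in_supp F (ord_y F) (ord_z F)"
  obtains u where "u dvd 1" "F = fps_y ^ ord_y F * fps_z ^ ord_z F * u"
proof -
  define u where "u = Abs_fps (\<lambda>i. Abs_fps (\<lambda>j. coeff2 F (i + ord_y F) (j + ord_z F)))"
  have cu: "coeff2 u i j = coeff2 F (i + ord_y F) (j + ord_z F)" for i j by (simp add: u_def coeff2_def)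
  have "F = fps_y ^ ord_y F * fps_z ^ ord_z F * u"
  proof (rule fps2_eqI)
    fix i j
    have "coeff2 F i j = 0" if "\<not> (ord_y F \<le> i \<and> ord_z F \<le> j)"
      using ord_y_spec(2)[OF F, of i j] ord_z_spec(1)[OF F, of i j] that by (auto simp: in_supp_def)
    then show "coeff2 F i j = coeff2 (fps_y ^ ord_y F * fps_z ^ ord_z F * u) i j"
      by (auto simp: coeff2_monom_mult cu)
  qed
  moreover have "u dvd 1" using in_supp by (simp add: unit2_iff cu in_supp_def)
  ultimately show ?thesis using that by blast
qed

lemma degree_one_monomial:
  fixes f :: "'k::alg_closed_field poly poly"
  assumes p: "prime CHAR('k)" and c: "(Y, Z) \<in> local_coordinates" and F: "F = expansion a (Y, Z) f" "F \<noteq> 0"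
    and d: "deg_y F = 1"
  shows "monomial_at a f"
proof -
  note m = local_coordinates_max[OF c]
  note os = ord_z_spec[OF F(2), unfolded d]
  define s where "s = ord_z F"
  define H where "H = Abs_fps (\<lambda>i. Abs_fps (\<lambda>j. coeff2 F i (j + s)))"
  have cH: "coeff2 H i j = coeff2 F i (j + s)" for i j by (simp add: H_def coeff2_def)
  have FH: "F = fps_z ^ s * H"
  proof (rule fps2_eqI)
    fix i j
    have "coeff2 F i j = 0" if "\<not> s \<le> j" using os(1)[of i j] that by (auto simp: in_supp_def s_def)
    then show "coeff2 F i j = coeff2 (fps_z ^ s * H) i j"
      using coeff2_monom_mult[of 0 s H i j] by (auto simp: cH)
  qed
  have "coeff2 H 0 0 = 0" using os(3)[of 0] by (auto simp: cH in_supp_def s_def)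
  moreover have "coeff2 H 1 0 \<noteq> 0" using os(2) by (simp add: cH in_supp_def s_def)
  ultimately have "(H, fps_z) \<in> local_coordinates"
    by (simp add: local_coordinates_iff max_ideal_iff jac_def coeff2_fps_z)
  then have c': "(subst2 H Y Z, Z) \<in> local_coordinates"
    using local_coordinates_subst2[OF c, of H fps_z] by (simp add: subst2_simps[OF m])
  note m' = local_coordinates_max[OF c']
  have "expansion a (subst2 H Y Z, Z) f = fps_y ^ 1 * fps_z ^ s"
  proof (rule expansion_eqI[OF p c'])
    show "off_powers (fps_y ^ 1 * fps_z ^ s :: 'k fps fps)"
      unfolding off_powers_def coeff2_monom using CHAR_not_1[where 'a='k] by auto
    have "subst2 (fps_y ^ 1 * fps_z ^ s) (subst2 H Y Z) Z = subst2 F Y Z"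
      unfolding FH subst2_monom[OF m'] by (simp add: subst2_mult m subst2_simps[OF m])
    then show "mod_powers (subst2 (fps_y ^ 1 * fps_z ^ s) (subst2 H Y Z) Z) = mod_powers (germ a f)"
      using expansion_props(2)[OF p c] F(1) by simp
  qed
  then have "expansion a (subst2 H Y Z, Z) f = fps_y ^ 1 * fps_z ^ s * 1" by simp
  then show ?thesis unfolding monomial_at_def using c' one_dvd by blast
qed

lemma nondegenerate_expansion:
  fixes f :: "'k::alg_closed_field poly poly"
  assumes p: "prime CHAR('k)" and nm: "\<not> monomial_at a f"
    and rep: "represents a h f F" and c: "c \<in> subordinate h" "F = expansion a c f"
  shows "nondegenerate F"
proof -
  have off: "off_powers F" and F: "F \<noteq> 0" using rep by (auto simp: represents_def)
  have corner: "\<not> in_supp (recoord g F) (ord_y (recoord g F)) (ord_z (recoord g F))" if g: "fps_nth g 0 = 0" for g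
  proof
    assume "in_supp (recoord g F) (ord_y (recoord g F)) (ord_z (recoord g F))"
    then obtain u where u: "u dvd 1" "recoord g F = fps_y ^ ord_y (recoord g F) * fps_z ^ ord_z (recoord g F) * u"
      using corner_monomial[OF recoord_invariants(1)[OF p off F g]] by blast
    obtain c1 where c1: "c1 \<in> subordinate h" "expansion a c1 f = recoord g F"
      using rep g unfolding represents_def by blast
    then have "c1 \<in> local_coordinates" by (auto simp: subordinate_def)
    then have "monomial_at a f" unfolding monomial_at_def using c1(2) u by metis
    then show False using nm by blast
  qed
  have "deg_y F \<noteq> 1"
  proof
    assume "deg_y F = 1"
    moreover obtain Y Z where "c = (Y, Z)" "(Y, Z) \<in> local_coordinates" using c(1) by (auto simp: subordinate_def)
    ultimately have "monomial_at a f" using degree_one_monomial[OF p _ _ F] c(2) by blast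
    then show False using nm by blast
  qed
  moreover have "deg_y F \<noteq> 0"
    using corner[of 0] recoord_0[OF off] ord_z_spec(2)[OF F] ord_y_le_deg_y[OF F] by (metis fps_zero_nth le_zero_eq)
  ultimately show ?thesis using off F corner by (auto simp: nondegenerate_def)
qed

section \<open>The blowup in local coordinates\<close>

text \<open>
  Both charts are instances of one situation: the two coordinate functions pull back to $ev$ and $ew$ with $e$ the
  equation of the exceptional divisor, and $w(b)v-v(b)w$ completes $e$ to local coordinates at $b$.
  Only this is used in the sequel, so that the charts need not be distinguished.
\<close>

lemma exceptional_chart:
  fixes b :: "'k::field \<times> 'k"
  assumes "b \<in> exc_points \<kappa>"
  obtains v w where "germ b (fst (chart_map \<kappa>)) = germ b (exc_equation \<kappa>) * v"
    "germ b (snd (chart_map \<kappa>)) = germ b (exc_equation \<kappa>) * w"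
    "germ b (exc_equation \<kappa>) \<in> max_ideal"
    "jac (const2 (coeff2 w 0 0) * v - const2 (coeff2 v 0 0) * w) (germ b (exc_equation \<kappa>)) \<noteq> 0"
proof -
  have ring_morphism_id: "ring_morphism (\<lambda>x :: 'k. x)" by (simp add: ring_morphism_def)
  show ?thesis
  proof (cases \<kappa>)
    case Chart_Z
    then have b: "snd b = 0" using assms by (simp add: exc_points_def eval2_z ring_morphism_id)
    show ?thesis
    proof (rule that[of "const2 (fst b) + fps_y" 1])
      show "jac (const2 (coeff2 1 0 0) * (const2 (fst b) + fps_y) - const2 (coeff2 (const2 (fst b) + fps_y) 0 0) * 1)
        (germ b (exc_equation \<kappa>)) \<noteq> 0"
        by (simp add: Chart_Z germ_simps b jac_def coeff2_const2 coeff2_fps_y coeff2_fps_z coeff2_1 const2_hom)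
    qed (simp_all add: Chart_Z germ_simps b const2_hom ring_morphismD[OF ring_morphism_germ] mult.commute)
  next
    case Chart_Y
    then have b: "fst b = 0" using assms by (simp add: exc_points_def eval2_y ring_morphism_id)
    show ?thesis
    proof (rule that[of 1 "const2 (snd b) + fps_z"])
      show "jac (const2 (coeff2 (const2 (snd b) + fps_z) 0 0) * 1 - const2 (coeff2 1 0 0) * (const2 (snd b) + fps_z))
        (germ b (exc_equation \<kappa>)) \<noteq> 0"
        by (simp add: Chart_Y germ_simps b jac_def coeff2_const2 coeff2_fps_y coeff2_fps_z coeff2_1 const2_hom)
    qed (simp_all add: Chart_Y germ_simps b const2_hom ring_morphismD[OF ring_morphism_germ])
  qed
qed

lemma jac_linear:
  "jac (const2 x * V - const2 y * W) e = x * jac V e - y * jac W e"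
  for V W e :: "'k::comm_ring_1 fps fps"
  unfolding jac_def coeff2_diff coeff2_const2_mult by (simp add: algebra_simps)

text \<open>
  The situation of \<open>exceptional_chart\<close> is stable under changes of coordinates at the center, because the
  determinant gets multiplied by the Jacobian: modulo $e$, pulled back series are constant.
\<close>

lemma pulled_back_coordinates:
  fixes Y Z e v w :: "'k::field fps fps"
  assumes e: "e \<in> max_ideal"
    and j: "jac (const2 (coeff2 w 0 0) * v - const2 (coeff2 v 0 0) * w) e \<noteq> 0"
    and c: "(Y, Z) \<in> local_coordinates"
  obtains V W where "subst2 Y (e * v) (e * w) = e * V" "subst2 Z (e * v) (e * w) = e * W"
    "jac (const2 (coeff2 W 0 0) * V - const2 (coeff2 V 0 0) * W) e \<noteq> 0"
proof -
  note m = local_coordinates_max[OF c]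
  have ev: "e * v \<in> max_ideal" "e * w \<in> max_ideal" using e by (auto intro: max_ideal_ops)
  obtain A B where Y: "Y = A * fps_y + B * fps_z" and AB: "coeff2 A 0 0 = coeff2 Y 1 0" "coeff2 B 0 0 = coeff2 Y 0 1"
    using max_ideal_decomp[OF m(1)] by blast
  obtain C D where Z: "Z = C * fps_y + D * fps_z" and CD: "coeff2 C 0 0 = coeff2 Z 1 0" "coeff2 D 0 0 = coeff2 Z 0 1"
    using max_ideal_decomp[OF m(2)] by blast
  define \<phi> where "\<phi> F = subst2 F (e * v) (e * w)" for F
  define V where "V = \<phi> A * v + \<phi> B * w"
  define W where "W = \<phi> C * v + \<phi> D * w"
  have 1: "\<phi> Y = e * V" "\<phi> Z = e * W"
    unfolding Y Z V_def W_def \<phi>_def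
    by (simp_all add: subst2_add subst2_mult[OF ev] subst2_simps[OF ev] algebra_simps)
  have e0: "coeff2 e 0 0 = 0" using e by (simp add: max_ideal_iff)
  have \<phi>0: "coeff2 (\<phi> F) 0 0 = coeff2 F 0 0" for F unfolding \<phi>_def by (rule coeff2_subst2_00[OF ev])
  have \<phi>1: "coeff2 (\<phi> F) 1 0 = (coeff2 F 1 0 * coeff2 v 0 0 + coeff2 F 0 1 * coeff2 w 0 0) * coeff2 e 1 0"
    "coeff2 (\<phi> F) 0 1 = (coeff2 F 1 0 * coeff2 v 0 0 + coeff2 F 0 1 * coeff2 w 0 0) * coeff2 e 0 1" for F
    unfolding \<phi>_def coeff2_subst2_lin[OF ev] coeff2_mult_lin e0 by (simp_all add: algebra_simps)
  have "jac (const2 (coeff2 W 0 0) * V - const2 (coeff2 V 0 0) * W) e =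
    jac Y Z * jac (const2 (coeff2 w 0 0) * v - const2 (coeff2 v 0 0) * w) e"
    unfolding jac_linear unfolding jac_def V_def W_def coeff2_add coeff2_mult_lin coeff2_mult_00 \<phi>0 \<phi>1
      AB[symmetric] CD[symmetric]
    by algebra
  moreover have "jac Y Z \<noteq> 0" using c by (simp add: local_coordinates_iff)
  ultimately show ?thesis using that[OF 1[unfolded \<phi>_def]] j by simp
qed

lemma strict_transform_eq:
  fixes h :: "'k::field fps fps"
  assumes pb: "formal_pullback \<kappa> b h = germ b (exc_equation \<kappa>) * W"
    and nd: "\<not> germ b (exc_equation \<kappa>) dvd W" and e0: "germ b (exc_equation \<kappa>) \<noteq> 0"
  shows "strict_transform \<kappa> b h = W"
  unfolding strict_transform_def
proof (rule the_equality)
  define e where "e = germ b (exc_equation \<kappa>)"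
  show "\<exists>m. formal_pullback \<kappa> b h = germ b (exc_equation \<kappa>) ^ m * W \<and> \<not> germ b (exc_equation \<kappa>) dvd W"
    using pb nd by (intro exI[of _ 1]) simp
  fix h' assume "\<exists>m. formal_pullback \<kappa> b h = germ b (exc_equation \<kappa>) ^ m * h' \<and> \<not> germ b (exc_equation \<kappa>) dvd h'"
  then obtain m where m: "e * W = e ^ m * h'" "\<not> e dvd h'" using pb unfolding e_def by auto
  consider "m = 0" | "m = 1" | n where "m = Suc (Suc n)" by (metis One_nat_def not0_implies_Suc)
  then show "h' = W"
  proof cases
    case 1
    then show ?thesis using m by (metis dvd_triv_left mult_1 power_0)
  next
    case 2
    then show ?thesis using m e0 by (simp add: e_def)
  next
    case 3
    then have "e * W = e * (e * (e ^ n * h'))" using m by (simp add: mult.assoc)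
    then have "W = e * (e ^ n * h')" using e0 unfolding e_def by (simp only: mult_cancel_left) simp
    then show ?thesis using nd unfolding e_def by (metis dvd_triv_left)
  qed
qed

lemma expansion_transform:
  fixes f :: "'k::alg_closed_field poly poly"
  assumes p: "prime CHAR('k)" and c: "(Y, Z) \<in> local_coordinates" and c': "(y', z') \<in> local_coordinates"
    and m: "germ b (fst (chart_map \<kappa>)) \<in> max_ideal" "germ b (snd (chart_map \<kappa>)) \<in> max_ideal"
    and M: "M1 \<in> max_ideal" "M2 \<in> max_ideal"
    and pb: "formal_pullback \<kappa> b Y = subst2 M1 y' z'" "formal_pullback \<kappa> b Z = subst2 M2 y' z'"
    and off: "off_powers (subst2 (expansion a (Y, Z) f) M1 M2)"
  shows "expansion b (y', z') (total_transform \<kappa> a f) = subst2 (expansion a (Y, Z) f) M1 M2"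
proof (rule expansion_eqI[OF p c' off])
  define F where "F = expansion a (Y, Z) f"
  note mc = local_coordinates_max[OF c] and mc' = local_coordinates_max[OF c']
  have "subst2 (subst2 F M1 M2) y' z' = subst2 F (formal_pullback \<kappa> b Y) (formal_pullback \<kappa> b Z)"
    by (simp add: subst2_comp M mc' pb)
  also have "\<dots> = subst2 (subst2 F Y Z) (germ b (fst (chart_map \<kappa>))) (germ b (snd (chart_map \<kappa>)))"
    unfolding formal_pullback_def by (simp add: subst2_comp mc m)
  finally have "mod_powers (subst2 (subst2 F M1 M2) y' z') =
      mod_powers (subst2 (subst2 F Y Z) (germ b (fst (chart_map \<kappa>))) (germ b (snd (chart_map \<kappa>))))" by simp
  also have "\<dots> = mod_powers (subst2 (germ a f) (germ b (fst (chart_map \<kappa>))) (germ b (snd (chart_map \<kappa>))))"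
    by (rule mod_powers_subst2_cong[OF p m]) (simp add: F_def expansion_props[OF p c])
  also have "\<dots> = mod_powers (germ b (total_transform \<kappa> a f))" by (simp add: germ_total_transform[OF m])
  finally show "mod_powers (subst2 (subst2 (expansion a (Y, Z) f) M1 M2) y' z') = mod_powers (germ b (total_transform \<kappa> a f))"
    unfolding F_def .
qed

lemma invariant_decreases:
  fixes f f' :: "'k::alg_closed_field poly poly"
  assumes p: "prime CHAR('k)" and rep: "represents a h f F" and rep': "represents a' h' f' F'"
    and dec: "complicacy_of \<epsilon> \<delta> F' < complicacy_of \<epsilon> \<delta> F \<or>
      (complicacy_of \<epsilon> \<delta> F' = complicacy_of \<epsilon> \<delta> F \<and> min_shade F' \<noteq> 0 \<and>
        (min_updent F' < min_updent F \<or> (min_updent F' = min_updent F \<and> max_indent F' < max_indent F)))"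
  shows "if quadrant_at a' h' f'
    then complicacy_at \<epsilon> \<delta> a' h' f' < complicacy_at \<epsilon> \<delta> a h f
    else ((complicacy_at \<epsilon> \<delta> a' h' f', dent_at a' h' f'),
          (complicacy_at \<epsilon> \<delta> a h f, dent_at a h f)) \<in> lex_less"
  using dec represents_measures(2)[OF p rep, of \<epsilon> \<delta>] represents_measures(2)[OF p rep', of \<epsilon> \<delta>]
    represents_measures(3)[OF p rep] represents_measures(3,4)[OF p rep']
  by (auto simp: lex_less_def)

text \<open>
  Let the flag equation $h$ pull back to $eW$. If $W(b)\ne 0$, the induced flag is the exceptional divisor,
  and subtracting a constant multiple of $h$ from the first coordinate yields coordinates
  in which the blowup is $(yz,z)$. If $W(b)=0$, the induced flag is $W$, and the blowup is $(y,yz)$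
  in all subordinate coordinates, so that those of minimal \<open>updent\<close> may be chosen.
\<close>

theorem blowup_decrease:
  fixes f :: "'k::alg_closed_field poly poly"
  assumes p: "prime CHAR('k)" and e: "0 < \<epsilon>" "\<epsilon> < \<delta>" "\<delta> < 1"
    and h: "regular_parameter h" and f: "f \<notin> range (\<lambda>q. q ^ CHAR('k))"
    and nm: "\<not> monomial_at a f" and nq: "\<not> quasi_monomial_at a h f" and b: "b \<in> exc_points \<kappa>"
  shows "\<exists>F F'. represents a h f F \<and> represents b (induced_flag \<kappa> b h) (total_transform \<kappa> a f) F' \<and>
    (complicacy_of \<epsilon> \<delta> F' < complicacy_of \<epsilon> \<delta> F \<or>
      (complicacy_of \<epsilon> \<delta> F' = complicacy_of \<epsilon> \<delta> F \<and> min_shade F' \<noteq> 0 \<and>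
        (min_updent F' < min_updent F \<or> (min_updent F' = min_updent F \<and> max_indent F' < max_indent F))))"
proof -
  have ne: "expansion a c f \<noteq> 0" if "c \<in> local_coordinates" for c
  proof
    assume z: "expansion a c f = 0"
    obtain Y Z where c: "c = (Y, Z)" by (cases c)
    note lc = that[unfolded c]
    have "mod_powers (germ a f) = mod_powers (subst2 0 Y Z)" using expansion_props(2)[OF p lc, of a f] z unfolding c by simp
    also have "\<dots> = 0" by (simp add: subst2_simps local_coordinates_max[OF lc] mod_powers_off_powers off_powers_def)
    finally show False using germ_power_imp_power[OF p] f by blast
  qed
  have rep: "represents a h f (expansion a c f)" and nd: "nondegenerate (expansion a c f)"
    if c: "c \<in> subordinate h" for c
  proof -
    have "c \<in> local_coordinates" using c by (auto simp: subordinate_def)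
    then show r: "represents a h f (expansion a c f)" by (intro representsI[OF p c] ne)
    show "nondegenerate (expansion a c f)" by (rule nondegenerate_expansion[OF p nm r c refl])
  qed
  obtain Y where Yh: "(Y, h) \<in> local_coordinates" using h by (auto simp: regular_parameter_def)
  have sub: "(Y, h) \<in> subordinate h" using Yh by (auto simp: subordinate_iff intro!: exI[of _ 1])
  define e where "e = germ b (exc_equation \<kappa>)"
  obtain v w where ch: "germ b (fst (chart_map \<kappa>)) = e * v" "germ b (snd (chart_map \<kappa>)) = e * w"
    and em: "e \<in> max_ideal" and jvw: "jac (const2 (coeff2 w 0 0) * v - const2 (coeff2 v 0 0) * w) e \<noteq> 0"
    using exceptional_chart[OF b] unfolding e_def by blast
  have chm: "germ b (fst (chart_map \<kappa>)) \<in> max_ideal" "germ b (snd (chart_map \<kappa>)) \<in> max_ideal"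
    using ch em by (auto intro: max_ideal_ops)
  have pb: "formal_pullback \<kappa> b F = subst2 F (e * v) (e * w)" for F
    by (simp add: formal_pullback_def ch)
  have evm: "e * v \<in> max_ideal" "e * w \<in> max_ideal" using em by (auto intro: max_ideal_ops)
  have e0: "coeff2 e 0 0 = 0" using em by (simp add: max_ideal_iff)
  have e_ne: "e \<noteq> 0" using jvw by (auto simp: jac_def)
  obtain V W where VW: "subst2 Y (e * v) (e * w) = e * V" "subst2 h (e * v) (e * w) = e * W"
    and J: "jac (const2 (coeff2 W 0 0) * V - const2 (coeff2 V 0 0) * W) e \<noteq> 0"
    using pulled_back_coordinates[OF em jvw Yh] by blast
  have ndvd: "\<not> e dvd W"
  proof
    assume "e dvd W"
    then obtain K where K: "W = e * K" by (elim dvdE)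
    have "jac (const2 (coeff2 W 0 0) * V - const2 (coeff2 V 0 0) * W) e = 0"
      unfolding K jac_linear by (simp add: jac_def coeff2_mult_lin coeff2_mult_00 e0)
    then show False using J by simp
  qed
  have st: "strict_transform \<kappa> b h = W"
    by (rule strict_transform_eq) (use VW ndvd e_ne in \<open>auto simp: pb e_def\<close>)
  define h' where "h' = induced_flag \<kappa> b h"
  have h': "h' = (if coeff2 W 0 0 = 0 then W else e)"
    by (simp add: h'_def induced_flag_def st max_ideal_iff e_def)
  have blow_m: "fps_y * fps_z \<in> (max_ideal :: 'k fps fps set)" by (simp add: max_ideal_ops)
  show ?thesis
  proof (cases "coeff2 W 0 0 = 0")
    case False
    \<comment> \<open>The strict transform of the flag misses \<open>b\<close>.\<close>
    define t where "t = coeff2 V 0 0 / coeff2 W 0 0"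
    have "W dvd 1" using False by (simp add: unit2_iff)
    then obtain W' where W': "W * W' = 1" using unit2_inverse by blast
    define Y1 where "Y1 = Y - const2 t * h"
    define z' where "z' = e * W"
    define y' where "y' = (V - const2 t * W) * W'"
    have "jac Y1 h = jac Y h"
      unfolding Y1_def jac_def coeff2_diff coeff2_const2_mult by (simp add: algebra_simps)
    then have c1: "(Y1, h) \<in> local_coordinates"
      using Yh unfolding local_coordinates_iff Y1_def by (simp add: max_ideal_ops)
    then have s1: "(Y1, h) \<in> subordinate h" by (auto simp: subordinate_iff intro!: exI[of _ 1])
    have W'0: "coeff2 W 0 0 * coeff2 W' 0 0 = 1" using W' by (metis coeff2_mult_00 coeff2_1)
    have V0: "coeff2 (V - const2 t * W) 0 0 = 0" using False by (simp add: t_def)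
    have jj: "jac y' z' = jac (V - const2 t * W) e"
    proof -
      have "jac y' z' = (coeff2 W 0 0 * coeff2 W' 0 0) * jac (V - const2 t * W) e"
        unfolding jac_def y'_def z'_def coeff2_mult_lin V0 e0 by algebra
      then show ?thesis using W'0 by simp
    qed
    have "coeff2 W 0 0 * jac (V - const2 t * W) e = jac (const2 (coeff2 W 0 0) * V - const2 (coeff2 V 0 0) * W) e"
      unfolding jac_linear unfolding jac_def coeff2_diff coeff2_const2_mult t_def
      using False by (simp add: field_simps)
    then have "jac (V - const2 t * W) e \<noteq> 0" using J by auto
    then have c1': "(y', z') \<in> local_coordinates"
      using V0 e0 jj by (simp add: local_coordinates_iff max_ideal_iff y'_def z'_def coeff2_mult_00)
    then have s1': "(y', z') \<in> subordinate h'"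
      using False \<open>W dvd 1\<close> by (auto simp: subordinate_iff h' z'_def intro!: exI[of _ W])
    have "y' * z' = e * (V - const2 t * W) * (W * W')" by (simp add: y'_def z'_def algebra_simps)
    then have yz: "y' * z' = e * (V - const2 t * W)" using W' by simp
    define F where "F = expansion a (Y1, h) f"
    have offF: "off_powers F" "F \<noteq> 0" using rep[OF s1] by (auto simp: F_def represents_def)
    have "expansion b (y', z') (total_transform \<kappa> a f) = blow_z F"
      unfolding F_def blow_z_def
    proof (rule expansion_transform[OF p c1 c1' chm blow_m fps_z_max])
      show "formal_pullback \<kappa> b Y1 = subst2 (fps_y * fps_z) y' z'" "formal_pullback \<kappa> b h = subst2 fps_z y' z'"
        using local_coordinates_max[OF c1'] yz
        by (simp_all add: pb Y1_def subst2_simps evm subst2_const_mult subst2_mult VW z'_def algebra_simps)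
      show "off_powers (subst2 (expansion a (Y1, h) f) (fps_y * fps_z) fps_z)"
        using off_powers_blow_z[OF offF(1)] by (simp add: F_def blow_z_def)
    qed
    then have rep': "represents b h' (total_transform \<kappa> a f) (blow_z F)"
      using representsI[OF p s1', of b "total_transform \<kappa> a f"] blow_z_ne_0[OF offF(2)] by simp
    have repF: "represents a h f F" and ndF: "nondegenerate F" using rep[OF s1] nd[OF s1] by (auto simp: F_def)
    show ?thesis
    proof (cases "\<exists>g. fps_nth g 0 = 0 \<and> ord_y (recoord (fps_X * g) F) = max_ord_y F")
      case True
      then obtain g where g: "fps_nth g 0 = 0" "ord_y (recoord (fps_X * g) F) = max_ord_y F" by blast
      have Xg: "fps_nth (fps_X * g) 0 = 0" by simp
      define F1 where "F1 = recoord (fps_X * g) F"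
      have r1: "represents a h f F1" unfolding F1_def by (rule represents_recoord[OF p repF Xg])
      have r1': "represents b h' (total_transform \<kappa> a f) (blow_z F1)"
        using represents_recoord[OF p rep' g(1)] by (simp add: recoord_blow_z g F1_def)
      have "nondegenerate F1" "ord_y F1 = max_ord_y F1"
        using nondegenerate_recoord(1,2)[OF p ndF Xg] g by (simp_all add: F1_def)
      from decrease_z_keeping[OF p this \<open>0 < \<epsilon>\<close> \<open>\<epsilon> < \<delta>\<close> \<open>\<delta> < 1\<close>] r1 r1'
      show ?thesis unfolding h'_def by blast
    next
      case False
      have "ord_y (recoord (fps_X * g) F) < max_ord_y F" if "fps_nth g 0 = 0" for g
        using max_ord_y_props(2)[OF p offF, of "fps_X * g"] False that by (simp add: le_neq_implies_less)
      from decrease_z_dropping[OF p ndF this \<open>0 < \<epsilon>\<close> \<open>\<epsilon> < \<delta>\<close> \<open>\<delta> < 1\<close>] repF rep'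
      show ?thesis unfolding h'_def by blast
    qed
  next
    case True
    define F0 where "F0 = expansion a (Y, h) f"
    have rep0: "represents a h f F0" using rep[OF sub] by (simp add: F0_def)
    have off0: "off_powers F0" "F0 \<noteq> 0" using rep0 by (auto simp: represents_def)
    obtain g where g: "g \<in> optimal_shifts F0" "updent (recoord g F0) = min_updent F0"
      using min_updent_props(1)[OF p off0] by blast
    have g0: "fps_nth g 0 = 0" "ord_y (recoord g F0) = max_ord_y F0" using g(1) by (auto simp: optimal_shifts_def)
    obtain c where c: "c \<in> subordinate h" "expansion a c f = recoord g F0"
      using rep0 g0 unfolding represents_def by blast
    obtain Yc Zc where cYZ: "c = (Yc, Zc)" by (cases c)
    define F where "F = recoord g F0"
    have Fc: "F = expansion a (Yc, Zc) f" using c cYZ by (simp add: F_def)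
    have sc: "(Yc, Zc) \<in> subordinate h" using c cYZ by simp
    then obtain u where lc: "(Yc, Zc) \<in> local_coordinates" and u: "u dvd 1" "Zc = u * h"
      by (auto simp: subordinate_iff)
    have repF: "represents a h f F" and ndF: "nondegenerate F" using rep[OF sc] nd[OF sc] by (auto simp: Fc)
    have offF: "off_powers F" "F \<noteq> 0" using repF by (auto simp: represents_def)
    have rF: "max_ord_y F = max_ord_y F0"
      unfolding F_def by (rule nondegenerate_recoord(2)[OF p _ g0(1)]) (use nd[OF sub] in \<open>simp add: F0_def\<close>)
    have optF: "ord_y F = max_ord_y F" using g0 rF by (simp add: F_def)
    have "min_updent F = min_updent F0"
      using represents_measures(3)[OF p repF] represents_measures(3)[OF p rep0] by simp
    then have updF: "updent F = min_updent F" using g by (simp add: F_def)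
    have "(Yc, Zc) \<in> realizing a h f"
      using represents_measures(5)[OF p repF] sc optF Fc by simp
    then have nqF: "\<not> quasi_monomial F" using nq Fc unfolding quasi_monomial_at_def by blast
    obtain Vc Wc where VWc: "subst2 Yc (e * v) (e * w) = e * Vc" "subst2 Zc (e * v) (e * w) = e * Wc"
      and Jc: "jac (const2 (coeff2 Wc 0 0) * Vc - const2 (coeff2 Vc 0 0) * Wc) e \<noteq> 0"
      using pulled_back_coordinates[OF em jvw lc] by blast
    define u' where "u' = subst2 u (e * v) (e * w)"
    have u': "u' dvd 1" using u(1) by (simp add: unit2_iff u'_def coeff2_subst2_00[OF evm])
    have "e * Wc = e * (u' * W)"
      using VWc(2) VW(2) unfolding u(2) subst2_mult[OF evm] u'_def[symmetric]
      by (metis mult.left_commute)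
    then have Wc: "Wc = u' * W" using e_ne by (simp only: mult_cancel_left) simp
    have Wc0: "coeff2 Wc 0 0 = 0" using True by (simp add: Wc coeff2_mult_00)
    have Vc0: "coeff2 Vc 0 0 \<noteq> 0"
    proof
      assume "coeff2 Vc 0 0 = 0"
      then show False using Jc Wc0 by (simp add: jac_def)
    qed
    then have "Vc dvd 1" by (simp add: unit2_iff)
    then obtain V' where V': "Vc * V' = 1" "V' dvd 1" using unit2_inverse by metis
    define y' where "y' = e * Vc"
    define z' where "z' = (V' * u') * W"
    have z'W: "z' = V' * Wc" by (simp add: z'_def Wc)
    have V'0: "coeff2 Vc 0 0 * coeff2 V' 0 0 = 1" using V'(1) by (metis coeff2_mult_00 coeff2_1)
    have "coeff2 Vc 0 0 * jac y' z' = jac (const2 (coeff2 Wc 0 0) * Vc - const2 (coeff2 Vc 0 0) * Wc) e"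
    proof -
      have "coeff2 Vc 0 0 * jac y' z' = (coeff2 Vc 0 0 * coeff2 V' 0 0) *
          jac (const2 (coeff2 Wc 0 0) * Vc - const2 (coeff2 Vc 0 0) * Wc) e"
        unfolding jac_linear unfolding jac_def y'_def z'W coeff2_mult_lin e0 Wc0 by algebra
      then show ?thesis using V'0 by simp
    qed
    then have "jac y' z' \<noteq> 0" using Jc by auto
    then have c1': "(y', z') \<in> local_coordinates"
      using e0 Wc0 by (simp add: local_coordinates_iff max_ideal_iff y'_def z'W coeff2_mult_00)
    have "V' * u' dvd 1" using V'(2) u' by (simp add: unit2_iff coeff2_mult_00)
    then have s1': "(y', z') \<in> subordinate h'"
      using c1' True by (auto simp: subordinate_iff h' z'_def intro!: exI[of _ "V' * u'"])
    have "y' * z' = e * Wc * (Vc * V')" by (simp add: y'_def z'W algebra_simps)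
    then have yz: "y' * z' = e * Wc" using V' by simp
    have "expansion b (y', z') (total_transform \<kappa> a f) = blow_y F"
      unfolding Fc blow_y_def
    proof (rule expansion_transform[OF p lc c1' chm fps_y_max blow_m])
      show "formal_pullback \<kappa> b Yc = subst2 fps_y y' z'" "formal_pullback \<kappa> b Zc = subst2 (fps_y * fps_z) y' z'"
        using local_coordinates_max[OF c1'] yz[symmetric]
        by (simp_all add: pb subst2_simps subst2_mult VWc y'_def)
      show "off_powers (subst2 (expansion a (Yc, Zc) f) fps_y (fps_y * fps_z))"
        using off_powers_blow_y[OF offF(1)] by (simp add: Fc blow_y_def)
    qed
    then have rep': "represents b h' (total_transform \<kappa> a f) (blow_y F)"
      using representsI[OF p s1', of b "total_transform \<kappa> a f"] blow_y_ne_0[OF offF(2)] by simp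
    from decrease_y[OF p ndF optF updF nqF \<open>0 < \<epsilon>\<close> \<open>\<epsilon> < \<delta>\<close> \<open>\<delta> < 1\<close>] repF rep'
    show ?thesis unfolding h'_def by blast
  qed
qed

theorem mainTheorem5:
  fixes p :: nat and \<epsilon> \<delta> :: real
    and a a' :: "'k::alg_closed_field \<times> 'k"
    and h :: "'k fps fps"
    and f :: "'k poly poly"
    and \<kappa> :: chart
  assumes "CHAR('k) = p" and "p > 0"
    and "0 < \<epsilon>" and "\<epsilon> < \<delta>" and "\<delta> < 1"
    and "regular_parameter h"
    and "f \<notin> range (\<lambda>q. q ^ p)"
    and "\<not> monomial_at a f"
    and "\<not> quasi_monomial_at a h f"
    and "a' \<in> exc_points \<kappa>"
  shows "let h' = induced_flag \<kappa> a' h; f' = total_transform \<kappa> a f in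
    if quadrant_at a' h' f'
    then complicacy_at \<epsilon> \<delta> a' h' f' < complicacy_at \<epsilon> \<delta> a h f
    else ((complicacy_at \<epsilon> \<delta> a' h' f', dent_at a' h' f'),
          (complicacy_at \<epsilon> \<delta> a h f, dent_at a h f)) \<in> lex_less"
proof -
  have p: "prime CHAR('k)" using assms(1,2) by (intro prime_CHAR_semidom) simp
  have "f \<notin> range (\<lambda>q. q ^ CHAR('k))" using assms(1,7) by simp
  from blowup_decrease[OF p assms(3,4,5,6) this assms(8,9,10)]
  obtain F F' where "represents a h f F" "represents a' (induced_flag \<kappa> a' h) (total_transform \<kappa> a f) F'"
    "complicacy_of \<epsilon> \<delta> F' < complicacy_of \<epsilon> \<delta> F \<or>
      (complicacy_of \<epsilon> \<delta> F' = complicacy_of \<epsilon> \<delta> F \<and> min_shade F' \<noteq> 0 \<and>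
        (min_updent F' < min_updent F \<or> (min_updent F' = min_updent F \<and> max_indent F' < max_indent F)))"
    by blast
  then show ?thesis unfolding Let_def by (rule invariant_decreases[OF p])
qed

end
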